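(* Let $M$ and $N$ be Riemannian manifolds and let $\mathcal{F}$ be a foliation on $M$ given by (the level sets of) a submersion $\Phi:M\to N$. Assume that $J\Phi<C$ on $M$ for some constant $C$, and that $\mu_M(M)<\infty$. Then, for any $p>1$, there exists an extremal function for the $p$-modulus of $\mathcal{F}$ if and only if $\mu_M(M_\infty)=0$.
   Context: $\mu_M$ and $\mu_L$ denote the Lebesgue (Riemannian volume) measures on $M$ and on a leaf $L\in\mathcal{F}$; the leaves of $\mathcal{F}$ are the level sets $\Phi^{-1}(y)$. Put $\mathcal{F}_\infty=\{L\in\mathcal{F}:\ \mu_L(L)=\infty\}$ and $M_\infty=\bigcup\mathcal{F}_\infty$. Jacobian: let $\mathcal{V}^\Phi=\ker\Phi_*$ and $\mathcal{H}^\Phi=(\mathcal{V}^\Phi)^\perp$, so that $\Phi_*:\mathcal{H}^\Phi\to TN$ is a fibrewise linear isomorphism with adjoint $\Phi_*^\top:TN\to\mathcal{H}^\Phi$; then $J\Phi=\sqrt{\det(\Phi_*^\top\circ\Phi_*:\mathcal{H}^\Phi\to\mathcal{H}^\Phi)}$. Modulus: a property holds for almost every $L\in\mathcal{F}$ if the union of the leaves for which it fails has $\mu_M$-measure zero. $\mathrm{adm}_p(\mathcal{F})$ is the family of all nonnegative $f\in L^p(M)$ such that $\int_L f\,d\mu_L\geq 1$ for almost every $L\in\mathcal{F}$; $\mathrm{mod}_p(\mathcal{F})=\inf_{f\in\mathrm{adm}_p(\mathcal{F})}\|f\|_p$ if $\mathrm{adm}_p(\mathcal{F})\neq\emptyset$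 and $\mathrm{mod}_p(\mathcal{F})=\infty$ otherwise. A function $f_0\in\mathrm{adm}_p(\mathcal{F})$ is extremal for the $p$-modulus of $\mathcal{F}$ if $\mathrm{mod}_p(\mathcal{F})=\|f_0\|_p$.
   Formalization: The formal theorem also assumes that adm_p(F) is nonempty (mod_p(F) finite); without this the claim fails, e.g. M={0<y<1, 0<x<y^a} in the plane, Φ=y, a(p-1)≥1, where M_∞ is empty but no admissible function exists. *)

theory Defs
  imports "HOL-Analysis.Analysis"
begin

section \<open>Smooth maps between Euclidean spaces\<close>

text \<open>Both predicates are meant for open sets \<open>S\<close>. In finite dimension, \<open>f\<close> is \<open>C\<^sup>k\<^sup>+\<^sup>1\<close> iff it is
  differentiable and all its directional derivatives are \<open>C\<^sup>k\<close>.\<close>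

primrec Ck_on :: "nat \<Rightarrow> ('a::euclidean_space \<Rightarrow> 'b::real_normed_vector) \<Rightarrow> 'a set \<Rightarrow> bool" where
  "Ck_on 0 f S \<longleftrightarrow> continuous_on S f"
| "Ck_on (Suc k) f S \<longleftrightarrow> (\<forall>x\<in>S. f differentiable (at x)) \<and>
      (\<forall>v. Ck_on k (\<lambda>x. frechet_derivative f (at x) v) S)"

definition smooth_on :: "'a::euclidean_space set \<Rightarrow> ('a \<Rightarrow> 'b::real_normed_vector) \<Rightarrow> bool" where
  "smooth_on S f \<longleftrightarrow> (\<forall>k. Ck_on k f S)"

section \<open>Riemannian manifolds\<close>

text \<open>A chart is a pair of a domain \<open>U\<close> and a map on \<open>U\<close> into the model space \<open>'e\<close>; the values of the
  map outside \<open>U\<close> are irrelevant. The carrier \<open>points X\<close> carries the subspace topology of its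
  type, which is Hausdorff and second countable by the class constraints below.

  The Riemannian metric is a tensor field given by its local expressions:
  \<open>metric X c y u v\<close> is the inner product, at the point with coordinates \<open>y\<close> in the chart \<open>c\<close>, of
  the tangent vectors with coordinates \<open>u\<close> and \<open>v\<close> in \<open>c\<close>.\<close>

type_synonym ('p, 'e) chart = "'p set \<times> ('p \<Rightarrow> 'e)"

record ('p, 'e) rmanifold =
  points :: "'p set"
  atlas :: "('p, 'e) chart set"
  metric :: "('p, 'e) chart \<Rightarrow> 'e \<Rightarrow> 'e \<Rightarrow> 'e \<Rightarrow> real"

definition is_chart ::
  "'p::topological_space set \<Rightarrow> ('p, 'e::euclidean_space) chart \<Rightarrow> bool" where
  "is_chart P c \<longleftrightarrow> openin (top_of_set P) (fst c) \<and> open (snd c ` fst c) \<and>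
     (\<exists>g. homeomorphism (fst c) (snd c ` fst c) (snd c) g)"

definition chart_inv :: "('p, 'e) chart \<Rightarrow> 'e \<Rightarrow> 'p" where
  "chart_inv c = inv_into (fst c) (snd c)"

definition transition :: "('p, 'e) chart \<Rightarrow> ('p, 'e) chart \<Rightarrow> 'e \<Rightarrow> 'e" where
  "transition c d = snd d \<circ> chart_inv c"

definition smooth_compatible ::
  "('p, 'e::euclidean_space) chart \<Rightarrow> ('p, 'e) chart \<Rightarrow> bool" where
  "smooth_compatible c d \<longleftrightarrow>
     smooth_on (snd c ` (fst c \<inter> fst d)) (transition c d) \<and>
     smooth_on (snd d ` (fst c \<inter> fst d)) (transition d c)"

text \<open>The smooth structure is a maximal smooth atlas.\<close>

definition smooth_manifold ::
  "('p::{t2_space, second_countable_topology}, 'e::euclidean_space) rmanifold \<Rightarrow> bool" where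
  "smooth_manifold X \<longleftrightarrow>
     (\<forall>c\<in>atlas X. is_chart (points X) c) \<and>
     \<Union>(fst ` atlas X) = points X \<and>
     (\<forall>c\<in>atlas X. \<forall>d\<in>atlas X. smooth_compatible c d) \<and>
     (\<forall>c. is_chart (points X) c \<and> (\<forall>d\<in>atlas X. smooth_compatible c d) \<longrightarrow> c \<in> atlas X)"

definition riemannian_manifold ::
  "('p::{t2_space, second_countable_topology}, 'e::euclidean_space) rmanifold \<Rightarrow> bool" where
  "riemannian_manifold X \<longleftrightarrow> smooth_manifold X \<and>
     (\<forall>c\<in>atlas X.
        (\<forall>u v. smooth_on (snd c ` fst c) (\<lambda>y. metric X c y u v)) \<and>
        (\<forall>y\<in>snd c ` fst c.
           bilinear (metric X c y) \<and>
           (\<forall>u v. metric X c y u v = metric X c y v u) \<and>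
           (\<forall>u. u \<noteq> 0 \<longrightarrow> metric X c y u u > 0))) \<and>
     (\<forall>c\<in>atlas X. \<forall>d\<in>atlas X. \<forall>x\<in>fst c \<inter> fst d. \<forall>u v.
        metric X c (snd c x) u v =
        metric X d (snd d x)
          (frechet_derivative (transition c d) (at (snd c x)) u)
          (frechet_derivative (transition c d) (at (snd c x)) v))"

section \<open>Riemannian volume\<close>

text \<open>Determinant of a matrix with rows and columns indexed by a finite set \<open>B\<close> (the Leibniz
  formula; \<^const>\<open>det\<close> is its instance for an index type). It is \<open>1\<close> for empty \<open>B\<close>.\<close>

definition det_on :: "'i set \<Rightarrow> ('i \<Rightarrow> 'i \<Rightarrow> real) \<Rightarrow> real" where
  "det_on B G = (\<Sum>p | p permutes B. of_int (sign p) * (\<Prod>i\<in>B. G i (p i)))"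

text \<open>Lebesgue measure of the coordinate subspace \<open>span B\<close>, for \<open>B \<subseteq> Basis\<close>, as a Borel measure on
  the whole space that is concentrated on \<open>span B\<close>. For \<open>B = Basis\<close> it is \<^const>\<open>lborel\<close>, for
  \<open>B = {}\<close> the unit mass at \<open>0\<close>.\<close>

definition lborel_span :: "'e::euclidean_space set \<Rightarrow> 'e measure" where
  "lborel_span B = distr (\<Pi>\<^sub>M b\<in>B. lborel) borel (\<lambda>t. \<Sum>b\<in>B. t b *\<^sub>R b)"

text \<open>A chart of \<open>X\<close> that flattens the subset \<open>S\<close> to the coordinate subspace \<open>span B\<close>. A subset
  covered by such charts, with \<open>card B = k\<close>, is an embedded \<open>k\<close>-dimensional submanifold, and the
  restrictions of the charts to \<open>S\<close> form a smooth atlas of it. For \<open>S = points X\<close> every chart is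
  a slice chart with \<open>B = Basis\<close>.\<close>

definition slice_chart ::
  "('p, 'e::euclidean_space) rmanifold \<Rightarrow> 'p set \<Rightarrow> ('p, 'e) chart \<Rightarrow> 'e set \<Rightarrow> bool" where
  "slice_chart X S c B \<longleftrightarrow> c \<in> atlas X \<and> B \<subseteq> Basis \<and>
     snd c ` (fst c \<inter> S) = snd c ` fst c \<inter> span B"

text \<open>The Riemannian volume of an embedded submanifold \<open>S\<close> with the induced metric: the unique Borel
  measure on \<open>S\<close> that is \<open>sqrt (det (g\<^sub>i\<^sub>j)) dy\<close> in local coordinates. The coordinates on \<open>S\<close> are those
  of a slice chart, where the components of the induced metric are the \<open>g (b, b')\<close> with
  \<open>b, b' \<in> B\<close>. The volume of \<open>X\<close> itself is the case \<open>S = points X\<close>.\<close>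

definition is_riemannian_volume ::
  "('p::topological_space, 'e::euclidean_space) rmanifold \<Rightarrow> 'p set \<Rightarrow> 'p measure \<Rightarrow> bool" where
  "is_riemannian_volume X S \<mu> \<longleftrightarrow>
     sets \<mu> = sets (restrict_space borel S) \<and>
     (\<forall>c B. slice_chart X S c B \<longrightarrow> (\<forall>A\<in>sets \<mu>. A \<subseteq> fst c \<longrightarrow>
        emeasure \<mu> A = (\<integral>\<^sup>+y\<in>snd c ` A. ennreal (sqrt (det_on B (metric X c y))) \<partial>lborel_span B)))"

definition riemannian_volume ::
  "('p::topological_space, 'e::euclidean_space) rmanifold \<Rightarrow> 'p set \<Rightarrow> 'p measure" where
  "riemannian_volume X S = (THE \<mu>. is_riemannian_volume X S \<mu>)"

definition lebesgue_volume ::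
  "('p::topological_space, 'e::euclidean_space) rmanifold \<Rightarrow> 'p set \<Rightarrow> 'p measure" where
  "lebesgue_volume X S = completion (riemannian_volume X S)"

section \<open>Submersions and their Jacobian\<close>

definition smooth_map ::
  "('p::topological_space, 'e::euclidean_space) rmanifold \<Rightarrow>
   ('q::topological_space, 'f::euclidean_space) rmanifold \<Rightarrow> ('p \<Rightarrow> 'q) \<Rightarrow> bool" where
  "smooth_map M N \<Phi> \<longleftrightarrow> \<Phi> ` points M \<subseteq> points N \<and> continuous_on (points M) \<Phi> \<and>
     (\<forall>c\<in>atlas M. \<forall>d\<in>atlas N.
        smooth_on (snd c ` (fst c \<inter> \<Phi> -` fst d)) (snd d \<circ> \<Phi> \<circ> chart_inv c))"

text \<open>The tangent space at \<open>x\<close> is identified with the model space by means of an arbitrary but fixed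
  chart around \<open>x\<close>. The notions below that do not mention tangent vectors, namely
  \<open>submersion\<close> and \<open>submersion_jacobian\<close>, do not depend on this choice.\<close>

definition chart_at :: "('p, 'e) rmanifold \<Rightarrow> 'p \<Rightarrow> ('p, 'e) chart" where
  "chart_at X x = (SOME c. c \<in> atlas X \<and> x \<in> fst c)"

definition metric_at :: "('p, 'e) rmanifold \<Rightarrow> 'p \<Rightarrow> 'e \<Rightarrow> 'e \<Rightarrow> real" where
  "metric_at X x = metric X (chart_at X x) (snd (chart_at X x) x)"

definition differential ::
  "('p, 'e::euclidean_space) rmanifold \<Rightarrow> ('q, 'f::euclidean_space) rmanifold \<Rightarrow>
   ('p \<Rightarrow> 'q) \<Rightarrow> 'p \<Rightarrow> 'e \<Rightarrow> 'f" where
  "differential M N \<Phi> x =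
     frechet_derivative (snd (chart_at N (\<Phi> x)) \<circ> \<Phi> \<circ> chart_inv (chart_at M x))
       (at (snd (chart_at M x) x))"

definition submersion ::
  "('p::topological_space, 'e::euclidean_space) rmanifold \<Rightarrow>
   ('q::topological_space, 'f::euclidean_space) rmanifold \<Rightarrow> ('p \<Rightarrow> 'q) \<Rightarrow> bool" where
  "submersion M N \<Phi> \<longleftrightarrow> smooth_map M N \<Phi> \<and> (\<forall>x\<in>points M. surj (differential M N \<Phi> x))"

definition vertical ::
  "('p, 'e::euclidean_space) rmanifold \<Rightarrow> ('q, 'f::euclidean_space) rmanifold \<Rightarrow>
   ('p \<Rightarrow> 'q) \<Rightarrow> 'p \<Rightarrow> 'e set" where
  "vertical M N \<Phi> x = {v. differential M N \<Phi> x v = 0}"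

definition horizontal ::
  "('p, 'e::euclidean_space) rmanifold \<Rightarrow> ('q, 'f::euclidean_space) rmanifold \<Rightarrow>
   ('p \<Rightarrow> 'q) \<Rightarrow> 'p \<Rightarrow> 'e set" where
  "horizontal M N \<Phi> x = {u. \<forall>v\<in>vertical M N \<Phi> x. metric_at M x u v = 0}"

text \<open>The adjoint of the differential restricted to the horizontal space, with respect to the two
  Riemannian metrics.\<close>

definition differential_adjoint ::
  "('p, 'e::euclidean_space) rmanifold \<Rightarrow> ('q, 'f::euclidean_space) rmanifold \<Rightarrow>
   ('p \<Rightarrow> 'q) \<Rightarrow> 'p \<Rightarrow> 'f \<Rightarrow> 'e" where
  "differential_adjoint M N \<Phi> x w = (THE u. u \<in> horizontal M N \<Phi> x \<and>
     (\<forall>v\<in>horizontal M N \<Phi> x.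
        metric_at M x u v = metric_at N (\<Phi> x) w (differential M N \<Phi> x v)))"

text \<open>Determinant of a linear endomorphism \<open>T\<close> of a subspace \<open>W\<close>, computed in any basis of \<open>W\<close>.\<close>

definition det_endo :: "'e::euclidean_space set \<Rightarrow> ('e \<Rightarrow> 'e) \<Rightarrow> real" where
  "det_endo W T = (let B = (SOME B. independent B \<and> span B = W)
     in det_on B (\<lambda>b b'. representation B (T b') b))"

definition submersion_jacobian ::
  "('p, 'e::euclidean_space) rmanifold \<Rightarrow> ('q, 'f::euclidean_space) rmanifold \<Rightarrow>
   ('p \<Rightarrow> 'q) \<Rightarrow> 'p \<Rightarrow> real" where
  "submersion_jacobian M N \<Phi> x = sqrt (det_endo (horizontal M N \<Phi> x)
     (differential_adjoint M N \<Phi> x \<circ> differential M N \<Phi> x))"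

section \<open>The modulus of the foliation by level sets\<close>

definition leaves :: "('p, 'e) rmanifold \<Rightarrow> ('p \<Rightarrow> 'q) \<Rightarrow> 'p set set" where
  "leaves M \<Phi> = {{x \<in> points M. \<Phi> x = y} | y. y \<in> \<Phi> ` points M}"

definition infinite_leaves ::
  "('p::topological_space, 'e::euclidean_space) rmanifold \<Rightarrow> ('p \<Rightarrow> 'q) \<Rightarrow> 'p set set" where
  "infinite_leaves M \<Phi> = {L \<in> leaves M \<Phi>. emeasure (lebesgue_volume M L) L = \<infinity>}"

definition almost_every_leaf ::
  "('p::topological_space, 'e::euclidean_space) rmanifold \<Rightarrow> ('p \<Rightarrow> 'q) \<Rightarrow>
   ('p set \<Rightarrow> bool) \<Rightarrow> bool" where
  "almost_every_leaf M \<Phi> P \<longleftrightarrow>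
     \<Union>{L \<in> leaves M \<Phi>. \<not> P L} \<in> null_sets (lebesgue_volume M (points M))"

definition Lp_norm ::
  "('p::topological_space, 'e::euclidean_space) rmanifold \<Rightarrow> real \<Rightarrow> ('p \<Rightarrow> real) \<Rightarrow> real" where
  "Lp_norm M p f = (LINT x|lebesgue_volume M (points M). \<bar>f x\<bar> powr p) powr (1 / p)"

definition in_Lp ::
  "('p::topological_space, 'e::euclidean_space) rmanifold \<Rightarrow> real \<Rightarrow> ('p \<Rightarrow> real) \<Rightarrow> bool" where
  "in_Lp M p f \<longleftrightarrow> f \<in> borel_measurable (lebesgue_volume M (points M)) \<and>
     integrable (lebesgue_volume M (points M)) (\<lambda>x. \<bar>f x\<bar> powr p)"

definition adm ::
  "('p::topological_space, 'e::euclidean_space) rmanifold \<Rightarrow> ('p \<Rightarrow> 'q) \<Rightarrow> real \<Rightarrow>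
   ('p \<Rightarrow> real) set" where
  "adm M \<Phi> p = {f. in_Lp M p f \<and> (\<forall>x\<in>points M. f x \<ge> 0) \<and>
     almost_every_leaf M \<Phi> (\<lambda>L. (\<integral>\<^sup>+x. ennreal (f x) \<partial>lebesgue_volume M L) \<ge> 1)}"

definition modulus ::
  "('p::topological_space, 'e::euclidean_space) rmanifold \<Rightarrow> ('p \<Rightarrow> 'q) \<Rightarrow> real \<Rightarrow> ennreal" where
  "modulus M \<Phi> p =
     (if adm M \<Phi> p \<noteq> {} then (INF f\<in>adm M \<Phi> p. ennreal (Lp_norm M p f)) else \<infinity>)"

definition extremal ::
  "('p::topological_space, 'e::euclidean_space) rmanifold \<Rightarrow> ('p \<Rightarrow> 'q) \<Rightarrow> real \<Rightarrow>
   ('p \<Rightarrow> real) \<Rightarrow> bool" where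
  "extremal M \<Phi> p f\<^sub>0 \<longleftrightarrow> f\<^sub>0 \<in> adm M \<Phi> p \<and> modulus M \<Phi> p = ennreal (Lp_norm M p f\<^sub>0)"

end

theory Submission
  imports Defs
begin

text \<open>
  Put \<open>J = J\<Phi>\<close>. The coarea formula \<open>\<integral>\<^sub>M f J d\<mu>\<^sub>M = \<integral>\<^sub>N \<integral>\<^sub>L f d\<mu>\<^sub>L d\<mu>\<^sub>N\<close>, with \<open>L\<close> the leaf over the point
  of \<open>N\<close>, shows for \<open>f = 1\<close> that almost every leaf has finite volume when \<open>J < C\<close> and \<open>\<mu>\<^sub>M(M) < \<infinity>\<close>.
  So \<open>M\<^sub>\<infinity>\<close> is always a null set under the hypotheses, and what is left is to exhibit an extremal
  function. It is \<open>f\<^sub>0 = J\<^sup>q / I\<close> with \<open>q = 1/(p - 1)\<close>, where \<open>I = \<integral>\<^sub>L J\<^sup>q d\<mu>\<^sub>L\<close> is constant on each leaf \<open>L\<close>.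
  Indeed \<open>f\<^sub>0\<close> has integral \<open>1\<close> over almost every leaf, and for every admissible \<open>f\<close> the tangent inequality
  \<open>f\<^sup>p \<ge> f\<^sub>0\<^sup>p + p f\<^sub>0\<^bsup>p-1\<^esup> (f - f\<^sub>0)\<close>, divided by \<open>J\<close> and integrated over \<open>L\<close>, gives
  \<open>\<integral>\<^sub>L f\<^sup>p/J d\<mu>\<^sub>L \<ge> \<integral>\<^sub>L f\<^sub>0\<^sup>p/J d\<mu>\<^sub>L\<close>, since \<open>f\<^sub>0\<^bsup>p-1\<^esup>/J\<close> is constant on \<open>L\<close>; the coarea formula turns this into
  \<open>\<parallel>f\<parallel>\<^sub>p \<ge> \<parallel>f\<^sub>0\<parallel>\<^sub>p\<close>.
\<close>

section \<open>Determinants over finite index sets\<close>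

text \<open>The formula for \<open>f0\<close> is the Lagrange condition for minimising the integral
  of f^p / J over one leaf among functions of integral 1 on it: f^(p-1) / J has to be constant along
  the leaf. The geometry sits in the coarea formula. It is local: around every point some chart of
  \<open>M\<close> turns \<Phi> into a projection to part of the coordinates, and there it is
  Fubini's theorem together with J * sqrt (det g_M) = sqrt (det g_L) * sqrt (det g_N) for the Gram
  determinants of \<open>M\<close>, the leaf and \<open>N\<close>. Countably many disjoint pieces of
  charts make it global. Leaves of volume zero are not excluded by geometry; the coarea formula
  itself shows that their union is null. An admissible function is measurable only for the completed
  volume, so it is replaced by a Borel function; the null set where the two differ meets almost
  every leaf in a null set. That \<open>f0\<close> has finite norm is not clear from its formula: it
  follows by comparison with some admissible function.\<close>

lemma det_on_cong: "A = B \<Longrightarrow> (\<And>i j. i \<in> B \<Longrightarrow> j \<in> B \<Longrightarrow> G i j = H i j) \<Longrightarrow> det_on A G = det_on B H"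
  unfolding det_on_def
  by (auto intro!: sum.cong arg_cong2[where f="(*)"] prod.cong simp: permutes_in_image)

text \<open>Conjugation by \<open>f\<close> is a sign-preserving bijection from the permutations of
  \<open>A\<close> to those of \<open>B\<close>.\<close>

lemma det_on_reindex:
  assumes f: "bij_betw f A B" and A: "finite A"
  shows "det_on A (\<lambda>i j. G (f i) (f j)) = det_on B G"
proof -
  have inj: "inj_on f A" and fA: "f ` A = B" using f by (auto simp: bij_betw_def)
  let ?g = "inv_into A f"
  have g: "bij_betw ?g B A" using f by (rule bij_betw_inv_into)
  have 1: "map_permutation B ?g (map_permutation A f p) = p" if "p permutes A" for p
    by (rule map_permutation_compose_inv[OF f that]) (simp add: inj)
  have 2: "map_permutation A f (map_permutation B ?g p) = p" if "p permutes B" for p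
    by (rule map_permutation_compose_inv[OF g that]) (simp add: fA f_inv_into_f)
  show ?thesis
    unfolding det_on_def
  proof (rule sum.reindex_bij_witness[of _ "map_permutation B ?g" "map_permutation A f"])
    fix p assume "p \<in> {p. p permutes A}"
    then have p: "p permutes A" by simp
    show "map_permutation B ?g (map_permutation A f p) = p" by (rule 1[OF p])
    show "map_permutation A f p \<in> {p. p permutes B}"
      using map_permutation_permutes[OF f p] by simp
    have "sign (map_permutation A f p) = sign p"
      using inj A p by (intro sign_map_permutation) auto
    moreover have "(\<Prod>i\<in>B. G i (map_permutation A f p i)) = (\<Prod>i\<in>A. G (f i) (f (p i)))"
      by (rule prod.reindex_cong[OF inj fA[symmetric]]) (simp add: map_permutation_apply[OF inj])
    ultimately show "of_int (sign (map_permutation A f p)) * (\<Prod>i\<in>B. G i (map_permutation A f p i)) =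
       of_int (sign p) * (\<Prod>i\<in>A. G (f i) (f (p i)))" by simp
  next
    fix p assume "p \<in> {p. p permutes B}"
    then have p: "p permutes B" by simp
    show "map_permutation A f (map_permutation B ?g p) = p" by (rule 2[OF p])
    show "map_permutation B ?g p \<in> {p. p permutes A}"
      using map_permutation_permutes[OF g p] by simp
  qed
qed

lemma det_on_transpose:
  assumes "finite B" shows "det_on B (\<lambda>i j. G j i) = det_on B G"
  unfolding det_on_def
proof (rule sum.reindex_bij_witness[of _ inv inv])
  fix p assume "p \<in> {p. p permutes B}"
  then have p: "p permutes B" by simp
  then have "permutation p" using assms permutation_permutes by blast
  then have "sign (inv p) = sign p" by (rule sign_inverse)
  moreover have "(\<Prod>i\<in>B. G i (inv p i)) = (\<Prod>i\<in>B. G (p i) i)"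
    by (rule prod.reindex_cong[of p])
       (use p in \<open>auto simp: permutes_inj_on permutes_image permutes_inverses\<close>)
  ultimately show "of_int (sign (inv p)) * (\<Prod>i\<in>B. G i (inv p i)) = of_int (sign p) * (\<Prod>i\<in>B. G (p i) i)"
    by simp
qed (auto simp: permutes_inv permutes_inv_inv)

text \<open>A permutation that moves a point of \<open>A\<close> contributes a zero factor. This
  expansion along unit rows serves below for all triangular and padded matrices.\<close>

lemma det_on_delta_rows:
  assumes fin: "finite A" "finite B" and disj: "A \<inter> B = {}"
    and delta: "\<And>i j. i \<in> A \<Longrightarrow> j \<in> A \<union> B \<Longrightarrow> G i j = (if i = j then 1 else 0)"
  shows "det_on (A \<union> B) G = det_on B G"
  unfolding det_on_def
proof (rule sum.mono_neutral_cong_right)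
  show "finite {p. p permutes A \<union> B}" using fin finite_permutations by blast
  show "{p. p permutes B} \<subseteq> {p. p permutes A \<union> B}" using permutes_subset by blast
  show "\<forall>p\<in>{p. p permutes A \<union> B} - {p. p permutes B}. of_int (sign p) * (\<Prod>i\<in>A\<union>B. G i (p i)) = 0"
  proof
    fix p assume "p \<in> {p. p permutes A \<union> B} - {p. p permutes B}"
    then have p: "p permutes A \<union> B" "\<not> p permutes B" by auto
    have "\<exists>i\<in>A. p i \<noteq> i"
    proof (rule ccontr)
      assume "\<not> ?thesis"
      then have "p permutes B" using p(1) disj
        by (intro permutes_superset[OF p(1)]) auto
      with p(2) show False by simp
    qed
    then obtain i where i: "i \<in> A" "p i \<noteq> i" by auto
    then have "G i (p i) = 0" using delta[of i "p i"] permutes_in_image[OF p(1), of i] by auto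
    then have "(\<Prod>i\<in>A\<union>B. G i (p i)) = 0" using i fin by (intro prod_zero) auto
    then show "of_int (sign p) * (\<Prod>i\<in>A\<union>B. G i (p i)) = 0" by simp
  qed
  fix p assume "p \<in> {p. p permutes B}"
  then have p: "p permutes B" by simp
  have "(\<Prod>i\<in>A. G i (p i)) = 1"
  proof (intro prod.neutral ballI)
    fix i assume i: "i \<in> A"
    then have "p i = i" using disj by (intro permutes_not_in[OF p]) auto
    with i show "G i (p i) = 1" using delta by simp
  qed
  then show "of_int (sign p) * (\<Prod>i\<in>A\<union>B. G i (p i)) = of_int (sign p) * (\<Prod>i\<in>B. G i (p i))"
    using fin disj by (simp add: prod.union_disjoint)
qed

lemma det_on_permute_rows:
  assumes fin: "finite B" and f: "f permutes B"
  shows "det_on B (\<lambda>i j. G (f i) j) = of_int (sign f) * det_on B G"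
proof -
  have "det_on B (\<lambda>i j. G (f i) j) = (\<Sum>p | p permutes B. of_int (sign f) * (of_int (sign p) * (\<Prod>i\<in>B. G i (p i))))"
    unfolding det_on_def
  proof (rule sum.reindex_bij_witness[of _ "\<lambda>p. p \<circ> f" "\<lambda>p. p \<circ> inv f"])
    fix p assume "p \<in> {p. p permutes B}"
    then have p: "p permutes B" by simp
    have perm: "permutation p" "permutation f" "permutation (inv f)"
      using p f fin permutation_permutes permutation_inverse by blast+
    show "p \<circ> inv f \<circ> f = p" using f by (simp add: fun_eq_iff permutes_inverses)
    show "p \<circ> inv f \<in> {p. p permutes B}" using f p by (simp add: permutes_compose permutes_inv)
    have "sign (p \<circ> inv f) = sign p * sign f"
      using perm by (simp add: sign_compose sign_inverse)
    moreover have "(\<Prod>i\<in>B. G i ((p \<circ> inv f) i)) = (\<Prod>i\<in>B. G (f i) (p i))"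
      by (rule prod.reindex_cong[of f])
         (use f in \<open>auto simp: permutes_inj_on permutes_image permutes_inverses\<close>)
    moreover have "real_of_int (sign f) * of_int (sign f) = 1"
      unfolding of_int_mult[symmetric] by simp
    ultimately show "of_int (sign f) * (of_int (sign (p \<circ> inv f)) * (\<Prod>i\<in>B. G i ((p \<circ> inv f) i))) =
        of_int (sign p) * (\<Prod>i\<in>B. G (f i) (p i))"
      by (metis (no_types, lifting) mult.assoc mult.commute mult_1 of_int_mult)
  next
    fix p assume "p \<in> {p. p permutes B}"
    then have p: "p permutes B" by simp
    show "p \<circ> f \<circ> inv f = p" using f by (simp add: fun_eq_iff permutes_inverses)
    show "p \<circ> f \<in> {p. p permutes B}" using f p by (simp add: permutes_compose)
  qed
  then show ?thesis by (simp add: det_on_def sum_distrib_left)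
qed

text \<open>Swapping the two rows changes the sign of the determinant but not the matrix.\<close>

lemma det_on_identical_rows:
  assumes fin: "finite B" and ab: "a \<in> B" "b \<in> B" "a \<noteq> b" and eq: "\<And>j. j \<in> B \<Longrightarrow> G a j = G b j"
  shows "det_on B G = 0"
proof -
  let ?t = "Transposition.transpose a b"
  have t: "?t permutes B" using ab by (simp add: permutes_swap_id)
  have "det_on B G = det_on B (\<lambda>i j. G (?t i) j)"
    by (rule det_on_cong) (auto simp: Transposition.transpose_def eq)
  also have "\<dots> = - det_on B G"
    unfolding det_on_permute_rows[OF fin t] using ab by (simp add: sign_swap_id)
  finally show ?thesis by simp
qed

text \<open>Expanding the product of sums gives one term for each map \<open>f\<close> of
  \<open>B\<close> into itself, with the determinant of the rows \<open>Y (f i)\<close> as a factor.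
  A map that is not injective produces two equal rows, so only permutations remain, and each
  contributes its sign.\<close>

lemma det_on_mult:
  assumes fin: "finite B"
  shows "det_on B (\<lambda>i j. \<Sum>k\<in>B. X i k * Y k j) = det_on B X * det_on B Y"
proof -
  have "det_on B (\<lambda>i j. \<Sum>k\<in>B. X i k * Y k j) =
     (\<Sum>p | p permutes B. of_int (sign p) * (\<Sum>f\<in>B \<rightarrow>\<^sub>E B. \<Prod>i\<in>B. X i (f i) * Y (f i) (p i)))"
    unfolding det_on_def using fin by (simp add: prod_sum_PiE)
  also have "\<dots> = (\<Sum>p | p permutes B. \<Sum>f\<in>B \<rightarrow>\<^sub>E B. (\<Prod>i\<in>B. X i (f i)) * (of_int (sign p) * (\<Prod>i\<in>B. Y (f i) (p i))))"
    by (simp add: sum_distrib_left prod.distrib mult_ac)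
  also have "\<dots> = (\<Sum>f\<in>B \<rightarrow>\<^sub>E B. (\<Prod>i\<in>B. X i (f i)) * det_on B (\<lambda>i j. Y (f i) j))"
    unfolding det_on_def by (subst sum.swap) (simp add: sum_distrib_left)
  \<comment> \<open>Maps in the extensional function space are \<open>undefined\<close> outside
    \<open>B\<close>, permutations are the identity there; \<open>restrict\<close> translates
    between the two conventions.\<close>
  also have "\<dots> = (\<Sum>f\<in>(\<lambda>q. restrict q B) ` {q. q permutes B}. (\<Prod>i\<in>B. X i (f i)) * det_on B (\<lambda>i j. Y (f i) j))"
  proof (rule sum.mono_neutral_right)
    show "finite (B \<rightarrow>\<^sub>E B)" using fin by (simp add: finite_PiE)
    show "(\<lambda>q. restrict q B) ` {q. q permutes B} \<subseteq> B \<rightarrow>\<^sub>E B" by (auto simp: permutes_in_image)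
    show "\<forall>f\<in>(B \<rightarrow>\<^sub>E B) - (\<lambda>q. restrict q B) ` {q. q permutes B}. (\<Prod>i\<in>B. X i (f i)) * det_on B (\<lambda>i j. Y (f i) j) = 0"
    proof
      fix f assume f: "f \<in> (B \<rightarrow>\<^sub>E B) - (\<lambda>q. restrict q B) ` {q. q permutes B}"
      have "\<not> inj_on f B"
      proof
        assume inj: "inj_on f B"
        have "f ` B = B" using f inj fin by (intro endo_inj_surj) auto
        define q where "q i = (if i \<in> B then f i else i)" for i
        have "bij_betw q B B" using inj \<open>f ` B = B\<close>
          by (auto simp: bij_betw_def q_def inj_on_def)
        then have "q permutes B" by (rule bij_imp_permutes) (simp add: q_def)
        moreover have "f = restrict q B" using f by (auto simp: q_def fun_eq_iff)
        ultimately show False using f by blast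
      qed
      then obtain a b where "a \<in> B" "b \<in> B" "a \<noteq> b" "f a = f b" by (auto simp: inj_on_def)
      then have "det_on B (\<lambda>i j. Y (f i) j) = 0"
        by (intro det_on_identical_rows[OF fin, of a b]) auto
      then show "(\<Prod>i\<in>B. X i (f i)) * det_on B (\<lambda>i j. Y (f i) j) = 0" by simp
    qed
  qed
  also have "\<dots> = (\<Sum>q | q permutes B. (\<Prod>i\<in>B. X i (restrict q B i)) * det_on B (\<lambda>i j. Y (restrict q B i) j))"
  proof (rule sum.reindex[unfolded o_def])
    show "inj_on (\<lambda>q. restrict q B) {q. q permutes B}"
    proof (rule inj_onI)
      fix p q assume "p \<in> {q. q permutes B}" "q \<in> {q. q permutes B}" "restrict p B = restrict q B"
      then have "p i = q i" for i
        by (cases "i \<in> B") (auto simp: permutes_not_in dest: fun_cong[of _ _ i])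
      then show "p = q" by auto
    qed
  qed
  also have "\<dots> = (\<Sum>q | q permutes B. (\<Prod>i\<in>B. X i (q i)) * (of_int (sign q) * det_on B Y))"
  proof (rule sum.cong[OF refl])
    fix q assume "q \<in> {q. q permutes B}"
    then have "det_on B (\<lambda>i j. Y (restrict q B i) j) = of_int (sign q) * det_on B Y"
      using det_on_permute_rows[OF fin, of q Y] by (simp cong: det_on_cong)
    then show "(\<Prod>i\<in>B. X i (restrict q B i)) * det_on B (\<lambda>i j. Y (restrict q B i) j) =
        (\<Prod>i\<in>B. X i (q i)) * (of_int (sign q) * det_on B Y)" by simp
  qed
  also have "\<dots> = det_on B X * det_on B Y"
    by (simp add: det_on_def[of B X] sum_distrib_right sum_distrib_left mult_ac)
  finally show ?thesis .
qed

lemma det_on_delta: "finite B \<Longrightarrow> det_on B (\<lambda>i j. if i = j then 1 else 0) = 1"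
  using det_on_delta_rows[of B "{}" "\<lambda>i j. if i = j then 1 else 0"] by (simp add: det_on_def)

lemma det_on_singleton: "det_on {a} G = G a a"
  by (simp add: det_on_def)

lemma bilinear_sum2:
  assumes "bilinear g" "finite I" "finite J"
  shows "g (\<Sum>i\<in>I. a i *\<^sub>R u i) (\<Sum>j\<in>J. b j *\<^sub>R v j) = (\<Sum>i\<in>I. \<Sum>j\<in>J. a i * b j * g (u i) (v j))"
proof -
  have "g (\<Sum>i\<in>I. a i *\<^sub>R u i) (\<Sum>j\<in>J. b j *\<^sub>R v j) = (\<Sum>(i,j)\<in>I\<times>J. g (a i *\<^sub>R u i) (b j *\<^sub>R v j))"
    using assms by (intro bilinear_sum)
  also have "\<dots> = (\<Sum>(i,j)\<in>I\<times>J. a i * b j * g (u i) (v j))"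
    by (rule sum.cong) (auto simp: bilinear_lmul[OF assms(1)] bilinear_rmul[OF assms(1)])
  finally show ?thesis by (simp only: sum.cartesian_product)
qed

text \<open>The new Gram matrix is the product of \<open>E\<close>, the old Gram matrix and the
  transpose of \<open>E\<close>.\<close>

lemma det_on_gram_change:
  assumes g: "bilinear g" and fin: "finite I"
    and e: "\<And>i. i \<in> I \<Longrightarrow> e' i = (\<Sum>k\<in>I. E i k *\<^sub>R e k)"
  shows "det_on I (\<lambda>i j. g (e' i) (e' j)) = (det_on I E)\<^sup>2 * det_on I (\<lambda>i j. g (e i) (e j))"
proof -
  have "det_on I (\<lambda>i j. g (e' i) (e' j)) =
    det_on I (\<lambda>i j. \<Sum>k\<in>I. E i k * (\<Sum>l\<in>I. g (e k) (e l) * E j l))"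
    by (rule det_on_cong[OF refl]) (simp add: e bilinear_sum2[OF g fin fin] sum_distrib_left mult_ac)
  also have "\<dots> = det_on I E * det_on I (\<lambda>k j. \<Sum>l\<in>I. g (e k) (e l) * E j l)"
    by (rule det_on_mult[OF fin])
  also have "det_on I (\<lambda>k j. \<Sum>l\<in>I. g (e k) (e l) * E j l) =
      det_on I (\<lambda>i j. g (e i) (e j)) * det_on I (\<lambda>i j. E j i)"
    by (rule det_on_mult[OF fin])
  finally show ?thesis by (simp add: det_on_transpose[OF fin, of E] power2_eq_square)
qed

text \<open>Factor the block diagonal matrix into two matrices with some rows of the unit matrix.\<close>

lemma det_on_block_diagonal:
  assumes fin: "finite A" "finite B" and disj: "A \<inter> B = {}"
    and zero: "\<And>i j. i \<in> A \<Longrightarrow> j \<in> B \<Longrightarrow> G i j = 0" "\<And>i j. i \<in> B \<Longrightarrow> j \<in> A \<Longrightarrow> G i j = 0"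
  shows "det_on (A \<union> B) G = det_on A G * det_on B G"
proof -
  let ?\<delta> = "\<lambda>i j. if i = j then 1 else 0::real"
  define X where "X i j = (if i \<in> B then ?\<delta> i j else G i j)" for i j
  define Y where "Y i j = (if i \<in> A then ?\<delta> i j else G i j)" for i j
  have "det_on (A \<union> B) G = det_on (A \<union> B) (\<lambda>i j. \<Sum>k\<in>A\<union>B. X i k * Y k j)"
  proof (rule det_on_cong[OF refl])
    fix i j assume ij: "i \<in> A \<union> B" "j \<in> A \<union> B"
    show "G i j = (\<Sum>k\<in>A\<union>B. X i k * Y k j)"
    proof (cases "i \<in> B")
      case True
      then have "(\<Sum>k\<in>A\<union>B. X i k * Y k j) = (\<Sum>k\<in>A\<union>B. if i = k then G i j else 0)"
        using disj by (intro sum.cong) (auto simp: X_def Y_def)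
      then show ?thesis using ij fin by simp
    next
      case False
      then have "(\<Sum>k\<in>A\<union>B. X i k * Y k j) = (\<Sum>k\<in>A\<union>B. if k = j then G i j else 0)"
        using disj ij zero by (intro sum.cong) (auto simp: X_def Y_def)
      then show ?thesis using ij fin by simp
    qed
  qed
  also have "\<dots> = det_on (A \<union> B) X * det_on (A \<union> B) Y" using fin by (simp add: det_on_mult)
  also have "det_on (A \<union> B) Y = det_on B Y"
    using fin disj by (intro det_on_delta_rows) (auto simp: Y_def)
  also have "det_on (A \<union> B) X = det_on A X"
    using fin disj by (subst Un_commute, intro det_on_delta_rows) (auto simp: X_def)
  also have "det_on A X = det_on A G" using disj by (intro det_on_cong) (auto simp: X_def)
  also have "det_on B Y = det_on B G" using disj by (intro det_on_cong) (auto simp: Y_def)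
  finally show ?thesis .
qed

section \<open>Inner products, Riesz representation and positivity of Gram determinants\<close>

definition inner_prod :: "('a::real_vector \<Rightarrow> 'a \<Rightarrow> real) \<Rightarrow> bool" where
  "inner_prod g \<longleftrightarrow> bilinear g \<and> (\<forall>u v. g u v = g v u) \<and> (\<forall>u. u \<noteq> 0 \<longrightarrow> g u u > 0)"

lemma inner_prodD:
  assumes "inner_prod g"
  shows "bilinear g" "g u v = g v u" "u \<noteq> 0 \<Longrightarrow> g u u > 0"
  using assms by (auto simp: inner_prod_def)

lemma inner_prod_linear:
  assumes "inner_prod g"
  shows "linear (g u)" "linear (\<lambda>u. g u v)"
  using assms by (auto simp: inner_prod_def bilinear_def)

text \<open>With \<open>f u\<close> the vector representing \<open>g u\<close> and \<open>P\<close> the orthogonal projection onto \<open>W\<close>, both for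
  the standard inner product, \<open>P \<circ> f\<close> is an injective endomorphism of \<open>W\<close>.\<close>

lemma riesz_subspace:
  fixes g :: "'a::euclidean_space \<Rightarrow> 'a \<Rightarrow> real"
  assumes g: "inner_prod g" and W: "subspace W" and l: "linear l"
  shows "\<exists>!u. u \<in> W \<and> (\<forall>v\<in>W. g u v = l v)"
proof -
  have lr: "linear (g u)" and ll: "linear (\<lambda>u. g u v)" for u v using inner_prod_linear[OF g] by auto
  have rep: "(\<Sum>b\<in>Basis. k b *\<^sub>R b) \<bullet> v = k v" if "linear k" for k :: "'a \<Rightarrow> real" and v
  proof -
    have "k v = k (\<Sum>b\<in>Basis. (v \<bullet> b) *\<^sub>R b)" by (simp add: euclidean_representation)
    also have "\<dots> = (\<Sum>b\<in>Basis. (v \<bullet> b) * k b)" using that by (simp add: linear_sum linear_scale)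
    finally show ?thesis by (simp add: inner_sum_left inner_commute[of v] mult_ac)
  qed
  define f where "f u = (\<Sum>b\<in>Basis. g u b *\<^sub>R b)" for u
  have f: "f u \<bullet> v = g u v" for u v unfolding f_def by (rule rep[OF lr])
  have linf: "linear f"
    by (rule linearI; rule euclidean_eqI)
       (simp_all add: f inner_left_distrib linear_add[OF ll] linear_scale[OF ll])
  obtain D where D: "D \<subseteq> W" "pairwise orthogonal D" "\<And>x. x \<in> D \<Longrightarrow> norm x = 1" "independent D"
      "card D = dim W" "span D = W"
    using orthonormal_basis_subspace[OF W] by metis
  have finD: "finite D" using D(4) independent_imp_finite by blast
  define P where "P x = (\<Sum>d\<in>D. (x \<bullet> d) *\<^sub>R d)" for x
  have linP: "linear P" unfolding P_def
    by (intro linear_compose_sum ballI linear_compose_scale_right)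
       (auto intro!: linearI linear_compose_sum simp: inner_left_distrib scaleR_left_distrib scaleR_right_distrib)
  have PW: "P x \<in> W" for x unfolding P_def using D(1) W
    by (intro subspace_sum subspace_scale) auto
  have PD: "P x \<bullet> d = x \<bullet> d" if "d \<in> D" for x d
  proof -
    have "P x \<bullet> d = (\<Sum>c\<in>D. if c = d then x \<bullet> d else 0)"
      unfolding P_def inner_sum_left using D(2) D(3)[OF that] that
      by (intro sum.cong) (auto simp: pairwise_def orthogonal_def norm_eq_1)
    then show ?thesis using finD that by simp
  qed
  have Pv: "P x \<bullet> v = x \<bullet> v" if "v \<in> W" for x v
  proof -
    have "v \<in> span D" using D(6) that by simp
    then show ?thesis
      by (induct rule: span_induct_alt) (auto simp: inner_right_distrib PD)
  qed
  have linPf: "linear (P \<circ> f)" using linf linP by (rule linear_compose)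
  have inj: "inj_on (P \<circ> f) W"
  proof (subst linear_inj_on_iff_eq_0[OF linPf W], intro ballI impI)
    fix u assume u: "u \<in> W" "(P \<circ> f) u = 0"
    then have "g u u = 0" using Pv[OF u(1), of "f u"] f[of u u] by simp
    then show "u = 0" using inner_prodD(3)[OF g, of u] by fastforce
  qed
  have "(P \<circ> f) ` W = W"
  proof (rule subspace_dim_equal)
    show "subspace ((P \<circ> f) ` W)" using linPf W by (rule linear_subspace_image)
    show "(P \<circ> f) ` W \<subseteq> W" using PW by auto
    show "dim ((P \<circ> f) ` W) \<ge> dim W"
      using dim_image_eq[OF linPf] inj W by (simp add: span_eq_iff[THEN iffD2])
  qed (use W in auto)
  then obtain u where u: "u \<in> W" "P (f u) = P (\<Sum>b\<in>Basis. l b *\<^sub>R b)"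
    using PW by (metis (mono_tags, lifting) comp_apply imageE)
  show ?thesis
  proof (rule ex1I[of _ u])
    show "u \<in> W \<and> (\<forall>v\<in>W. g u v = l v)"
      using u by (metis Pv f rep[OF l])
    fix u' assume u': "u' \<in> W \<and> (\<forall>v\<in>W. g u' v = l v)"
    have "u' - u \<in> W" using u u' W by (auto intro: subspace_diff)
    then have "g (u' - u) (u' - u) = 0"
      using u' \<open>u \<in> W \<and> (\<forall>v\<in>W. g u v = l v)\<close> by (simp add: linear_diff[OF ll])
    then show "u' = u" using inner_prodD(3)[OF g, of "u' - u"] by fastforce
  qed
qed

text \<open>One step of Gram-Schmidt: subtracting from \<open>e a\<close> its projection
  \<open>w\<close> to the span of the other vectors is a unit triangular change of the family.
  Afterwards the Gram matrix is block diagonal, with the positive entry g (e a - w) (e a - w) split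
  off.\<close>

lemma gram_det_pos:
  fixes g :: "'a::euclidean_space \<Rightarrow> 'a \<Rightarrow> real"
  assumes g: "inner_prod g" and fin: "finite I" and inj: "inj_on e I" and ind: "independent (e ` I)"
  shows "det_on I (\<lambda>i j. g (e i) (e j)) > 0"
  using fin inj ind
proof (induct I)
  case empty
  then show ?case by (simp add: det_on_def)
next
  case (insert a I)
  have IH: "det_on I (\<lambda>i j. g (e i) (e j)) > 0"
    using insert by (meson independent_mono inj_on_subset subset_insertI image_mono)
  have notin: "e a \<notin> span (e ` I)"
    using insert by (auto simp: independent_insert image_iff inj_on_def split: if_splits)
  obtain w where w: "w \<in> span (e ` I)" "\<And>v. v \<in> span (e ` I) \<Longrightarrow> g w v = g (e a) v"
    using riesz_subspace[OF g subspace_span inner_prod_linear(1)[OF g], of "e ` I" "e a"] by blast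
  have "w \<in> range (\<lambda>c. \<Sum>v\<in>e ` I. c v *\<^sub>R v)" using w(1) insert(1) by (simp add: span_finite)
  then obtain c where c: "w = (\<Sum>v\<in>e ` I. c v *\<^sub>R v)" by auto
  have w_eq: "w = (\<Sum>k\<in>I. c (e k) *\<^sub>R e k)"
    using insert.prems unfolding c by (subst sum.reindex) (auto simp: inj_on_def)
  define E where "E i k = (if i = k then 1 else if i = a then - c (e k) else 0)" for i k
  define e' where "e' i = (if i = a then e a - w else e i)" for i
  have fin': "finite (insert a I)" using insert by simp
  have "det_on (insert a I) (\<lambda>i j. g (e' i) (e' j)) =
     (det_on (insert a I) E)\<^sup>2 * det_on (insert a I) (\<lambda>i j. g (e i) (e j))"
  proof (rule det_on_gram_change[OF inner_prodD(1)[OF g] fin'])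
    fix i assume i: "i \<in> insert a I"
    show "e' i = (\<Sum>k\<in>insert a I. E i k *\<^sub>R e k)"
    proof (cases "i = a")
      case True
      have "(\<Sum>k\<in>insert a I. E i k *\<^sub>R e k) = e a + (\<Sum>k\<in>I. - (c (e k) *\<^sub>R e k))"
        using insert True by (subst sum.insert) (auto simp: E_def intro!: sum.cong)
      then show ?thesis using True by (simp add: e'_def w_eq sum_negf)
    next
      case False
      have "(\<Sum>k\<in>insert a I. E i k *\<^sub>R e k) = (\<Sum>k\<in>insert a I. if k = i then e i else 0)"
        using False by (intro sum.cong) (auto simp: E_def)
      then show ?thesis using False i insert(1) by (auto simp: e'_def)
    qed
  qed
  also have "det_on (insert a I) E = 1"
  proof -
    have "det_on (I \<union> {a}) E = det_on {a} E"
      using insert by (intro det_on_delta_rows) (auto simp: E_def)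
    then show ?thesis by (simp add: det_on_singleton E_def)
  qed
  finally have "det_on (insert a I) (\<lambda>i j. g (e i) (e j)) = det_on ({a} \<union> I) (\<lambda>i j. g (e' i) (e' j))"
    by simp
  also have "\<dots> = det_on {a} (\<lambda>i j. g (e' i) (e' j)) * det_on I (\<lambda>i j. g (e' i) (e' j))"
  proof (rule det_on_block_diagonal)
    have z: "g (e a - w) (e j) = 0" if "j \<in> I" for j
      using that w(2)[of "e j"] by (simp add: span_base linear_diff[OF inner_prod_linear(2)[OF g]])
    show "g (e' i) (e' j) = 0" if "i \<in> {a}" "j \<in> I" for i j
      using that z insert(2) by (auto simp: e'_def)
    show "g (e' i) (e' j) = 0" if "i \<in> I" "j \<in> {a}" for i j
      using that z insert(2) by (subst inner_prodD(2)[OF g]) (auto simp: e'_def)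
  qed (use insert in auto)
  also have "det_on I (\<lambda>i j. g (e' i) (e' j)) = det_on I (\<lambda>i j. g (e i) (e j))"
    using insert by (intro det_on_cong) (auto simp: e'_def)
  also have "det_on {a} (\<lambda>i j. g (e' i) (e' j)) = g (e a - w) (e a - w)"
    by (simp add: det_on_singleton e'_def)
  finally have "det_on (insert a I) (\<lambda>i j. g (e i) (e j)) =
      g (e a - w) (e a - w) * det_on I (\<lambda>i j. g (e i) (e j))" .
  moreover have "g (e a - w) (e a - w) > 0"
    using notin w(1) by (intro inner_prodD(3)[OF g]) auto
  ultimately show ?case using IH by simp
qed

section \<open>Change of variables on Euclidean spaces\<close>

text \<open>The change of variables theorem of the library is stated for \<open>real ^ 'n\<close> with a well-ordered index
  type, so a Euclidean space is given an index type of its own.\<close>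

typedef (overloaded) 'a basis_index = "{..<DIM('a::euclidean_space)}"
  by (metis DIM_positive lessThan_iff)

instantiation basis_index :: (euclidean_space) "{finite,wellorder}"
begin
definition "(a :: 'a basis_index) \<le> b \<longleftrightarrow> Rep_basis_index a \<le> Rep_basis_index b"
definition "(a :: 'a basis_index) < b \<longleftrightarrow> Rep_basis_index a < Rep_basis_index b"
instance
proof
  show "finite (UNIV :: 'a basis_index set)"
    by (metis finite_imageI finite_lessThan type_definition.Abs_image type_definition_basis_index)
  fix P and a :: "'a basis_index"
  assume *: "\<And>x::'a basis_index. (\<And>y. y < x \<Longrightarrow> P y) \<Longrightarrow> P x"
  show "P a"
    by (induct a rule: measure_induct_rule[of Rep_basis_index]) (auto intro: * simp: less_basis_index_def)
qed (auto simp: less_eq_basis_index_def less_basis_index_def Rep_basis_index_inject)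
end

lemma card_basis_index: "CARD('a::euclidean_space basis_index) = DIM('a)"
  using type_definition.card[OF type_definition_basis_index] by simp

definition basis_enum :: "'a::euclidean_space basis_index \<Rightarrow> 'a" where
  "basis_enum = (SOME f. bij_betw f UNIV Basis)"

lemma basis_enum: "bij_betw (basis_enum :: 'a::euclidean_space basis_index \<Rightarrow> 'a) UNIV Basis"
proof -
  have "\<exists>f. bij_betw f (UNIV :: 'a basis_index set) (Basis :: 'a set)"
    by (rule finite_same_card_bij) (simp_all add: card_basis_index)
  then show ?thesis unfolding basis_enum_def by (rule someI_ex)
qed

lemma basis_enum_in [simp]: "basis_enum i \<in> Basis"
  using basis_enum by (auto simp: bij_betw_def)

lemma basis_enum_inner: "basis_enum i \<bullet> basis_enum j = (if i = j then 1 else 0)"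
  using basis_enum by (auto simp: inner_Basis bij_betw_def inj_on_def)

definition vec_of :: "'a::euclidean_space \<Rightarrow> real ^ 'a basis_index" where
  "vec_of v = (\<chi> i. v \<bullet> basis_enum i)"

definition of_vec :: "real ^ 'a basis_index \<Rightarrow> 'a::euclidean_space" where
  "of_vec x = (\<Sum>i\<in>UNIV. x $ i *\<^sub>R basis_enum i)"

lemma of_vec_inner [simp]: "of_vec x \<bullet> basis_enum i = x $ i"
proof -
  have "of_vec x \<bullet> basis_enum i = (\<Sum>k\<in>UNIV. if k = i then x $ i else 0)"
    unfolding of_vec_def inner_sum_left by (rule sum.cong) (auto simp: basis_enum_inner)
  then show ?thesis by simp
qed

lemma vec_of_of_vec [simp]: "vec_of (of_vec x) = x"
  by (simp add: vec_of_def vec_eq_iff)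

lemma of_vec_vec_of [simp]: "of_vec (vec_of v) = v"
proof (rule euclidean_eqI)
  fix b :: 'a assume "b \<in> Basis"
  then obtain i where "b = basis_enum i" using basis_enum by (auto simp: bij_betw_def)
  then show "of_vec (vec_of v) \<bullet> b = v \<bullet> b" by (simp add: vec_of_def)
qed

lemma linear_vec_of: "linear vec_of" and linear_of_vec: "linear of_vec"
  by (rule linearI; simp add: vec_of_def of_vec_def vec_eq_iff inner_left_distrib scaleR_left_distrib
     sum.distrib scaleR_sum_right)+

lemma borel_of_vec [measurable]: "of_vec \<in> borel_measurable borel"
  by (rule borel_measurable_continuous_onI) (rule linear_continuous_on[OF linear_linear[THEN iffD2, OF linear_of_vec]])

lemma prod_basis_enum: "(\<Prod>b\<in>Basis. f b) = (\<Prod>i\<in>UNIV. f (basis_enum i))"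
  using basis_enum by (metis prod.reindex_bij_betw)

lemma ball_Basis_enum: "(\<forall>b\<in>Basis. P b) \<longleftrightarrow> (\<forall>i. P (basis_enum i))"
  using basis_enum by (auto simp: bij_betw_def) (metis rangeI image_iff)

text \<open>Relabelling the coordinates maps boxes to boxes with the same side lengths.\<close>

lemma lborel_distr_of_vec: "distr lborel borel of_vec = (lborel :: 'a::euclidean_space measure)"
proof (rule lborel_eqI[symmetric])
  fix l u :: 'a assume lu: "\<And>b. b \<in> Basis \<Longrightarrow> l \<bullet> b \<le> u \<bullet> b"
  have "of_vec -` box l u = box (vec_of l) (vec_of u)"
    by (auto simp: mem_box_cart mem_box ball_Basis_enum vec_of_def)
  then have "emeasure (distr lborel borel of_vec) (box l u) = emeasure lborel (box (vec_of l) (vec_of u))"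
    by (simp add: emeasure_distr)
  also have "\<dots> = (\<Prod>b\<in>Basis. (vec_of u - vec_of l) \<bullet> b)"
    using lu by (intro emeasure_lborel_box) (auto simp: Basis_vec_def vec_of_def inner_axis)
  also have "(\<Prod>b\<in>Basis. (vec_of u - vec_of l) \<bullet> b) = (\<Prod>i\<in>UNIV. (u - l) \<bullet> basis_enum i)"
    by (simp add: Basis_vec_def prod.UNION_disjoint axis_eq_axis vec_of_def inner_axis inner_diff_left)
  finally show "emeasure (distr lborel borel of_vec) (box l u) = ennreal (\<Prod>b\<in>Basis. (u - l) \<bullet> b)"
    by (simp add: prod_basis_enum)
qed simp

text \<open>\<open>has_measure_differentiable_image\<close> is an equivalence about finite values.
  Read in one direction it gives equality when the integral is finite; read in the other it shows
  that an image of finite measure forces a finite integral, which settles the infinite case.\<close>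

lemma emeasure_image_cart:
  fixes g :: "real^'n::{finite,wellorder} \<Rightarrow> real^'n::_"
  assumes X: "X \<in> sets borel" and gX: "g ` X \<in> sets borel"
    and der: "\<And>x. x \<in> X \<Longrightarrow> (g has_derivative g' x) (at x within X)"
    and inj: "inj_on g X"
    and meas: "(\<lambda>x. indicator X x * \<bar>det (matrix (g' x))\<bar>) \<in> borel_measurable borel"
  shows "emeasure lborel (g ` X) = (\<integral>\<^sup>+x. ennreal (indicator X x * \<bar>det (matrix (g' x))\<bar>) \<partial>lborel)"
proof -
  let ?F = "\<lambda>x. indicator X x * \<bar>det (matrix (g' x))\<bar>"
  have X': "X \<in> sets lebesgue" and gX': "g ` X \<in> sets lebesgue" using X gX by auto
  have F_iff: "(?F has_integral m) UNIV \<longleftrightarrow> ((\<lambda>x. \<bar>det (matrix (g' x))\<bar>) has_integral m) X" for m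
  proof -
    have "?F = (\<lambda>x. if x \<in> X then \<bar>det (matrix (g' x))\<bar> else 0)" by auto
    then show ?thesis by (simp only: has_integral_restrict_UNIV)
  qed
  note hm = has_measure_differentiable_image[OF X' der inj]
  show ?thesis
  proof (cases "(\<integral>\<^sup>+x. ?F x \<partial>lborel) = \<infinity>")
    case False
    then obtain m where m: "0 \<le> m" "(\<integral>\<^sup>+x. ?F x \<partial>lborel) = ennreal m"
      by (cases "\<integral>\<^sup>+x. ?F x \<partial>lborel" rule: ennreal_cases) auto
    then have "(?F has_integral m) UNIV" using meas by (intro nn_integral_has_integral) auto
    then have "g ` X \<in> lmeasurable \<and> measure lebesgue (g ` X) = m" using hm F_iff by blast
    then have "emeasure lebesgue (g ` X) = ennreal m" by (metis emeasure_eq_measure2)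
    then show ?thesis using m gX by simp
  next
    case True
    have "emeasure lborel (g ` X) = \<infinity>"
    proof (rule ccontr)
      assume "emeasure lborel (g ` X) \<noteq> \<infinity>"
      then have "g ` X \<in> lmeasurable" using gX by (auto simp: fmeasurable_def less_top)
      then have "(?F has_integral measure lebesgue (g ` X)) UNIV" using hm F_iff by blast
      then have "(\<integral>\<^sup>+x. ?F x \<partial>lborel) = measure lebesgue (g ` X)"
        using meas by (intro nn_integral_has_integral_lborel) auto
      then show False using True by simp
    qed
    then show ?thesis using True by simp
  qed
qed

lemma det_matrix_det_on:
  fixes L :: "'a::euclidean_space \<Rightarrow> 'a"
  shows "det (matrix (vec_of \<circ> L \<circ> of_vec)) = det_on Basis (\<lambda>i j. i \<bullet> L j)"
proof -
  have ax: "of_vec (axis j 1) = basis_enum j" for j :: "'a basis_index"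
    unfolding of_vec_def by (subst sum.remove[of _ j]) (auto simp: axis_def intro!: sum.neutral)
  have "det (matrix (vec_of \<circ> L \<circ> of_vec)) = det_on UNIV (\<lambda>i j. basis_enum i \<bullet> L (basis_enum j))"
    unfolding det_def det_on_def by (simp add: matrix_def ax vec_of_def inner_commute)
  also have "\<dots> = det_on Basis (\<lambda>i j. i \<bullet> L j)" by (rule det_on_reindex[OF basis_enum]) simp
  finally show ?thesis .
qed

lemma emeasure_image_euclidean:
  fixes g :: "'a::euclidean_space \<Rightarrow> 'a"
  assumes X: "X \<in> sets borel" and gX: "g ` X \<in> sets borel"
    and der: "\<And>x. x \<in> X \<Longrightarrow> (g has_derivative g' x) (at x)"
    and inj: "inj_on g X"
    and meas: "(\<lambda>x. indicator X x * \<bar>det_on Basis (\<lambda>i j. i \<bullet> g' x j)\<bar>) \<in> borel_measurable borel"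
  shows "emeasure lborel (g ` X) = (\<integral>\<^sup>+x. ennreal (indicator X x * \<bar>det_on Basis (\<lambda>i j. i \<bullet> g' x j)\<bar>) \<partial>lborel)"
proof -
  let ?X = "of_vec -` X" and ?g = "vec_of \<circ> g \<circ> of_vec" and ?g' = "\<lambda>x. vec_of \<circ> g' (of_vec x) \<circ> of_vec"
  let ?F = "\<lambda>x. indicator X x * \<bar>det_on Basis (\<lambda>i j. i \<bullet> g' x j)\<bar>"
  have F: "(\<lambda>x. indicator ?X x * \<bar>det (matrix (?g' x))\<bar>) = ?F \<circ> of_vec"
    by (auto simp: fun_eq_iff det_matrix_det_on indicator_def)
  have img: "?g ` ?X = of_vec -` (g ` X)"
  proof (intro set_eqI iffI)
    fix y assume "y \<in> of_vec -` (g ` X)"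
    then obtain x where "x \<in> X" "of_vec y = g x" by auto
    then have "?g (vec_of x) = vec_of (of_vec y)" "vec_of x \<in> ?X" by simp_all
    then have "?g (vec_of x) = y" by simp
    then show "y \<in> ?g ` ?X" using \<open>vec_of x \<in> ?X\<close> by blast
  qed auto
  have vim: "of_vec -` A \<in> sets borel" if "A \<in> sets borel" for A :: "'a set"
    using measurable_sets[OF borel_of_vec that] by simp
  have "emeasure lborel (?g ` ?X) = (\<integral>\<^sup>+x. ennreal (indicator ?X x * \<bar>det (matrix (?g' x))\<bar>) \<partial>lborel)"
  proof (rule emeasure_image_cart)
    show "?X \<in> sets borel" "?g ` ?X \<in> sets borel" unfolding img using X gX vim by auto
    show "(?g has_derivative ?g' x) (at x within ?X)" if "x \<in> ?X" for x
    proof -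
      have l: "(vec_of has_derivative vec_of) (at z)" "(of_vec has_derivative of_vec) (at y)" for z :: 'a and y :: "real ^ 'a basis_index"
        by (rule linear_imp_has_derivative[OF linear_vec_of], rule linear_imp_has_derivative[OF linear_of_vec])
      have "((g \<circ> of_vec) has_derivative (g' (of_vec x) \<circ> of_vec)) (at x)"
        using that by (intro diff_chain_at l der) simp
      then have "((vec_of \<circ> (g \<circ> of_vec)) has_derivative (vec_of \<circ> (g' (of_vec x) \<circ> of_vec))) (at x)"
        by (rule diff_chain_at[OF _ l(1)])
      then show ?thesis by (simp add: o_assoc has_derivative_at_withinI)
    qed
    show "inj_on ?g ?X"
      using inj by (auto simp: inj_on_def) (metis vec_of_of_vec of_vec_vec_of)
    show "(\<lambda>x. indicator ?X x * \<bar>det (matrix (?g' x))\<bar>) \<in> borel_measurable borel"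
      unfolding F by (rule measurable_comp[OF borel_of_vec meas])
  qed
  also have "\<dots> = (\<integral>\<^sup>+x. ennreal (?F (of_vec x)) \<partial>lborel)"
    using fun_cong[OF F] by (intro nn_integral_cong) (simp add: comp_def)
  also have "\<dots> = (\<integral>\<^sup>+x. ennreal (?F x) \<partial>distr lborel borel of_vec)"
    using meas by (subst nn_integral_distr) auto
  also have "emeasure lborel (?g ` ?X) = emeasure (distr lborel borel of_vec) (g ` X)"
    unfolding img using gX by (simp add: emeasure_distr)
  finally show ?thesis by (simp add: lborel_distr_of_vec)
qed

lemma nn_integral_change_of_variables:
  fixes g :: "'a::euclidean_space \<Rightarrow> 'a"
  assumes X: "X \<in> sets borel" and gX: "\<And>A. A \<in> sets borel \<Longrightarrow> A \<subseteq> X \<Longrightarrow> g ` A \<in> sets borel"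
    and der: "\<And>x. x \<in> X \<Longrightarrow> (g has_derivative g' x) (at x)"
    and inj: "inj_on g X"
    and meas: "(\<lambda>x. indicator X x * \<bar>det_on Basis (\<lambda>i j. i \<bullet> g' x j)\<bar>) \<in> borel_measurable borel"
    and f: "f \<in> borel_measurable borel"
  shows "(\<integral>\<^sup>+x. indicator (g ` X) x * f x \<partial>lborel) =
         (\<integral>\<^sup>+x. ennreal (indicator X x * \<bar>det_on Basis (\<lambda>i j. i \<bullet> g' x j)\<bar>) * f (g x) \<partial>lborel)"
proof -
  define F where "F x = indicator X x * \<bar>det_on Basis (\<lambda>i j. i \<bullet> g' x j)\<bar>" for x
  \<comment> \<open>A globally Borel version of \<open>g\<close>. The value 0 outside
    \<open>X\<close> is harmless, as the density \<open>F\<close> vanishes there.\<close>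
  define h where "h x = (if x \<in> X then g x else 0)" for x
  have cont: "continuous_on X g"
    using der has_derivative_continuous by (intro continuous_at_imp_continuous_on) blast
  have h[measurable]: "h \<in> borel_measurable borel"
    unfolding h_def using X cont by (intro borel_measurable_continuous_on_if) auto
  have Fm[measurable]: "F \<in> borel_measurable borel" unfolding F_def by (rule meas)
  have [measurable]: "g ` X \<in> sets borel" using X gX by blast
  note f[measurable]
  have "density lborel (indicator (g ` X)) = distr (density lborel (\<lambda>x. ennreal (F x))) borel h"
  proof (rule measure_eqI)
    fix A assume "A \<in> sets (density lborel (indicator (g ` X)))"
    then have A[measurable]: "A \<in> sets borel" by simp
    let ?Y = "X \<inter> h -` A"
    have hA: "h -` A \<in> sets borel" using measurable_sets[OF h A] by simp
    then have Y: "?Y \<in> sets borel" using X by auto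
    have gY: "g ` ?Y = g ` X \<inter> A" by (auto simp: h_def)
    have ind: "indicator ?Y x * \<bar>det_on Basis (\<lambda>i j. i \<bullet> g' x j)\<bar> = indicator (h -` A) x * F x" for x
      by (auto simp: indicator_def F_def)
    have "emeasure lborel (g ` ?Y) = (\<integral>\<^sup>+x. ennreal (indicator ?Y x * \<bar>det_on Basis (\<lambda>i j. i \<bullet> g' x j)\<bar>) \<partial>lborel)"
    proof (rule emeasure_image_euclidean[OF Y])
      show "g ` ?Y \<in> sets borel" by (rule gX[OF Y]) simp
      show "inj_on g ?Y" using inj by (rule inj_on_subset) simp
      show "(\<lambda>x. indicator ?Y x * \<bar>det_on Basis (\<lambda>i j. i \<bullet> g' x j)\<bar>) \<in> borel_measurable borel"
        unfolding ind using hA Fm by (intro borel_measurable_times borel_measurable_indicator) auto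
    qed (use der in auto)
    then have "emeasure lborel (g ` X \<inter> A) = (\<integral>\<^sup>+x. ennreal (F x) * indicator (h -` A) x \<partial>lborel)"
      unfolding gY ind by (auto intro!: nn_integral_cong simp: indicator_def)
    moreover have "emeasure (density lborel (indicator (g ` X))) A = emeasure lborel (g ` X \<inter> A)"
      by (simp add: emeasure_density indicator_inter_arith[symmetric])
    moreover have "emeasure (distr (density lborel (\<lambda>x. ennreal (F x))) borel h) A =
        (\<integral>\<^sup>+x. ennreal (F x) * indicator (h -` A) x \<partial>lborel)"
      using hA by (subst emeasure_distr) (auto simp: emeasure_density)
    ultimately show "emeasure (density lborel (indicator (g ` X))) A =
        emeasure (distr (density lborel (\<lambda>x. ennreal (F x))) borel h) A" by simp
  qed simp
  then have "(\<integral>\<^sup>+x. f x \<partial>density lborel (indicator (g ` X))) =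
      (\<integral>\<^sup>+x. f x \<partial>distr (density lborel (\<lambda>x. ennreal (F x))) borel h)" by simp
  then have "(\<integral>\<^sup>+x. indicator (g ` X) x * f x \<partial>lborel) = (\<integral>\<^sup>+x. ennreal (F x) * f (h x) \<partial>lborel)"
    by (simp add: nn_integral_density nn_integral_distr)
  also have "\<dots> = (\<integral>\<^sup>+x. ennreal (F x) * f (g x) \<partial>lborel)"
    by (rule nn_integral_cong) (auto simp: h_def F_def indicator_def)
  finally show ?thesis by (simp only: F_def)
qed

section \<open>Coordinate subspaces\<close>

definition coord_sum :: "'a::euclidean_space set \<Rightarrow> ('a \<Rightarrow> real) \<Rightarrow> 'a" where
  "coord_sum B t = (\<Sum>b\<in>B. t b *\<^sub>R b)"

lemma coord_sum_measurable [measurable]: "coord_sum B \<in> measurable (\<Pi>\<^sub>M b\<in>B. lborel) borel"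
  unfolding coord_sum_def by measurable

lemma coord_sum_inner:
  assumes "B \<subseteq> Basis" "i \<in> Basis"
  shows "coord_sum B t \<bullet> i = (if i \<in> B then t i else 0)"
proof -
  have fin: "finite B" using assms finite_subset[OF _ finite_Basis] by blast
  have "coord_sum B t \<bullet> i = (\<Sum>b\<in>B. if b = i then t i else 0)"
    unfolding coord_sum_def inner_sum_left using assms
    by (intro sum.cong) (auto simp: inner_Basis subset_iff)
  then show ?thesis using fin by simp
qed

lemma coord_sum_span: "coord_sum B t \<in> span B"
  unfolding coord_sum_def by (intro span_sum span_scale span_base)

text \<open>A bijection \<sigma> from \<open>B\<close> onto the basis of another space identifies
  \<open>span B\<close> with that space; \<open>lift\<close> and \<open>push\<close> are the two
  directions of this identification, and \<open>push\<close> discards the coordinates outside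
  \<open>B\<close>. With the identity as \<sigma>, \<open>lift\<close> is the orthogonal projection
  to \<open>span B\<close>.\<close>

definition lift :: "'a set \<Rightarrow> ('a \<Rightarrow> 'b) \<Rightarrow> 'b::real_inner \<Rightarrow> 'a::euclidean_space" where
  "lift B \<sigma> w = (\<Sum>b\<in>B. (w \<bullet> \<sigma> b) *\<^sub>R b)"

definition push :: "'a set \<Rightarrow> ('a \<Rightarrow> 'b) \<Rightarrow> 'a::euclidean_space \<Rightarrow> 'b::real_inner" where
  "push B \<sigma> z = (\<Sum>b\<in>B. (z \<bullet> b) *\<^sub>R \<sigma> b)"

abbreviation proj_on :: "'a::euclidean_space set \<Rightarrow> 'a \<Rightarrow> 'a" where
  "proj_on B \<equiv> lift B (\<lambda>b. b)"

lemma linear_lift: "linear (lift B \<sigma>)" and linear_push: "linear (push B \<sigma>)"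
  unfolding lift_def push_def
  by (rule linearI; simp add: inner_left_distrib scaleR_left_distrib sum.distrib scaleR_sum_right)+

lemma borel_lift [measurable]: "lift B \<sigma> \<in> borel_measurable (borel :: 'b::euclidean_space measure)"
  and borel_push [measurable]: "push B \<sigma> \<in> borel \<rightarrow>\<^sub>M (borel :: 'b::euclidean_space measure)"
  unfolding lift_def push_def by measurable

lemma lift_inner:
  assumes "B \<subseteq> Basis" "b \<in> Basis"
  shows "lift B \<sigma> w \<bullet> b = (if b \<in> B then w \<bullet> \<sigma> b else 0)"
  using coord_sum_inner[OF assms, of "\<lambda>b. w \<bullet> \<sigma> b"] by (simp add: lift_def coord_sum_def)

lemma push_inner:
  fixes \<sigma> :: "'a::euclidean_space \<Rightarrow> 'b::euclidean_space"
  assumes B: "finite B" "bij_betw \<sigma> B Basis" and b: "b \<in> B"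
  shows "push B \<sigma> s \<bullet> \<sigma> b = s \<bullet> b"
proof -
  have "\<sigma> k \<bullet> \<sigma> b = (if k = b then 1 else 0)" if "k \<in> B" for k
    using bij_betwE[OF B(2)] inj_on_eq_iff[OF bij_betw_imp_inj_on[OF B(2)]] b that
    by (simp add: inner_Basis)
  then have "push B \<sigma> s \<bullet> \<sigma> b = (\<Sum>k\<in>B. if k = b then s \<bullet> b else 0)"
    unfolding push_def inner_sum_left by (intro sum.cong) auto
  then show ?thesis using B b by simp
qed

lemma in_span_Basis_iff:
  assumes "B \<subseteq> Basis"
  shows "z \<in> span B \<longleftrightarrow> (\<forall>i\<in>Basis - B. z \<bullet> i = 0)"
  using span_substd_basis[OF assms] by auto

lemma proj_on_id: "B \<subseteq> Basis \<Longrightarrow> z \<in> span B \<Longrightarrow> proj_on B z = z"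
  by (rule euclidean_eqI) (auto simp: in_span_Basis_iff lift_inner)

lemma borel_span [measurable]: "span B \<in> sets (borel :: 'a::euclidean_space measure)"
  by (simp add: borel_closed closed_subspace)

lemma lborel_span_eq: "lborel_span B = distr (\<Pi>\<^sub>M b\<in>B. lborel) borel (coord_sum B)"
  by (simp add: lborel_span_def coord_sum_def[abs_def])

lemma sets_lborel_span [simp, measurable_cong]: "sets (lborel_span B) = sets borel"
  by (simp add: lborel_span_def)

lemma space_lborel_span [simp]: "space (lborel_span B) = UNIV"
  by (simp add: lborel_span_def)

lemma nn_integral_lborel_span:
  assumes "f \<in> borel_measurable borel"
  shows "(\<integral>\<^sup>+z. f z \<partial>lborel_span B) = (\<integral>\<^sup>+t. f (coord_sum B t) \<partial>(\<Pi>\<^sub>M b\<in>B. lborel))"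
  unfolding lborel_span_eq using assms by (subst nn_integral_distr) simp_all

lemma nn_integral_lborel_span_cong:
  assumes "\<And>z. z \<in> span B \<Longrightarrow> f z = g z" "f \<in> borel_measurable borel" "g \<in> borel_measurable borel"
  shows "(\<integral>\<^sup>+z. f z \<partial>lborel_span B) = (\<integral>\<^sup>+z. g z \<partial>lborel_span B)"
  using assms by (simp add: nn_integral_lborel_span coord_sum_span)

lemma lborel_span_Basis: "lborel_span Basis = lborel"
  unfolding lborel_span_def by (rule lborel_eq[symmetric])

lemma product_sigma_finite_lborel: "product_sigma_finite (\<lambda>b. lborel :: real measure)"
  by (simp add: product_sigma_finite_def sigma_finite_lborel)

lemma sigma_finite_lborel_span:
  assumes "B \<subseteq> Basis"
  shows "sigma_finite_measure (lborel_span B :: 'a::euclidean_space measure)"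
proof -
  interpret product_sigma_finite "\<lambda>b::'a. lborel :: real measure" by (rule product_sigma_finite_lborel)
  have fin: "finite B" using assms finite_subset[OF _ finite_Basis] by blast
  define A where "A n = {z::'a. \<forall>b\<in>B. \<bar>z \<bullet> b\<bar> \<le> real n}" for n
  have A[measurable]: "A n \<in> sets borel" for n
    unfolding A_def using fin by measurable
  have "emeasure (lborel_span B) (A n) \<noteq> \<infinity>" for n
  proof -
    have "coord_sum B -` A n \<inter> space (\<Pi>\<^sub>M b\<in>B. lborel) = (\<Pi>\<^sub>E b\<in>B. {- real n..real n})"
    proof -
      have "coord_sum B t \<in> A n \<longleftrightarrow> (\<forall>b\<in>B. \<bar>t b\<bar> \<le> real n)" for t
        using assms by (simp add: A_def coord_sum_inner subset_iff)
      then show ?thesis by (auto simp: space_PiM PiE_iff abs_le_iff minus_le_iff)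
    qed
    then have "emeasure (lborel_span B) (A n) = (\<Prod>b\<in>B. emeasure lborel {- real n..real n})"
      unfolding lborel_span_eq by (simp add: emeasure_distr emeasure_PiM[OF fin])
    then show ?thesis by (simp add: power_eq_top_ennreal)
  qed
  moreover have "(\<Union>n. A n) = UNIV"
  proof (intro set_eqI iffI UNIV_I)
    fix z :: 'a
    obtain n where "norm z \<le> real n" using real_arch_simple by blast
    then have "z \<in> A n" using assms Basis_le_norm[of _ z] by (force simp: A_def)
    then show "z \<in> (\<Union>n. A n)" by blast
  qed
  ultimately show ?thesis
    by (intro sigma_finite_measure.intro exI[of _ "range A"]) auto
qed

lemma nn_integral_lborel_split:
  fixes f :: "'a::euclidean_space \<Rightarrow> ennreal"
  assumes B: "B \<subseteq> Basis" and f[measurable]: "f \<in> borel_measurable borel"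
  shows "(\<integral>\<^sup>+z. f z \<partial>lborel) = (\<integral>\<^sup>+s. (\<integral>\<^sup>+t. f (s + t) \<partial>lborel_span B) \<partial>lborel_span (Basis - B))"
proof -
  interpret product_sigma_finite "\<lambda>b::'a. lborel :: real measure" by (rule product_sigma_finite_lborel)
  interpret sB: sigma_finite_measure "lborel_span B" by (rule sigma_finite_lborel_span[OF B])
  have fin: "finite B" "finite (Basis - B)" using B finite_subset[OF _ finite_Basis] by blast+
  have *: "coord_sum Basis (merge (Basis - B) B (s, t)) = coord_sum (Basis - B) s + coord_sum B t" for s t
    using B by (intro euclidean_eqI[where 'a='a]) (auto simp: coord_sum_inner inner_left_distrib merge_def)
  have "(\<integral>\<^sup>+z. f z \<partial>lborel) = (\<integral>\<^sup>+t. f (coord_sum Basis t) \<partial>(\<Pi>\<^sub>M b\<in>Basis. lborel))"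
    by (simp add: lborel_span_Basis[symmetric] nn_integral_lborel_span)
  also have "\<dots> = (\<integral>\<^sup>+t. f (coord_sum Basis t) \<partial>(\<Pi>\<^sub>M b\<in>(Basis - B) \<union> B. lborel))"
    using B by (simp add: Un_absorb2)
  also have "\<dots> = (\<integral>\<^sup>+s. (\<integral>\<^sup>+t. f (coord_sum Basis (merge (Basis - B) B (s, t))) \<partial>(\<Pi>\<^sub>M b\<in>B. lborel)) \<partial>(\<Pi>\<^sub>M b\<in>Basis - B. lborel))"
    using fin B by (intro product_nn_integral_fold) (auto simp: Un_absorb2)
  also have "\<dots> = (\<integral>\<^sup>+s. (\<integral>\<^sup>+t. f (coord_sum (Basis - B) s + t) \<partial>lborel_span B) \<partial>(\<Pi>\<^sub>M b\<in>Basis - B. lborel))"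
    by (simp add: * nn_integral_lborel_span)
  also have "\<dots> = (\<integral>\<^sup>+s. (\<integral>\<^sup>+t. f (s + t) \<partial>lborel_span B) \<partial>lborel_span (Basis - B))"
    by (subst nn_integral_lborel_span) (auto intro!: sB.borel_measurable_nn_integral)
  finally show ?thesis .
qed

text \<open>The unit cube in the complementary coordinates has mass 1. Integrals over
  \<open>span B\<close> thus become integrals over a slab of the full space, where the change of
  variables is available.\<close>

lemma nn_integral_thicken:
  fixes h :: "'a::euclidean_space \<Rightarrow> ennreal"
  assumes B: "B \<subseteq> Basis" and h[measurable]: "h \<in> borel_measurable borel"
  shows "(\<integral>\<^sup>+z. h (proj_on B z) * indicator {z. \<forall>b\<in>Basis - B. z \<bullet> b \<in> {0..1}} z \<partial>lborel) =
         (\<integral>\<^sup>+z. h z \<partial>lborel_span B)"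
proof -
  interpret product_sigma_finite "\<lambda>b::'a. lborel :: real measure" by (rule product_sigma_finite_lborel)
  have fin: "finite B" "finite (Basis - B)" using B finite_subset[OF _ finite_Basis] by blast+
  let ?Q = "{z::'a. \<forall>b\<in>Basis - B. z \<bullet> b \<in> {0..1}}"
  have Q[measurable]: "?Q \<in> sets borel" using fin by measurable
  have 1: "(\<integral>\<^sup>+t. h (proj_on B (s + t)) * indicator ?Q (s + t) \<partial>lborel_span B) =
      (\<integral>\<^sup>+t. h t \<partial>lborel_span B) * indicator ?Q s" if s: "s \<in> span (Basis - B)" for s
  proof -
    have "(\<integral>\<^sup>+t. h (proj_on B (s + t)) * indicator ?Q (s + t) \<partial>lborel_span B) =
       (\<integral>\<^sup>+t. h t * indicator ?Q s \<partial>lborel_span B)"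
    proof (rule nn_integral_lborel_span_cong)
      fix t assume t: "t \<in> span B"
      have "proj_on B (s + t) = t" using s t B
        by (intro euclidean_eqI[where 'a='a]) (auto simp: in_span_Basis_iff lift_inner inner_left_distrib)
      moreover have "s + t \<in> ?Q \<longleftrightarrow> s \<in> ?Q" using t B by (auto simp: in_span_Basis_iff inner_left_distrib)
      ultimately show "h (proj_on B (s + t)) * indicator ?Q (s + t) = h t * indicator ?Q s"
        by (simp add: indicator_def)
    qed measurable
    then show ?thesis by (simp add: nn_integral_multc)
  qed
  have "(\<integral>\<^sup>+z. h (proj_on B z) * indicator ?Q z \<partial>lborel) =
      (\<integral>\<^sup>+s. (\<integral>\<^sup>+t. h (proj_on B (s + t)) * indicator ?Q (s + t) \<partial>lborel_span B) \<partial>lborel_span (Basis - B))"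
    by (rule nn_integral_lborel_split[OF B]) measurable
  also have "\<dots> = (\<integral>\<^sup>+s. (\<integral>\<^sup>+t. h t \<partial>lborel_span B) * indicator ?Q s \<partial>lborel_span (Basis - B))"
  proof -
    interpret sB: sigma_finite_measure "lborel_span B" by (rule sigma_finite_lborel_span[OF B])
    show ?thesis by (rule nn_integral_lborel_span_cong[OF 1]) (auto intro!: sB.borel_measurable_nn_integral)
  qed
  also have "\<dots> = (\<integral>\<^sup>+t. h t \<partial>lborel_span B) * emeasure (lborel_span (Basis - B)) ?Q"
    by (subst nn_integral_cmult_indicator) simp_all
  also have "emeasure (lborel_span (Basis - B)) ?Q = 1"
  proof -
    have "coord_sum (Basis - B) -` ?Q \<inter> space (\<Pi>\<^sub>M b\<in>Basis - B. lborel) = (\<Pi>\<^sub>E b\<in>Basis - B. {0..1})"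
    proof -
      have "coord_sum (Basis - B) t \<in> ?Q \<longleftrightarrow> (\<forall>b\<in>Basis - B. t b \<in> {0..1})" for t :: "'a \<Rightarrow> real"
        by (simp add: coord_sum_inner)
      then show ?thesis by (auto simp: space_PiM PiE_iff)
    qed
    then show ?thesis
      unfolding lborel_span_eq by (simp add: emeasure_distr emeasure_PiM[OF fin(2)])
  qed
  finally show ?thesis by simp
qed

text \<open>The change of variables on a coordinate subspace is reduced to the one on the whole space by
  extending \<open>T\<close> by an isometry of the orthogonal complements.\<close>

lemma nn_integral_slice_change:
  fixes T :: "'a::euclidean_space \<Rightarrow> 'a"
  assumes B: "B \<subseteq> Basis" and B': "B' \<subseteq> Basis" and \<pi>: "bij_betw \<pi> B B'"
    and A: "A \<in> sets borel" and AB: "A \<subseteq> span B" and TB: "T ` A \<subseteq> span B'"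
    and TE: "\<And>E. E \<in> sets borel \<Longrightarrow> E \<subseteq> A \<Longrightarrow> T ` E \<in> sets borel"
    and der: "\<And>y. y \<in> A \<Longrightarrow> (T has_derivative T' y) (at y)"
    and inj: "inj_on T A"
    and meas: "(\<lambda>y. indicator A y * \<bar>det_on B (\<lambda>i j. \<pi> i \<bullet> T' y j)\<bar>) \<in> borel_measurable borel"
    and f: "f \<in> borel_measurable borel"
  shows "(\<integral>\<^sup>+y. indicator (T ` A) y * f y \<partial>lborel_span B') =
    (\<integral>\<^sup>+y. ennreal (indicator A y * \<bar>det_on B (\<lambda>i j. \<pi> i \<bullet> T' y j)\<bar>) * f (T y) \<partial>lborel_span B)"
proof -
  note f[measurable]
  have finB: "finite B" "finite B'" using B B' finite_subset[OF _ finite_Basis] by blast+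
  have "card (Basis - B) = card (Basis - B')"
    using B B' finB bij_betw_same_card[OF \<pi>] by (simp add: card_Diff_subset)
  then obtain \<kappa> where \<kappa>: "bij_betw \<kappa> (Basis - B) (Basis - B')"
    using finite_same_card_bij[of "Basis - B" "Basis - B'"] by auto
  \<comment> \<open>The bijection \<pi> is extended to a permutation of the whole basis. The
    resulting relabelling \<open>R\<close> of coordinates is the isometry that acts on the
    complementary coordinates.\<close>
  define \<rho> where "\<rho> b = (if b \<in> B then \<pi> b else \<kappa> b)" for b
  have \<rho>B: "bij_betw \<rho> B B'" using \<pi> by (rule bij_betw_cong[THEN iffD1, rotated]) (simp add: \<rho>_def)
  have \<rho>C: "bij_betw \<rho> (Basis - B) (Basis - B')" using \<kappa> by (rule bij_betw_cong[THEN iffD1, rotated]) (simp add: \<rho>_def)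
  have \<rho>: "bij_betw \<rho> Basis Basis"
    using bij_betw_combine[OF \<rho>B \<rho>C] B B' by (simp add: Un_absorb1)
  have \<rho>_in: "\<rho> b \<in> Basis" if "b \<in> Basis" for b using \<rho> that by (auto simp: bij_betw_def)
  have \<rho>_inner: "\<rho> a \<bullet> \<rho> b = (if a = b then 1 else 0)" if "a \<in> Basis" "b \<in> Basis" for a b
    using \<rho> \<rho>_in that by (auto simp: inner_Basis bij_betw_def inj_on_def)
  have \<rho>_mem: "\<rho> b \<in> B' \<longleftrightarrow> b \<in> B" if "b \<in> Basis" for b
    using \<rho>B \<rho>C that by (auto simp: bij_betw_def)
  have ballC: "(\<forall>b\<in>Basis - B'. P b) \<longleftrightarrow> (\<forall>b\<in>Basis - B. P (\<rho> b))" for P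
    using \<rho>C by (auto simp: bij_betw_def) (metis DiffI imageE)
  have eqI: "x = y" if "\<And>b. b \<in> Basis \<Longrightarrow> x \<bullet> \<rho> b = y \<bullet> \<rho> b" for x y :: 'a
  proof (rule euclidean_eqI)
    fix b :: 'a assume "b \<in> Basis"
    then obtain a where "a \<in> Basis" "b = \<rho> a" using \<rho> by (metis bij_betw_imp_surj_on imageE)
    then show "x \<bullet> b = y \<bullet> b" using that by simp
  qed
  define R where "R = push Basis \<rho>"
  define R' where "R' = lift Basis \<rho>"
  have R: "R z \<bullet> \<rho> b = z \<bullet> b" if "b \<in> Basis" for z b
    unfolding R_def using push_inner[OF finite_Basis \<rho> that] .
  have R': "R' w \<bullet> b = w \<bullet> \<rho> b" if "b \<in> Basis" for w b
    using that by (simp add: R'_def lift_inner)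
  have linR: "linear R" unfolding R_def by (rule linear_push)
  have [measurable]: "R' \<in> borel_measurable borel" unfolding R'_def by measurable
  define P where "P = proj_on B"
  define P' where "P' = proj_on B'"
  have [measurable]: "P \<in> borel_measurable borel" "P' \<in> borel_measurable borel"
    unfolding P_def P'_def by measurable
  have P: "P z \<bullet> b = (if b \<in> B then z \<bullet> b else 0)" if "b \<in> Basis" for z b
    unfolding P_def by (rule lift_inner[OF B that])
  have P': "P' z \<bullet> b = (if b \<in> B' then z \<bullet> b else 0)" if "b \<in> Basis" for z b
    unfolding P'_def by (rule lift_inner[OF B' that])
  \<comment> \<open>In the coordinates of \<open>B\<close> this is \<open>T\<close>, in the
    remaining ones only the relabelling by \<rho>. The target splits in the same way, since
    \<open>T\<close> maps \<open>A\<close> into \<open>span B'\<close>.\<close>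
  define \<Psi> where "\<Psi> z = T (P z) + R (z - P z)" for z
  define \<Psi>' where "\<Psi>' z v = T' (P z) (P v) + R (v - P v)" for z v
  define X where "X = P -` A"
  have X: "X \<in> sets borel" unfolding X_def using measurable_sets[of P borel borel A] A by simp
  have Tz: "T y \<bullet> \<rho> b = 0" if "y \<in> A" "b \<in> Basis" "b \<notin> B" for y b
    using TB that \<rho>_in \<rho>_mem in_span_Basis_iff[OF B', of "T y"] by auto
  have \<Psi>_inner: "\<Psi> z \<bullet> \<rho> b = (if b \<in> B then T (P z) \<bullet> \<rho> b else z \<bullet> b)" if "b \<in> Basis" "z \<in> X" for z b
    using that Tz[of "P z" b] by (auto simp: \<Psi>_def inner_left_distrib R P inner_diff_left X_def)
  have P'\<Psi>: "P' (\<Psi> z) = T (P z)" if "z \<in> X" for z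
    using that Tz[of "P z"]
    by (intro eqI) (auto simp: P' \<rho>_in \<rho>_mem \<Psi>_inner X_def)
  have R'\<Psi>: "R' (\<Psi> z - P' (\<Psi> z)) = z - P z" if "z \<in> X" for z
    using that Tz[of "P z"]
    by (intro euclidean_eqI[of "R' (\<Psi> z - P' (\<Psi> z))"]) (auto simp: R' P'\<Psi> P \<Psi>_inner X_def inner_diff_left)
  have inj\<Psi>: "inj_on \<Psi> X"
  proof (rule inj_onI)
    fix y z assume yz: "y \<in> X" "z \<in> X" "\<Psi> y = \<Psi> z"
    then have "T (P y) = T (P z)" "y - P y = z - P z" using P'\<Psi> R'\<Psi> by metis+
    moreover from this have "P y = P z" using inj yz by (auto simp: X_def inj_on_def)
    ultimately show "y = z" by simp
  qed
  \<comment> \<open>A Borel left inverse of \<open>T\<close>, defined everywhere. With it the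
    inverse of \<Psi> extends to a Borel map on the whole space, so that \<Psi> sends Borel subsets
    of \<open>X\<close> to Borel sets, as the change of variables demands.\<close>
  define S where "S y = (if y \<in> T ` A then inv_into A T y else 0)" for y
  have TA[measurable]: "T ` A \<in> sets borel" using TE[OF A] by simp
  have S[measurable]: "S \<in> borel_measurable borel"
  proof (rule borel_measurableI)
    fix U :: "'a set" assume U: "open U"
    have "S -` U = T ` (A \<inter> U) \<union> (if 0 \<in> U then - (T ` A) else {})"
    proof (intro set_eqI)
      fix y show "y \<in> S -` U \<longleftrightarrow> y \<in> T ` (A \<inter> U) \<union> (if 0 \<in> U then - (T ` A) else {})"
      proof (cases "y \<in> T ` A")
        case True
        then obtain x where "x \<in> A" "y = T x" by auto
        then show ?thesis using inj by (auto simp: S_def inj_on_def image_iff)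
      qed (auto simp: S_def)
    qed
    then show "S -` U \<inter> space borel \<in> sets borel" using U A TE[of "A \<inter> U"] TA by auto
  qed
  have S_T: "S (T y) = y" if "y \<in> A" for y using that inj by (simp add: S_def)
  have \<Psi>_inverse: "z \<in> X \<and> \<Psi> z = w"
    if y: "y \<in> A" "P' w = T y" and z: "z = y + R' (w - P' w)" for w y z
  proof -
    have wp: "(w - P' w) \<bullet> \<rho> b = (if b \<in> B then 0 else w \<bullet> \<rho> b)" if "b \<in> Basis" for b
      using that by (simp add: inner_diff_left P' \<rho>_in \<rho>_mem)
    have yB: "y \<bullet> b = 0" if "b \<in> Basis" "b \<notin> B" for b
      using y(1) AB that in_span_Basis_iff[OF B, of y] by auto
    have Ty: "T y \<bullet> \<rho> b = w \<bullet> \<rho> b" if "b \<in> B" for b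
      using that B by (subst y(2)[symmetric]) (auto simp: P' \<rho>_in \<rho>_mem subset_iff)
    have Pz: "P z = y"
      by (intro euclidean_eqI[where 'a='a]) (auto simp: P z inner_left_distrib R' wp yB)
    then have "z \<in> X" using y by (simp add: X_def)
    moreover from this have "\<Psi> z = w"
      by (intro eqI) (simp add: \<Psi>_inner Pz Ty, simp add: z inner_left_distrib R' wp yB)
    ultimately show ?thesis by simp
  qed
  have \<Psi>_X: "\<Psi> ` X = P' -` (T ` A)"
  proof (intro set_eqI iffI)
    fix w assume "w \<in> P' -` (T ` A)"
    then obtain y where y: "y \<in> A" "P' w = T y" by auto
    show "w \<in> \<Psi> ` X" using \<Psi>_inverse[OF y refl] by (metis imageI)
  next
    fix w assume "w \<in> \<Psi> ` X"
    then obtain z where "z \<in> X" "w = \<Psi> z" by auto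
    then show "w \<in> P' -` (T ` A)" using P'\<Psi>[of z] by (simp add: X_def)
  qed
  have \<Psi>_img: "\<Psi> ` E = P' -` (T ` A) \<inter> (\<lambda>w. S (P' w) + R' (w - P' w)) -` E" if EX: "E \<subseteq> X" for E
  proof (intro set_eqI iffI)
    fix w assume "w \<in> \<Psi> ` E"
    then obtain z where z: "z \<in> E" "w = \<Psi> z" "z \<in> X" using EX by auto
    then show "w \<in> P' -` (T ` A) \<inter> (\<lambda>w. S (P' w) + R' (w - P' w)) -` E"
      using P'\<Psi>[OF z(3)] R'\<Psi>[OF z(3)] S_T[of "P z"] by (simp add: X_def)
  next
    fix w assume "w \<in> P' -` (T ` A) \<inter> (\<lambda>w. S (P' w) + R' (w - P' w)) -` E"
    then obtain y where y: "y \<in> A" "P' w = T y" and E: "y + R' (w - P' w) \<in> E" by (auto simp: S_T)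
    show "w \<in> \<Psi> ` E" using \<Psi>_inverse[OF y refl] E by (metis imageI)
  qed
  let ?J = "\<lambda>y. \<bar>det_on B (\<lambda>i j. \<pi> i \<bullet> T' y j)\<bar>"
  \<comment> \<open>Permuting the rows by \<rho> costs only a sign. After transposition the rows
    that belong to coordinates outside \<open>B\<close> are unit rows, so the determinant reduces to
    the block of \<open>T'\<close>.\<close>
  have det: "\<bar>det_on Basis (\<lambda>i j. i \<bullet> \<Psi>' z j)\<bar> = ?J (P z)" if "z \<in> X" for z
  proof -
    interpret T': linear "T' (P z)" using der[of "P z"] that by (auto simp: X_def has_derivative_def bounded_linear.linear)
    interpret R: linear R by (rule linR)
    have PB: "P j = j" if "j \<in> B" for j unfolding P_def using that B by (intro proj_on_id span_base)
    have PC: "P j = 0" if "j \<in> Basis - B" for j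
      using that by (intro euclidean_eqI[where 'a='a]) (auto simp: P inner_Basis)
    have Rj: "R j = \<rho> j" if "j \<in> Basis" for j
      using that by (intro eqI) (auto simp: R \<rho>_inner inner_Basis)
    obtain q where q: "q permutes Basis" "\<And>b. b \<in> Basis \<Longrightarrow> q b = \<rho> b"
    proof
      show "(\<lambda>b. if b \<in> Basis then \<rho> b else b) permutes Basis"
        by (rule bij_imp_permutes, rule bij_betw_cong[THEN iffD1, rotated, OF \<rho>]) auto
    qed auto
    have "det_on Basis (\<lambda>i j. \<rho> i \<bullet> \<Psi>' z j) = det_on Basis (\<lambda>i j. q i \<bullet> \<Psi>' z j)"
      by (rule det_on_cong) (auto simp: q(2))
    also have "\<dots> = of_int (sign q) * det_on Basis (\<lambda>i j. i \<bullet> \<Psi>' z j)"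
      by (rule det_on_permute_rows[OF finite_Basis q(1)])
    finally have "\<bar>det_on Basis (\<lambda>i j. i \<bullet> \<Psi>' z j)\<bar> = \<bar>det_on Basis (\<lambda>i j. \<rho> i \<bullet> \<Psi>' z j)\<bar>"
      by (simp add: abs_mult flip: of_int_abs)
    also have "det_on Basis (\<lambda>i j. \<rho> i \<bullet> \<Psi>' z j) = det_on Basis (\<lambda>i j. \<rho> j \<bullet> \<Psi>' z i)"
      by (rule det_on_transpose[OF finite_Basis, symmetric])
    also have "\<dots> = det_on ((Basis - B) \<union> B) (\<lambda>i j. \<rho> j \<bullet> \<Psi>' z i)"
      using B by (simp add: Un_absorb2)
    also have "\<dots> = det_on B (\<lambda>i j. \<rho> j \<bullet> \<Psi>' z i)"
      using B finB by (intro det_on_delta_rows) (auto simp: \<Psi>'_def PC Rj T'.zero \<rho>_inner)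
    also have "\<dots> = det_on B (\<lambda>i j. \<rho> i \<bullet> \<Psi>' z j)" by (rule det_on_transpose[OF finB(1)])
    also have "\<dots> = det_on B (\<lambda>i j. \<pi> i \<bullet> T' (P z) j)"
      by (rule det_on_cong) (auto simp: \<Psi>'_def PB R.zero \<rho>_def)
    finally show ?thesis .
  qed
  have indJ: "indicator X z * \<bar>det_on Basis (\<lambda>i j. i \<bullet> \<Psi>' z j)\<bar> = indicator A (P z) * ?J (P z)" for z
    using det[of z] by (auto simp: indicator_def X_def)
  \<comment> \<open>Nothing is known about \<open>T\<close> outside \<open>A\<close>, so a Borel
    version is needed before the slab can be collapsed to \<open>span B\<close> again.\<close>
  define T0 where "T0 y = (if y \<in> A then T y else 0)" for y
  have "continuous_on A T"
    using der has_derivative_continuous by (intro continuous_at_imp_continuous_on) blast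
  then have T0: "T0 \<in> borel_measurable borel"
    unfolding T0_def using A by (intro borel_measurable_continuous_on_if) auto
  let ?Q = "{z. \<forall>b\<in>Basis - B. z \<bullet> b \<in> {0..1}}" and ?Q' = "{z. \<forall>b\<in>Basis - B'. z \<bullet> b \<in> {0..1}}"
  have [measurable]: "?Q' \<in> sets borel" by measurable
  have "(\<integral>\<^sup>+y. indicator (T ` A) y * f y \<partial>lborel_span B') =
      (\<integral>\<^sup>+w. indicator (T ` A) (P' w) * f (P' w) * indicator ?Q' w \<partial>lborel)"
    unfolding P'_def by (rule nn_integral_thicken[OF B', symmetric]) measurable
  also have "\<dots> = (\<integral>\<^sup>+w. indicator (\<Psi> ` X) w * (f (P' w) * indicator ?Q' w) \<partial>lborel)"
    unfolding \<Psi>_X by (rule nn_integral_cong) (simp add: indicator_def)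
  also have "\<dots> = (\<integral>\<^sup>+z. ennreal (indicator X z * \<bar>det_on Basis (\<lambda>i j. i \<bullet> \<Psi>' z j)\<bar>) * (f (P' (\<Psi> z)) * indicator ?Q' (\<Psi> z)) \<partial>lborel)"
  proof (rule nn_integral_change_of_variables[OF X _ _ inj\<Psi>])
    show "\<Psi> ` E \<in> sets borel" if "E \<in> sets borel" "E \<subseteq> X" for E
    proof -
      have [measurable]: "E \<in> sets borel" by fact
      have "P' -` (T ` A) \<inter> space borel \<in> sets borel" "(\<lambda>w. S (P' w) + R' (w - P' w)) -` E \<inter> space borel \<in> sets borel"
        by measurable
      then show ?thesis unfolding \<Psi>_img[OF that(2)] by auto
    qed
    show "(\<Psi> has_derivative \<Psi>' z) (at z)" if "z \<in> X" for z
    proof -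
      have dP: "(P has_derivative P) (at x)" "(R has_derivative R) (at x)" for x
        by (rule linear_imp_has_derivative, simp add: P_def linear_lift, rule linear_imp_has_derivative[OF linR])
      have "((T \<circ> P) has_derivative (T' (P z) \<circ> P)) (at z)"
        using that by (intro diff_chain_at dP der) (simp add: X_def)
      moreover have "((R \<circ> (\<lambda>z. z - P z)) has_derivative (R \<circ> (\<lambda>v. v - P v))) (at z)"
        by (intro diff_chain_at dP has_derivative_diff has_derivative_ident)
      ultimately show ?thesis unfolding \<Psi>_def[abs_def] \<Psi>'_def[abs_def]
        by (auto simp: comp_def dest: has_derivative_add)
    qed
    show "(\<lambda>z. indicator X z * \<bar>det_on Basis (\<lambda>i j. i \<bullet> \<Psi>' z j)\<bar>) \<in> borel_measurable borel"
      unfolding indJ using measurable_comp[of P borel borel, OF _ meas] by (simp add: comp_def)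
  qed measurable
  also have "\<dots> = (\<integral>\<^sup>+z. ennreal (indicator A (P z) * ?J (P z)) * f (T (P z)) * indicator ?Q z \<partial>lborel)"
  proof (rule nn_integral_cong)
    fix z
    show "ennreal (indicator X z * \<bar>det_on Basis (\<lambda>i j. i \<bullet> \<Psi>' z j)\<bar>) * (f (P' (\<Psi> z)) * indicator ?Q' (\<Psi> z)) =
      ennreal (indicator A (P z) * ?J (P z)) * f (T (P z)) * indicator ?Q z"
    proof (cases "z \<in> X")
      case True
      \<comment> \<open>The complementary coordinates are only relabelled, hence the unit cube of
        the target pulls back to that of the source.\<close>
      then have "\<Psi> z \<in> ?Q' \<longleftrightarrow> z \<in> ?Q" by (simp only: mem_Collect_eq ballC) (auto simp: \<Psi>_inner)
      then have "indicator ?Q' (\<Psi> z) = (indicator ?Q z :: ennreal)" by (simp only: indicator_def)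
      then show ?thesis unfolding indJ by (simp only: P'\<Psi>[OF True] mult.assoc)
    next
      case False
      then show ?thesis by (simp add: X_def)
    qed
  qed
  also have "\<dots> = (\<integral>\<^sup>+z. ennreal (indicator A (P z) * ?J (P z)) * f (T0 (P z)) * indicator ?Q z \<partial>lborel)"
    by (rule nn_integral_cong) (simp add: T0_def indicator_def)
  also have "\<dots> = (\<integral>\<^sup>+y. ennreal (indicator A y * ?J y) * f (T0 y) \<partial>lborel_span B)"
    unfolding P_def
  proof (rule nn_integral_thicken[OF B])
    show "(\<lambda>y. ennreal (indicator A y * ?J y) * f (T0 y)) \<in> borel_measurable borel"
      by (intro borel_measurable_times_ennreal measurable_compose[OF meas measurable_ennreal]
          measurable_compose[OF T0 f])
  qed
  also have "\<dots> = (\<integral>\<^sup>+y. ennreal (indicator A y * ?J y) * f (T y) \<partial>lborel_span B)"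
    by (rule nn_integral_cong) (simp add: T0_def indicator_def)
  finally show ?thesis .
qed

lemma lborel_distr_push:
  fixes \<sigma> :: "'a::euclidean_space \<Rightarrow> 'b::euclidean_space"
  assumes B: "B \<subseteq> Basis" and \<sigma>: "bij_betw \<sigma> B Basis"
  shows "distr (lborel_span B) borel (push B \<sigma>) = lborel"
proof (rule lborel_eqI[symmetric])
  interpret product_sigma_finite "\<lambda>b::'a. lborel :: real measure" by (rule product_sigma_finite_lborel)
  have fin: "finite B" using B finite_subset[OF _ finite_Basis] by blast
  let ?S = "push B \<sigma>"
  note S = push_inner[OF fin \<sigma>]
  fix l u :: 'b assume lu: "\<And>b. b \<in> Basis \<Longrightarrow> l \<bullet> b \<le> u \<bullet> b"
  have "coord_sum B -` (?S -` box l u) \<inter> space (\<Pi>\<^sub>M b\<in>B. lborel) = (\<Pi>\<^sub>E b\<in>B. {l \<bullet> \<sigma> b<..<u \<bullet> \<sigma> b})"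
  proof -
    have "?S (coord_sum B t) \<in> box l u \<longleftrightarrow> (\<forall>b\<in>B. t b \<in> {l \<bullet> \<sigma> b<..<u \<bullet> \<sigma> b})" for t
    proof -
      have "?S (coord_sum B t) \<in> box l u \<longleftrightarrow> (\<forall>b\<in>B. ?S (coord_sum B t) \<bullet> \<sigma> b \<in> {l \<bullet> \<sigma> b<..<u \<bullet> \<sigma> b})"
        unfolding mem_box bij_betw_imp_surj_on[OF \<sigma>, symmetric] by simp
      also have "\<dots> \<longleftrightarrow> (\<forall>b\<in>B. t b \<in> {l \<bullet> \<sigma> b<..<u \<bullet> \<sigma> b})"
        by (rule ball_cong[OF refl]) (use B in \<open>simp only: S, simp add: coord_sum_inner subset_iff\<close>)
      finally show ?thesis .
    qed
    then show ?thesis by (auto simp: space_PiM PiE_iff)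
  qed
  moreover have "?S -` box l u \<in> sets borel"
    using measurable_sets[of ?S borel borel "box l u"] by simp
  ultimately have "emeasure (distr (lborel_span B) borel ?S) (box l u) = (\<Prod>b\<in>B. emeasure lborel {l \<bullet> \<sigma> b<..<u \<bullet> \<sigma> b})"
    unfolding lborel_span_eq by (simp add: emeasure_distr emeasure_PiM[OF fin])
  also have "\<dots> = (\<Prod>b\<in>B. ennreal ((u - l) \<bullet> \<sigma> b))"
    using lu bij_betwE[OF \<sigma>] by (intro prod.cong) (auto simp: inner_diff_left)
  also have "\<dots> = (\<Prod>i\<in>Basis. ennreal ((u - l) \<bullet> i))"
    by (rule prod.reindex_bij_betw[OF \<sigma>])
  also have "\<dots> = ennreal (\<Prod>i\<in>Basis. (u - l) \<bullet> i)"
    using lu by (intro prod_ennreal) (simp add: inner_diff_left)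
  finally show "emeasure (distr (lborel_span B) borel ?S) (box l u) = ennreal (\<Prod>i\<in>Basis. (u - l) \<bullet> i)" .
qed simp

lemma sets_restrict_restrict:
  "W \<subseteq> P \<Longrightarrow> sets (restrict_space (restrict_space M P) W) = sets (restrict_space M W)"
  unfolding sets_restrict_space image_image by (intro image_cong) auto

section \<open>Smooth maps and the inverse function theorem\<close>

lemma Ck_on_cong_aux:
  assumes "open S"
  shows "(\<And>x. x \<in> S \<Longrightarrow> f x = g x) \<Longrightarrow> Ck_on k f S \<Longrightarrow> Ck_on k g S"
proof (induct k arbitrary: f g)
  case 0
  then show ?case by (simp cong: continuous_on_cong)
next
  case (Suc k)
  have der: "(g has_derivative frechet_derivative f (at x)) (at x)" if "x \<in> S" for x
    using Suc.prems(2) that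
    by (intro has_derivative_transform_within_open[OF _ assms that Suc.prems(1)])
       (auto simp: frechet_derivative_works[symmetric])
  have "frechet_derivative f (at x) v = frechet_derivative g (at x) v" if "x \<in> S" for x v
    using frechet_derivative_at[OF der[OF that]] by simp
  then show ?case
    using der Suc.hyps[of "\<lambda>x. frechet_derivative f (at x) v" "\<lambda>x. frechet_derivative g (at x) v" for v] Suc.prems(2)
    by (auto simp: differentiable_def)
qed

lemma Ck_on_cong:
  assumes "open S" "\<And>x. x \<in> S \<Longrightarrow> f x = g x"
  shows "Ck_on k f S \<longleftrightarrow> Ck_on k g S"
  using Ck_on_cong_aux[OF assms(1)] assms(2) by metis

text \<open>Lets the inductions below work with an explicit formula for the derivative instead of
  \<open>frechet_derivative\<close>.\<close>

lemma Ck_on_Suc_intro: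
  assumes "open S" "\<And>x. x \<in> S \<Longrightarrow> (f has_derivative f' x) (at x)" and "\<And>v. Ck_on k (\<lambda>x. f' x v) S"
  shows "Ck_on (Suc k) f S"
proof -
  have "f' x = frechet_derivative f (at x)" if "x \<in> S" for x
    using assms(2)[OF that] by (rule frechet_derivative_at)
  then have "Ck_on k (\<lambda>x. frechet_derivative f (at x) v) S" for v
    by (intro Ck_on_cong_aux[OF assms(1) _ assms(3)[of v]]) simp
  then show ?thesis using assms(2) by (auto simp: differentiable_def)
qed

lemma Ck_on_has_derivative:
  assumes "Ck_on (Suc k) f S" "x \<in> S"
  shows "(f has_derivative frechet_derivative f (at x)) (at x)"
  using assms by (auto simp: frechet_derivative_works[symmetric])

lemma Ck_on_SucD: "Ck_on (Suc k) f S \<Longrightarrow> Ck_on k f S"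
proof (induct k arbitrary: f)
  case 0
  then show ?case
    by (auto intro!: continuous_at_imp_continuous_on differentiable_imp_continuous_within)
next
  case (Suc k)
  then show ?case by auto
qed

lemma Ck_on_subset: "Ck_on k f S \<Longrightarrow> T \<subseteq> S \<Longrightarrow> Ck_on k f T"
  by (induct k arbitrary: f) (auto intro: continuous_on_subset)

lemma Ck_on_const: "open S \<Longrightarrow> Ck_on k (\<lambda>x. c) S"
  by (induct k arbitrary: c) (auto intro!: Ck_on_Suc_intro derivative_intros)

lemma Ck_on_bounded_linear: 
  assumes "open S" "bounded_linear L" shows "Ck_on k L S"
proof (cases k)
  case 0
  then show ?thesis using assms by (simp add: linear_continuous_on)
next
  case (Suc k)
  then show ?thesis using assms
    by (auto intro!: Ck_on_Suc_intro[of S L "\<lambda>_. L"] Ck_on_const bounded_linear_imp_has_derivative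
        simp del: Ck_on.simps)
qed

lemma Ck_on_compose_linear:
  assumes S: "open S" and L: "bounded_linear L"
  shows "Ck_on k f S \<Longrightarrow> Ck_on k (\<lambda>x. L (f x)) S"
proof (induct k arbitrary: f)
  case 0
  then show ?case using L by (simp add: bounded_linear.continuous_on)
next
  case (Suc k)
  show ?case
    by (rule Ck_on_Suc_intro[OF S bounded_linear.has_derivative[OF L Ck_on_has_derivative[OF Suc.prems]]])
       (use Suc in auto)
qed

lemma Ck_on_add:
  assumes S: "open S"
  shows "Ck_on k f S \<Longrightarrow> Ck_on k g S \<Longrightarrow> Ck_on k (\<lambda>x. f x + g x) S"
proof (induct k arbitrary: f g)
  case 0
  then show ?case by (simp add: continuous_on_add)
next
  case (Suc k)
  show ?case
    by (rule Ck_on_Suc_intro[OF S has_derivative_add[OF Ck_on_has_derivative[OF Suc.prems(1)] Ck_on_has_derivative[OF Suc.prems(2)]]])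
       (use Suc in auto)
qed

lemma Ck_on_bilinear:
  assumes S: "open S" and h: "bounded_bilinear h"
  shows "Ck_on k f S \<Longrightarrow> Ck_on k g S \<Longrightarrow> Ck_on k (\<lambda>x. h (f x) (g x)) S"
proof (induct k arbitrary: f g)
  case 0
  then show ?case using h by (simp add: bounded_bilinear.continuous_on)
next
  case (Suc k)
  show ?case
  proof (rule Ck_on_Suc_intro[OF S])
    show "((\<lambda>x. h (f x) (g x)) has_derivative
        (\<lambda>v. h (f x) (frechet_derivative g (at x) v) + h (frechet_derivative f (at x) v) (g x))) (at x)"
      if "x \<in> S" for x
      using bounded_bilinear.FDERIV[OF h Ck_on_has_derivative[OF Suc.prems(1) that] Ck_on_has_derivative[OF Suc.prems(2) that]] .
    show "Ck_on k (\<lambda>x. h (f x) (frechet_derivative g (at x) v) + h (frechet_derivative f (at x) v) (g x)) S" for v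
      using Suc.prems by (intro Ck_on_add[OF S] Suc.hyps Ck_on_SucD[OF Suc.prems(1)] Ck_on_SucD[OF Suc.prems(2)]) auto
  qed
qed

lemmas Ck_on_mult = Ck_on_bilinear[OF _ bounded_bilinear_mult]
lemmas Ck_on_scaleR = Ck_on_bilinear[OF _ bounded_bilinear_scaleR]

lemma Ck_on_sum:
  assumes "open S" "\<And>i. i \<in> I \<Longrightarrow> Ck_on k (f i) S"
  shows "Ck_on k (\<lambda>x. \<Sum>i\<in>I. f i x) S"
  using assms by (induct I rule: infinite_finite_induct) (auto intro: Ck_on_const Ck_on_add)

lemma Ck_on_prod:
  fixes f :: "'i \<Rightarrow> 'a::euclidean_space \<Rightarrow> real"
  assumes "open S" "\<And>i. i \<in> I \<Longrightarrow> Ck_on k (f i) S"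
  shows "Ck_on k (\<lambda>x. \<Prod>i\<in>I. f i x) S"
  using assms by (induct I rule: infinite_finite_induct) (auto intro: Ck_on_const Ck_on_mult)

text \<open>The derivative of 1/f contains 1/f itself only as a factor, and for that factor the
  induction hypothesis provides \<open>Ck_on k\<close>.\<close>

lemma Ck_on_inverse:
  fixes f :: "'a::euclidean_space \<Rightarrow> real"
  assumes S: "open S" and nz: "\<And>x. x \<in> S \<Longrightarrow> f x \<noteq> 0"
  shows "Ck_on k f S \<Longrightarrow> Ck_on k (\<lambda>x. inverse (f x)) S"
proof (induct k)
  case 0
  then show ?case using nz by (auto intro!: continuous_on_inverse)
next
  case (Suc k)
  note i = Suc.hyps[OF Ck_on_SucD[OF Suc.prems]]
  show ?case
  proof (rule Ck_on_Suc_intro[OF S])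
    show "((\<lambda>x. inverse (f x)) has_derivative (\<lambda>v. - (inverse (f x) * frechet_derivative f (at x) v * inverse (f x)))) (at x)"
      if "x \<in> S" for x
      by (rule Deriv.has_derivative_inverse[OF nz[OF that] Ck_on_has_derivative[OF Suc.prems that]])
    show "Ck_on k (\<lambda>x. - (inverse (f x) * frechet_derivative f (at x) v * inverse (f x))) S" for v
      using Suc.prems
      by (intro Ck_on_compose_linear[OF S bounded_linear_minus[OF bounded_linear_ident]] Ck_on_mult S i) auto
  qed
qed

text \<open>The chain rule yields a derivative of \<open>g\<close> in a direction that varies with
  the point. Expanded in the basis it becomes a sum of scalar coefficients times derivatives of
  \<open>g\<close> in fixed directions, composed with \<open>f\<close>; the induction hypothesis,
  which is general in \<open>g\<close>, applies to these.\<close>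

lemma Ck_on_compose:
  fixes f :: "'a::euclidean_space \<Rightarrow> 'b::euclidean_space"
  assumes S: "open S" and T: "open T" and fS: "f ` S \<subseteq> T"
  shows "Ck_on k f S \<Longrightarrow> Ck_on k g T \<Longrightarrow> Ck_on k (\<lambda>x. g (f x)) S"
proof (induct k arbitrary: g)
  case 0
  then show ?case using fS by (auto intro: continuous_on_compose2)
next
  case (Suc k)
  let ?f = "\<lambda>x. frechet_derivative f (at x)" and ?g = "\<lambda>y. frechet_derivative g (at y)"
  have f: "(f has_derivative ?f x) (at x)" if "x \<in> S" for x
    by (rule Ck_on_has_derivative[OF Suc.prems(1) that])
  have g: "(g has_derivative ?g (f x)) (at (f x))" if "x \<in> S" for x
    using fS that by (intro Ck_on_has_derivative[OF Suc.prems(2)]) auto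
  have der: "((\<lambda>x. g (f x)) has_derivative (\<lambda>v. ?g (f x) (?f x v))) (at x)" if "x \<in> S" for x
    using diff_chain_at[OF f[OF that] g[OF that]] by (simp add: comp_def)
  show ?case
  proof (rule Ck_on_Suc_intro[OF S der])
    fix v
    have "Ck_on k (\<lambda>x. \<Sum>b\<in>Basis. (?f x v \<bullet> b) *\<^sub>R ?g (f x) b) S"
    proof (intro Ck_on_sum S Ck_on_scaleR)
      fix b :: 'b
      have "Ck_on k (\<lambda>x. ?f x v) S" "Ck_on k (\<lambda>y. ?g y b) T" using Suc.prems by auto
      then show "Ck_on k (\<lambda>x. ?f x v \<bullet> b) S" "Ck_on k (\<lambda>x. ?g (f x) b) S"
        using Suc.hyps[OF Ck_on_SucD[OF Suc.prems(1)], of "\<lambda>y. ?g y b"]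
        by (auto intro: Ck_on_compose_linear[OF S bounded_linear_inner_left])
    qed
    moreover have "(\<Sum>b\<in>Basis. (?f x v \<bullet> b) *\<^sub>R ?g (f x) b) = ?g (f x) (?f x v)" if "x \<in> S" for x
    proof -
      interpret linear "?g (f x)" using g[OF that] by (simp add: has_derivative_def bounded_linear.linear)
      have "?g (f x) (?f x v) = ?g (f x) (\<Sum>b\<in>Basis. (?f x v \<bullet> b) *\<^sub>R b)" by (simp add: euclidean_representation)
      then show ?thesis by (simp add: sum scale)
    qed
    ultimately show "Ck_on k (\<lambda>x. ?g (f x) (?f x v)) S" using Ck_on_cong[OF S] by (metis (no_types, lifting))
  qed
qed

lemma Ck_on_det_on:
  assumes "open S" "\<And>i j. i \<in> B \<Longrightarrow> j \<in> B \<Longrightarrow> Ck_on k (\<lambda>x. G x i j) S"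
  shows "Ck_on k (\<lambda>x. det_on B (G x)) S"
  unfolding det_on_def using assms
  by (intro Ck_on_sum Ck_on_mult Ck_on_prod Ck_on_const) (auto simp: permutes_in_image)

section \<open>Determinants of endomorphisms, Cramer's rule and smooth local inverses\<close>

lemma det_on_compose:
  fixes L M :: "'a::euclidean_space \<Rightarrow> 'a"
  assumes "linear L"
  shows "det_on Basis (\<lambda>i j. i \<bullet> L (M j)) = det_on Basis (\<lambda>i j. i \<bullet> L j) * det_on Basis (\<lambda>i j. i \<bullet> M j)"
proof -
  interpret linear L by fact
  have "i \<bullet> L (M j) = (\<Sum>k\<in>Basis. (i \<bullet> L k) * (k \<bullet> M j))" for i j
  proof -
    have "L (M j) = L (\<Sum>k\<in>Basis. (M j \<bullet> k) *\<^sub>R k)" by (simp add: euclidean_representation)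
    then show ?thesis by (simp add: sum scale inner_sum_right inner_commute mult.commute)
  qed
  then show ?thesis by (simp add: det_on_mult)
qed

lemma det_on_ident: "det_on Basis (\<lambda>i j. i \<bullet> (j::'a::euclidean_space)) = 1"
  using det_on_delta[of "Basis :: 'a set"] by (simp add: inner_Basis cong: det_on_cong)

lemma det_on_bij_nonzero:
  fixes L :: "'a::euclidean_space \<Rightarrow> 'a"
  assumes "linear L" "bij L"
  shows "det_on Basis (\<lambda>i j. i \<bullet> L j) \<noteq> 0"
proof -
  have "det_on Basis (\<lambda>i j. i \<bullet> L (inv L j)) = 1"
    using assms(2) by (simp add: bij_is_surj surj_f_inv_f det_on_ident)
  then show ?thesis using det_on_compose[OF assms(1), of "inv L"] by auto
qed

text \<open>Replacing column \<open>j\<close> of \<open>L\<close> by \<open>L x\<close> is the same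
  as composing \<open>L\<close> with the map that replaces the basis vector \<open>j\<close> by
  \<open>x\<close>, and the latter has determinant \<open>x \<bullet> j\<close>.\<close>

lemma cramer_det_on:
  fixes L :: "'a::euclidean_space \<Rightarrow> 'a"
  assumes L: "linear L" and j: "j \<in> Basis"
  shows "det_on Basis (\<lambda>i k. i \<bullet> (if k = j then L x else L k)) = det_on Basis (\<lambda>i j. i \<bullet> L j) * (x \<bullet> j)"
proof -
  define M where "M k = (if k = j then x else k)" for k
  have "det_on Basis (\<lambda>i k. i \<bullet> (if k = j then L x else L k)) = det_on Basis (\<lambda>i k. i \<bullet> L (M k))"
    by (rule det_on_cong) (auto simp: M_def)
  also have "\<dots> = det_on Basis (\<lambda>i j. i \<bullet> L j) * det_on Basis (\<lambda>i k. i \<bullet> M k)"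
    by (rule det_on_compose[OF L])
  also have "det_on Basis (\<lambda>i k. i \<bullet> M k) = det_on Basis (\<lambda>i k. k \<bullet> M i)"
    by (rule det_on_transpose[OF finite_Basis, symmetric])
  also have "\<dots> = det_on ((Basis - {j}) \<union> {j}) (\<lambda>i k. k \<bullet> M i)" using j by (simp add: insert_absorb)
  also have "\<dots> = det_on {j} (\<lambda>i k. k \<bullet> M i)"
    using j by (intro det_on_delta_rows) (auto simp: M_def inner_Basis)
  finally show ?thesis by (simp add: det_on_singleton M_def inner_commute)
qed

text \<open>By Cramer's rule the coordinates of the inverse are quotients of polynomials in the
  matrix entries of \<open>A\<close>, with nonvanishing denominator.\<close>

lemma Ck_on_inv_linear:
  fixes A :: "'a::euclidean_space \<Rightarrow> 'b::euclidean_space \<Rightarrow> 'b"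
  assumes S: "open S" and lin: "\<And>x. x \<in> S \<Longrightarrow> linear (A x)" and bij: "\<And>x. x \<in> S \<Longrightarrow> bij (A x)"
    and A: "\<And>v. Ck_on k (\<lambda>x. A x v) S"
  shows "Ck_on k (\<lambda>x. inv (A x) v) S"
proof -
  let ?d = "\<lambda>x. det_on Basis (\<lambda>i j. i \<bullet> A x j)"
  let ?n = "\<lambda>j x. det_on Basis (\<lambda>i k. i \<bullet> (if k = j then v else A x k))"
  have "inv (A x) v = (\<Sum>j\<in>Basis. (?n j x * inverse (?d x)) *\<^sub>R j)" if "x \<in> S" for x
  proof -
    have e: "A x (inv (A x) v) = v" using bij[OF that] by (simp add: bij_is_surj surj_f_inv_f)
    have "?n j x = ?d x * (inv (A x) v \<bullet> j)" if "j \<in> Basis" for j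
      using cramer_det_on[OF lin[OF \<open>x \<in> S\<close>] that, of "inv (A x) v"] unfolding e .
    moreover have "?d x \<noteq> 0" using lin bij that by (intro det_on_bij_nonzero)
    ultimately have "(\<Sum>j\<in>Basis. (?n j x * inverse (?d x)) *\<^sub>R j) = (\<Sum>j\<in>Basis. (inv (A x) v \<bullet> j) *\<^sub>R j)"
      by (intro sum.cong) auto
    then show ?thesis by (simp add: euclidean_representation)
  qed
  moreover have "Ck_on k (\<lambda>x. \<Sum>j\<in>Basis. (?n j x * inverse (?d x)) *\<^sub>R j) S"
  proof (intro Ck_on_sum S Ck_on_scaleR Ck_on_mult Ck_on_inverse Ck_on_det_on Ck_on_const)
    show "?d x \<noteq> 0" if "x \<in> S" for x using lin bij that by (intro det_on_bij_nonzero)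
    show "Ck_on k (\<lambda>x. i \<bullet> A x j) S" for i j
      by (rule Ck_on_compose_linear[OF S bounded_linear_inner_right A])
    show "Ck_on k (\<lambda>x. i \<bullet> (if k' = j then v else A x k')) S" for i j k'
      using Ck_on_compose_linear[OF S bounded_linear_inner_right A] Ck_on_const[OF S] by (cases "k' = j") auto
  qed
  ultimately show ?thesis using Ck_on_cong[OF S] by (metis (no_types, lifting))
qed

lemma smooth_onD: "smooth_on S f \<Longrightarrow> x \<in> S \<Longrightarrow> (f has_derivative frechet_derivative f (at x)) (at x)"
  unfolding smooth_on_def using Ck_on_has_derivative by blast

lemma smooth_on_continuous_on: "smooth_on S f \<Longrightarrow> continuous_on S f"
  unfolding smooth_on_def by (metis Ck_on.simps(1))

lemma smooth_on_derivative: "smooth_on S f \<Longrightarrow> smooth_on S (\<lambda>x. frechet_derivative f (at x) v)"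
  unfolding smooth_on_def by (metis Ck_on.simps(2))

lemma smooth_on_subset: "smooth_on S f \<Longrightarrow> T \<subseteq> S \<Longrightarrow> smooth_on T f"
  unfolding smooth_on_def using Ck_on_subset by blast

lemma smooth_on_cong: "open S \<Longrightarrow> (\<And>x. x \<in> S \<Longrightarrow> f x = g x) \<Longrightarrow> smooth_on S f \<longleftrightarrow> smooth_on S g"
  unfolding smooth_on_def using Ck_on_cong by metis

lemma smooth_on_compose:
  fixes f :: "'a::euclidean_space \<Rightarrow> 'b::euclidean_space"
  assumes "open S" "open T" "f ` S \<subseteq> T" "smooth_on S f" "smooth_on T g"
  shows "smooth_on S (\<lambda>x. g (f x))"
  using assms Ck_on_compose unfolding smooth_on_def by blast

lemma smooth_on_id: "open S \<Longrightarrow> smooth_on S (\<lambda>x. x)"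
  unfolding smooth_on_def using Ck_on_bounded_linear bounded_linear_ident by blast

lemma smooth_on_const: "open S \<Longrightarrow> smooth_on S (\<lambda>x. c)"
  unfolding smooth_on_def using Ck_on_const by blast

lemma smooth_on_add: "open S \<Longrightarrow> smooth_on S f \<Longrightarrow> smooth_on S g \<Longrightarrow> smooth_on S (\<lambda>x. f x + g x)"
  unfolding smooth_on_def using Ck_on_add by blast

lemma smooth_on_linear: "open S \<Longrightarrow> bounded_linear L \<Longrightarrow> smooth_on S f \<Longrightarrow> smooth_on S (\<lambda>x. L (f x))"
  unfolding smooth_on_def using Ck_on_compose_linear by blast

text \<open>The inverse function theorem supplies only a differentiable inverse \<open>g\<close>.
  Its derivative is the inverse of the derivative of \<open>G\<close>, evaluated at
  \<open>g y\<close>; so if \<open>g\<close> is C^k, then so is its derivative, and \<open>g\<close>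
  is C^(k+1).\<close>

lemma smooth_local_inverse:
  fixes G :: "'a::euclidean_space \<Rightarrow> 'a"
  assumes S: "open S" and x: "x \<in> S" and G: "smooth_on S G" and bij: "bij (frechet_derivative G (at x))"
  shows "\<exists>U V g. open U \<and> U \<subseteq> S \<and> x \<in> U \<and> open V \<and> homeomorphism U V G g \<and> smooth_on V g"
proof -
  \<comment> \<open>The inverse function theorem asks for a derivative that is continuous as a map
    into the bounded operators. In finite dimension this can be checked in each direction
    separately.\<close>
  define D where "D z = Blinfun (frechet_derivative G (at z))" for z
  have D: "blinfun_apply (D z) = frechet_derivative G (at z)" if "z \<in> S" for z
    using smooth_onD[OF G that] unfolding D_def
    by (intro bounded_linear_Blinfun_apply) (simp add: has_derivative_def)
  have bl: "bounded_linear (frechet_derivative G (at x))" using smooth_onD[OF G x] by (simp add: has_derivative_def)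
  have "bounded_linear (inv (frechet_derivative G (at x)))"
  proof -
    have "linear (inv (frechet_derivative G (at x)))"
      using bl bij by (simp add: inj_linear_imp_inv_linear bij_is_inj bounded_linear.linear)
    then show ?thesis by (simp add: linear_linear)
  qed
  then have inv: "Blinfun (inv (frechet_derivative G (at x))) o\<^sub>L D x = id_blinfun"
    using bij by (intro blinfun_eqI) (simp add: D[OF x] bounded_linear_Blinfun_apply bij_is_inj)
  have derD: "\<And>z. z \<in> S \<Longrightarrow> (G has_derivative blinfun_apply (D z)) (at z)"
    using smooth_onD[OF G] D by simp
  have contD: "continuous_on S D"
    using smooth_on_continuous_on[OF smooth_on_derivative[OF G]]
    by (intro continuous_on_blinfun_componentwise) (simp add: D cong: continuous_on_cong)
  obtain U V g g' where UV: "open U" "U \<subseteq> S" "x \<in> U" "open V" "homeomorphism U V G g"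
    and g': "\<And>y. y \<in> V \<Longrightarrow> (g has_derivative (g' y)) (at y)"
       "\<And>y. y \<in> V \<Longrightarrow> g' y = inv (blinfun_apply (D (g y)))"
       "\<And>y. y \<in> V \<Longrightarrow> bij (blinfun_apply (D (g y)))"
    using inverse_function_theorem[where f = G and f' = D, OF S derD contD x inv] by metis
  have gV: "g y \<in> U" if "y \<in> V" for y using UV(5) that by (auto simp: homeomorphism_def)
  have bijU: "bij (frechet_derivative G (at z))" if "z \<in> U" for z
    using g'(3)[of "G z"] that UV by (auto simp: homeomorphism_def D subset_iff)
  have linU: "linear (frechet_derivative G (at z))" if "z \<in> U" for z
    using smooth_onD[OF G, of z] UV that by (auto simp: has_derivative_def bounded_linear.linear)
  have "Ck_on k g V" for k
  proof (induct k)
    case 0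
    show ?case using UV(5) by (simp add: homeomorphism_def)
  next
    case (Suc k)
    show ?case
    proof (rule Ck_on_Suc_intro[OF UV(4) g'(1)])
      fix v
      have "Ck_on k (\<lambda>z. inv (frechet_derivative G (at z)) v) U"
        using smooth_on_subset[OF smooth_on_derivative[OF G] UV(2)]
        by (intro Ck_on_inv_linear[OF UV(1) linU bijU]) (auto simp: smooth_on_def)
      then have "Ck_on k (\<lambda>y. inv (frechet_derivative G (at (g y))) v) V"
        using gV by (intro Ck_on_compose[OF UV(4) UV(1) _ Suc]) auto
      then show "Ck_on k (\<lambda>y. g' y v) V"
        using Ck_on_cong[OF UV(4), of "\<lambda>y. g' y v"] g'(2) D[OF subsetD[OF UV(2) gV]] by simp
    qed
  qed
  then show ?thesis using UV unfolding smooth_on_def by blast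
qed

section \<open>The Jacobian as a ratio of Gram determinants\<close>

text \<open>Stated for an indexed family because it is applied to horizontal parts \<open>w\<close>,
  for which injectivity is not established.\<close>

lemma span_image_sum:
  assumes "finite I" "x \<in> span (w ` I)"
  shows "\<exists>c. x = (\<Sum>i\<in>I. c i *\<^sub>R w i)"
proof -
  have "span (w ` I) \<subseteq> range (\<lambda>c. \<Sum>i\<in>I. c i *\<^sub>R w i)"
  proof (rule span_minimal)
    show "w ` I \<subseteq> range (\<lambda>c. \<Sum>i\<in>I. c i *\<^sub>R w i)"
    proof
      fix y assume "y \<in> w ` I"
      then obtain k where "k \<in> I" "y = w k" by auto
      then have "y = (\<Sum>i\<in>I. (if i = k then 1 else 0) *\<^sub>R w i)"
        using assms(1) by (simp add: if_distrib[of "\<lambda>a. a *\<^sub>R _"] cong: if_cong)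
      then show "y \<in> range (\<lambda>c. \<Sum>i\<in>I. c i *\<^sub>R w i)"
        by (rule range_eqI[where x = "\<lambda>i. if i = k then 1 else 0"])
    qed
    show "subspace (range (\<lambda>c. \<Sum>i\<in>I. c i *\<^sub>R w i))"
    proof (rule subspaceI)
      show "0 \<in> range (\<lambda>c. \<Sum>i\<in>I. c i *\<^sub>R w i)" by (rule image_eqI[of _ _ "\<lambda>_. 0"]) auto
    next
      fix x y assume "x \<in> range (\<lambda>c. \<Sum>i\<in>I. c i *\<^sub>R w i)" "y \<in> range (\<lambda>c. \<Sum>i\<in>I. c i *\<^sub>R w i)"
      then obtain c d where "x = (\<Sum>i\<in>I. c i *\<^sub>R w i)" "y = (\<Sum>i\<in>I. d i *\<^sub>R w i)" by auto
      then show "x + y \<in> range (\<lambda>c. \<Sum>i\<in>I. c i *\<^sub>R w i)"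
        by (intro image_eqI[of _ _ "\<lambda>i. c i + d i"]) (auto simp: scaleR_left_distrib sum.distrib)
    next
      fix r x assume "x \<in> range (\<lambda>c. \<Sum>i\<in>I. c i *\<^sub>R w i)"
      then obtain c where "x = (\<Sum>i\<in>I. c i *\<^sub>R w i)" by auto
      then show "r *\<^sub>R x \<in> range (\<lambda>c. \<Sum>i\<in>I. c i *\<^sub>R w i)"
        by (intro image_eqI[of _ _ "\<lambda>i. r * c i"]) (auto simp: scaleR_sum_right)
    qed
  qed
  then show ?thesis using assms(2) by auto
qed

text \<open>The square of the Jacobian is the ratio of the Gram determinants of \<open>h\<close> pulled back by \<open>D\<close>
  and of \<open>g\<close> on any basis of the horizontal space. The vectors \<open>w i\<close> below are the horizontal parts
  of the \<open>e i\<close>.\<close>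

lemma det_endo_adjoint:
  fixes D :: "'a::euclidean_space \<Rightarrow> 'b::euclidean_space"
  assumes g: "inner_prod g" and h: "inner_prod h" and D: "linear D" "surj D"
    and H_def: "H = {u. \<forall>v\<in>{v. D v = 0}. g u v = 0}"
    and adj: "\<And>x. adj x = (THE u. u \<in> H \<and> (\<forall>v\<in>H. g u v = h x (D v)))"
    and fin: "finite I0" "finite I1" and disj: "I0 \<inter> I1 = {}"
    and inj: "inj_on e (I0 \<union> I1)" and ind: "independent (e ` (I0 \<union> I1))"
    and spn: "span (e ` (I0 \<union> I1)) = UNIV"
    and V: "{v. D v = 0} = span (e ` I0)" and card: "card I1 = DIM('b)"
  shows "det_endo H (adj \<circ> D) * det_on (I0 \<union> I1) (\<lambda>i j. g (e i) (e j)) =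
     det_on I1 (\<lambda>i j. h (D (e i)) (D (e j))) * det_on I0 (\<lambda>i j. g (e i) (e j))"
proof -
  interpret D: linear D by (rule D(1))
  have lr: "linear (g u)" and ll: "linear (\<lambda>u. g u v)" for u v using inner_prod_linear[OF g] by auto
  define V where "V = {v. D v = 0}"
  have subV: "subspace V" unfolding V_def by (auto simp: subspace_def D.add D.scale)
  have subH: "subspace H" unfolding H_def
    by (auto simp: subspace_def linear_0[OF ll] linear_add[OF ll] linear_scale[OF ll])
  have HV0: "u = 0" if "u \<in> H" "u \<in> V" for u
    using that inner_prodD(3)[OF g, of u] by (auto simp: H_def V_def)
  have decomp: "\<exists>v\<in>V. u - v \<in> H" for u
  proof -
    obtain v where "v \<in> V" "\<forall>x\<in>V. g v x = g u x"
      using riesz_subspace[OF g subV lr[of u]] by blast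
    then show ?thesis by (auto simp: H_def V_def linear_diff[OF ll])
  qed
  have adjH: "adj x \<in> H \<and> (\<forall>v\<in>H. g (adj x) v = h x (D v))" for x
  proof -
    have "linear (\<lambda>v. h x (D v))"
      using linear_compose[OF D(1) inner_prod_linear(1)[OF h]] by (simp add: comp_def)
    from riesz_subspace[OF g subH this] show ?thesis unfolding adj by (rule theI')
  qed
  \<comment> \<open>\<open>det_endo\<close> evaluates the determinant in this basis; only its
    defining property is known, so the result has to be compared with the given family
    \<open>e\<close>.\<close>
  define B where "B = (SOME B. independent B \<and> span B = H)"
  have "\<exists>B. independent B \<and> span B = H"
    using basis_exists[of H] by (metis span_eq_iff span_mono span_span subH subset_antisym)
  then have B: "independent B" "span B = H" unfolding B_def by (metis (mono_tags, lifting) someI_ex)+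
  have finB: "finite B" using B(1) by (rule independent_imp_finite)
  have dimH: "card B = DIM('b)"
  proof -
    have "inj_on D (span H)"
      using subH HV0 linear_inj_on_iff_eq_0[OF D(1) subH]
      by (simp add: span_eq_iff[THEN iffD2] V_def)
    then have "dim (D ` H) = dim H" by (rule dim_image_eq[OF D(1)])
    moreover have "D ` H = UNIV"
    proof (intro set_eqI iffI UNIV_I)
      fix y
      obtain u where u: "y = D u" using D(2) by (metis surjD)
      obtain v where "v \<in> V" "u - v \<in> H" using decomp by blast
      then have "y = D (u - v)" by (simp add: u D.diff V_def)
      then show "y \<in> D ` H" using \<open>u - v \<in> H\<close> by blast
    qed
    ultimately have "dim H = DIM('b)" by simp
    then show ?thesis using dim_span[of B] B dim_eq_card_independent[OF B(1)] by simp
  qed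
  define T where "T = adj \<circ> D"
  define X where "X i k = representation B (T i) k" for i k
  have X: "T i = (\<Sum>k\<in>B. X i k *\<^sub>R k)" for i
    unfolding X_def using adjH B finB by (intro sum_representation_eq[symmetric]) (auto simp: T_def)
  have "det_endo H (adj \<circ> D) = det_on B X"
    unfolding det_endo_def Let_def B_def[symmetric] T_def[symmetric]
    using det_on_transpose[OF finB, of X] by (simp add: X_def)
  moreover have "det_on B (\<lambda>i j. h (D i) (D j)) = det_on B X * det_on B (\<lambda>i j. g i j)"
  proof -
    \<comment> \<open>The adjoint turns \<open>h\<close> pulled back by \<open>D\<close> into
      \<open>g\<close> with \<open>T\<close> applied on one side. Hence the pulled back Gram matrix
      is the matrix of \<open>T\<close> times the Gram matrix of \<open>g\<close>.\<close>
    have "h (D i) (D j) = (\<Sum>k\<in>B. X i k * g k j)" if "i \<in> B" "j \<in> B" for i j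
    proof -
      have "h (D i) (D j) = g (T i) j" using adjH that B by (auto simp: T_def span_base)
      also have "\<dots> = (\<Sum>k\<in>B. X i k * g k j)"
        by (subst X) (simp add: linear_sum[OF ll] linear_scale[OF ll])
      finally show ?thesis .
    qed
    then have "det_on B (\<lambda>i j. h (D i) (D j)) = det_on B (\<lambda>i j. \<Sum>k\<in>B. X i k * g k j)"
      by (intro det_on_cong) auto
    then show ?thesis using det_on_mult[OF finB, of X g] by simp
  qed
  \<comment> \<open>\<open>D\<close> maps \<open>H\<close> isomorphically onto its target, so
    \<open>B\<close> has as many elements as \<open>I1\<close> and can be indexed by it.\<close>
  moreover obtain \<beta> where \<beta>: "bij_betw \<beta> I1 B"
    using finite_same_card_bij[OF fin(2) finB] card dimH by auto
  ultimately have J2: "det_on I1 (\<lambda>i j. h (D (\<beta> i)) (D (\<beta> j))) =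
      det_endo H (adj \<circ> D) * det_on I1 (\<lambda>i j. g (\<beta> i) (\<beta> j))"
    using det_on_reindex[OF \<beta> fin(2), of "\<lambda>i j. h (D i) (D j)"] det_on_reindex[OF \<beta> fin(2), of g] by simp
  have "\<exists>v. \<forall>i. v i \<in> V \<and> e i - v i \<in> H" using decomp by (intro choice) blast
  then obtain v where v: "\<And>i. v i \<in> V" "\<And>i. e i - v i \<in> H" by blast
  define w where "w i = e i - v i" for i
  have wH: "w i \<in> H" and Dw: "D (w i) = D (e i)" for i
    using v[of i] by (simp_all add: w_def V_def D.diff)
  have "\<exists>c. v i = (\<Sum>k\<in>I0. c k *\<^sub>R e k)" for i
    using v(1)[of i] V span_image_sum[OF fin(1), of "v i" e] by (simp add: V_def)
  then obtain a where a: "\<And>i. v i = (\<Sum>k\<in>I0. a i k *\<^sub>R e k)" by metis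
  let ?I = "I0 \<union> I1"
  have finI: "finite ?I" using fin by simp
  have a': "det_on ?I (\<lambda>i j. g (e i) (e j)) = det_on I0 (\<lambda>i j. g (e i) (e j)) * det_on I1 (\<lambda>i j. g (w i) (w j))"
  proof -
    \<comment> \<open>Replacing \<open>e i\<close>, for \<open>i\<close> in \<open>I1\<close>, by
      its horizontal part \<open>w i\<close> is a unit triangular change. It makes the Gram matrix
      block diagonal, because horizontal and vertical vectors are orthogonal.\<close>
    define E where "E i k = (if i = k then 1 else if i \<in> I1 \<and> k \<in> I0 then - a i k else 0)" for i k
    define e' where "e' i = (if i \<in> I1 then w i else e i)" for i
    have "det_on ?I (\<lambda>i j. g (e' i) (e' j)) = (det_on ?I E)\<^sup>2 * det_on ?I (\<lambda>i j. g (e i) (e j))"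
    proof (rule det_on_gram_change[OF inner_prodD(1)[OF g] finI])
      fix i assume i: "i \<in> ?I"
      have "(\<Sum>k\<in>?I. E i k *\<^sub>R e k) = (\<Sum>k\<in>?I. (if i = k then 1 else 0) *\<^sub>R e k) + (\<Sum>k\<in>?I. (if i \<in> I1 \<and> k \<in> I0 then - a i k else 0) *\<^sub>R e k)"
        unfolding sum.distrib[symmetric] scaleR_left_distrib[symmetric] using disj
        by (intro sum.cong) (auto simp: E_def)
      also have "(\<Sum>k\<in>?I. (if i = k then 1 else 0) *\<^sub>R e k) = e i"
        using i finI by (simp add: if_distrib[of "\<lambda>a. a *\<^sub>R _"] cong: if_cong)
      also have "(\<Sum>k\<in>?I. (if i \<in> I1 \<and> k \<in> I0 then - a i k else 0) *\<^sub>R e k) = (\<Sum>k\<in>I0. (if i \<in> I1 then - a i k else 0) *\<^sub>R e k)"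
        using finI by (intro sum.mono_neutral_cong_right) auto
      also have "\<dots> = (if i \<in> I1 then - v i else 0)" by (simp add: a sum_negf)
      finally show "e' i = (\<Sum>k\<in>?I. E i k *\<^sub>R e k)" by (simp add: e'_def w_def)
    qed
    moreover have "det_on ?I E = 1"
    proof -
      have "det_on ?I E = det_on I1 E"
        using fin disj by (intro det_on_delta_rows) (auto simp: E_def)
      also have "\<dots> = det_on I1 (\<lambda>i j. if i = j then 1 else 0)"
        using disj by (intro det_on_cong) (auto simp: E_def)
      finally show ?thesis using det_on_delta[OF fin(2)] by simp
    qed
    moreover have "det_on ?I (\<lambda>i j. g (e' i) (e' j)) = det_on I0 (\<lambda>i j. g (e' i) (e' j)) * det_on I1 (\<lambda>i j. g (e' i) (e' j))"
    proof (rule det_on_block_diagonal[OF fin disj])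
      have z: "g (w j) (e i) = 0" if "i \<in> I0" for i j
      proof -
        have "e i \<in> {v. D v = 0}" unfolding V using that by (intro span_base) auto
        then show ?thesis using wH[of j] by (simp add: H_def)
      qed
      show "g (e' i) (e' j) = 0" if "i \<in> I0" "j \<in> I1" for i j
        using z that disj by (subst inner_prodD(2)[OF g]) (auto simp: e'_def)
      show "g (e' i) (e' j) = 0" if "i \<in> I1" "j \<in> I0" for i j
        using z that disj by (auto simp: e'_def)
    qed
    moreover have "det_on I0 (\<lambda>i j. g (e' i) (e' j)) = det_on I0 (\<lambda>i j. g (e i) (e j))"
      using disj by (intro det_on_cong) (auto simp: e'_def)
    moreover have "det_on I1 (\<lambda>i j. g (e' i) (e' j)) = det_on I1 (\<lambda>i j. g (w i) (w j))"
      by (intro det_on_cong) (auto simp: e'_def)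
    ultimately show ?thesis by simp
  qed
  have Hw: "H \<subseteq> span (w ` I1)"
  proof
    fix u assume u: "u \<in> H"
    have "u \<in> span (e ` ?I)" using spn by simp
    then obtain c where c: "u = (\<Sum>i\<in>?I. c i *\<^sub>R e i)" using span_image_sum[OF finI] by blast
    define u' where "u' = (\<Sum>i\<in>I1. c i *\<^sub>R w i)"
    have "u' \<in> H" unfolding u'_def by (intro subspace_sum subspace_scale subH wH)
    moreover have "u - u' \<in> V"
    proof -
      have "D u = D (\<Sum>i\<in>I0. c i *\<^sub>R e i) + D (\<Sum>i\<in>I1. c i *\<^sub>R e i)"
        using fin disj by (simp add: c sum.union_disjoint D.add)
      also have "(\<Sum>i\<in>I0. c i *\<^sub>R e i) \<in> {v. D v = 0}"
        unfolding V by (intro span_sum span_scale span_base) auto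
      then have "D (\<Sum>i\<in>I0. c i *\<^sub>R e i) = 0" by simp
      also have "D (\<Sum>i\<in>I1. c i *\<^sub>R e i) = D u'"
        by (simp add: u'_def D.sum D.scale Dw)
      finally show ?thesis by (simp add: V_def D.diff)
    qed
    moreover have "u - u' \<in> H" using u \<open>u' \<in> H\<close> subH by (simp add: subspace_diff)
    ultimately have "u = u'" using HV0[of "u - u'"] by simp
    moreover have "u' \<in> span (w ` I1)" unfolding u'_def
      by (intro span_sum span_scale span_base) auto
    ultimately show "u \<in> span (w ` I1)" by simp
  qed
  have "\<exists>c. \<beta> i = (\<Sum>k\<in>I1. c k *\<^sub>R w k)" if "i \<in> I1" for i
  proof -
    have "\<beta> i \<in> H" using \<beta> B(2) that by (metis bij_betwE span_base)
    then show ?thesis using Hw by (intro span_image_sum[OF fin(2)]) auto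
  qed
  then obtain F where F: "\<And>i. i \<in> I1 \<Longrightarrow> \<beta> i = (\<Sum>k\<in>I1. F i k *\<^sub>R w k)" by metis
  have bil: "bilinear (\<lambda>x y. h (D x) (D y))"
    using inner_prodD(1)[OF h] by (auto simp: bilinear_def linear_iff D.add D.scale)
  \<comment> \<open>Passing from \<open>w\<close> to \<beta> multiplies both Gram determinants by
    the same factor, the square of the determinant of \<open>F\<close>. It is nonzero because the
    left side of \<open>c1\<close> is positive, so it cancels from \<open>J2\<close>.\<close>
  have c1: "det_on I1 (\<lambda>i j. g (\<beta> i) (\<beta> j)) = (det_on I1 F)\<^sup>2 * det_on I1 (\<lambda>i j. g (w i) (w j))"
    by (rule det_on_gram_change[OF inner_prodD(1)[OF g] fin(2) F])
  have c2: "det_on I1 (\<lambda>i j. h (D (\<beta> i)) (D (\<beta> j))) = (det_on I1 F)\<^sup>2 * det_on I1 (\<lambda>i j. h (D (e i)) (D (e j)))"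
    using det_on_gram_change[OF bil fin(2) F] by (simp add: Dw)
  have "det_on I1 (\<lambda>i j. g (\<beta> i) (\<beta> j)) > 0"
    using \<beta> B(1) by (intro gram_det_pos[OF g fin(2)]) (auto simp: bij_betw_def)
  then have "(det_on I1 F)\<^sup>2 \<noteq> 0" using c1 by auto
  then have "det_on I1 (\<lambda>i j. h (D (e i)) (D (e j))) = det_endo H (adj \<circ> D) * det_on I1 (\<lambda>i j. g (w i) (w j))"
    using J2 unfolding c1 c2 by (simp add: mult.left_commute)
  then show ?thesis using a' by simp
qed

section \<open>Riemannian volume\<close>

lemma nn_suminf_swap:
  fixes f :: "nat \<Rightarrow> nat \<Rightarrow> ennreal"
  shows "(\<Sum>i. \<Sum>j. f i j) = (\<Sum>j. \<Sum>i. f i j)"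
proof -
  have "(\<Sum>i. \<Sum>j. f i j) = (\<integral>\<^sup>+i. (\<Sum>j. f i j) \<partial>count_space UNIV)"
    by (rule nn_integral_count_space_nat[symmetric])
  also have "\<dots> = (\<Sum>j. \<integral>\<^sup>+i. f i j \<partial>count_space UNIV)" by (rule nn_integral_suminf) simp
  finally show ?thesis by (simp only: nn_integral_count_space_nat)
qed

section \<open>Charts, transition maps and the metric in charts\<close>

locale riem =
  fixes X :: "('p::{t2_space, second_countable_topology}, 'e::euclidean_space) rmanifold"
  assumes riem: "riemannian_manifold X"
begin

abbreviation tr where "tr c d x \<equiv> frechet_derivative (transition c d) (at (snd c x))"

lemma atlas_chart: "c \<in> atlas X \<Longrightarrow> is_chart (points X) c"
  using riem by (auto simp: riemannian_manifold_def smooth_manifold_def)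

lemma cover: "\<Union>(fst ` atlas X) = points X"
  using riem by (auto simp: riemannian_manifold_def smooth_manifold_def)

lemma compatible: "c \<in> atlas X \<Longrightarrow> d \<in> atlas X \<Longrightarrow> smooth_compatible c d"
  using riem by (auto simp: riemannian_manifold_def smooth_manifold_def)

lemma maximal: "is_chart (points X) c \<Longrightarrow> (\<And>d. d \<in> atlas X \<Longrightarrow> smooth_compatible c d) \<Longrightarrow> c \<in> atlas X"
  using riem unfolding riemannian_manifold_def smooth_manifold_def by blast

lemma chart_domain: "c \<in> atlas X \<Longrightarrow> fst c \<subseteq> points X"
  using cover by auto

lemma chart_domain_open: "c \<in> atlas X \<Longrightarrow> \<exists>U. open U \<and> fst c = points X \<inter> U"
  using atlas_chart by (auto simp: is_chart_def openin_open)

lemma chart_inj: "c \<in> atlas X \<Longrightarrow> inj_on (snd c) (fst c)"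
  using atlas_chart unfolding is_chart_def homeomorphism_def by (metis inj_on_inverseI)

lemma chart_inv [simp]: "c \<in> atlas X \<Longrightarrow> x \<in> fst c \<Longrightarrow> chart_inv c (snd c x) = x"
  by (simp add: chart_inv_def chart_inj)

lemma chart_inv_in: "c \<in> atlas X \<Longrightarrow> y \<in> snd c ` fst c \<Longrightarrow> chart_inv c y \<in> fst c"
  by auto

lemma chart_homeo: 
  assumes "c \<in> atlas X" shows "homeomorphism (fst c) (snd c ` fst c) (snd c) (chart_inv c)"
proof -
  obtain g where g: "homeomorphism (fst c) (snd c ` fst c) (snd c) g"
    using atlas_chart[OF assms] by (auto simp: is_chart_def)
  then have "chart_inv c y = g y" if "y \<in> snd c ` fst c" for y
    using that assms by (auto simp: homeomorphism_def)
  then show ?thesis using g unfolding homeomorphism_def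
    by (auto cong: continuous_on_cong image_cong)
qed

lemma chart_continuous: "c \<in> atlas X \<Longrightarrow> continuous_on (fst c) (snd c)"
  and chart_inv_continuous: "c \<in> atlas X \<Longrightarrow> continuous_on (snd c ` fst c) (chart_inv c)"
  using chart_homeo by (auto simp: homeomorphism_def)

lemma chart_open: "c \<in> atlas X \<Longrightarrow> open (snd c ` fst c)"
  using atlas_chart by (auto simp: is_chart_def)

lemma chart_open_image:
  assumes c: "c \<in> atlas X" and W: "openin (top_of_set (points X)) W" "W \<subseteq> fst c"
  shows "open (snd c ` W)"
proof -
  have "openin (top_of_set (fst c)) W"
    using W chart_domain[OF c] by (metis openin_subset_trans)
  then have "openin (top_of_set (snd c ` fst c)) (snd c ` W)"
    by (rule homeomorphism_imp_open_map[OF chart_homeo[OF c]])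
  then show ?thesis using chart_open[OF c] by (rule openin_open_trans)
qed

lemma overlap_open:
  assumes "c \<in> atlas X" "d \<in> atlas X"
  shows "open (snd c ` (fst c \<inter> fst d))"
  using assms atlas_chart[of c] atlas_chart[of d]
  by (intro chart_open_image) (auto simp: is_chart_def)

lemma transition_smooth:
  assumes "c \<in> atlas X" "d \<in> atlas X"
  shows "smooth_on (snd c ` (fst c \<inter> fst d)) (transition c d)"
  using compatible[OF assms] by (simp add: smooth_compatible_def)

lemma transition_app [simp]: "c \<in> atlas X \<Longrightarrow> x \<in> fst c \<Longrightarrow> transition c d (snd c x) = snd d x"
  by (simp add: transition_def)

lemma transition_derivative:
  assumes "c \<in> atlas X" "d \<in> atlas X" "x \<in> fst c" "x \<in> fst d"
  shows "(transition c d has_derivative tr c d x) (at (snd c x))"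
  using assms by (intro smooth_onD[OF transition_smooth]) auto

lemma transition_linear:
  assumes "c \<in> atlas X" "d \<in> atlas X" "x \<in> fst c" "x \<in> fst d"
  shows "linear (tr c d x)"
  using transition_derivative[OF assms] by (auto simp: has_derivative_def bounded_linear.linear)

lemma transition_inverse:
  assumes c: "c \<in> atlas X" "d \<in> atlas X" and x: "x \<in> fst c" "x \<in> fst d"
  shows "tr d c x (tr c d x v) = v"
proof -
  have "(transition d c \<circ> transition c d has_derivative (tr d c x \<circ> tr c d x)) (at (snd c x))"
    using transition_derivative[OF c x] transition_derivative[OF c(2,1) x(2,1)] c x
    by (intro diff_chain_at) simp_all
  moreover have "(transition d c \<circ> transition c d has_derivative (\<lambda>v. v)) (at (snd c x))"
    by (rule has_derivative_transform_within_open[OF has_derivative_ident overlap_open[OF c]])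
       (use c x in auto)
  ultimately have "tr d c x \<circ> tr c d x = (\<lambda>v. v)" by (rule has_derivative_unique)
  then show ?thesis by (metis comp_apply)
qed

lemma transition_bij:
  assumes c: "c \<in> atlas X" "d \<in> atlas X" and x: "x \<in> fst c" "x \<in> fst d"
  shows "bij (tr c d x)"
  by (rule bijI') (use transition_inverse[OF c x] transition_inverse[OF c(2,1) x(2,1)] in metis)+

lemma metric_inner_prod:
  assumes "c \<in> atlas X" "y \<in> snd c ` fst c"
  shows "inner_prod (metric X c y)"
  using riem assms unfolding riemannian_manifold_def inner_prod_def by blast

lemma metric_change:
  assumes "c \<in> atlas X" "d \<in> atlas X" "x \<in> fst c" "x \<in> fst d"
  shows "metric X c (snd c x) u v = metric X d (snd d x) (tr c d x u) (tr c d x v)"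
  using riem assms unfolding riemannian_manifold_def by blast

lemma metric_continuous:
  assumes "c \<in> atlas X" shows "continuous_on (snd c ` fst c) (\<lambda>y. metric X c y u v)"
  using riem assms unfolding riemannian_manifold_def by (blast intro: smooth_on_continuous_on)

lemma gram_continuous:
  assumes "c \<in> atlas X" shows "continuous_on (snd c ` fst c) (\<lambda>y. det_on B (metric X c y))"
  unfolding det_on_def by (intro continuous_intros metric_continuous[OF assms])

lemma gram_pos:
  assumes "c \<in> atlas X" "y \<in> snd c ` fst c" "B \<subseteq> Basis"
  shows "det_on B (metric X c y) > 0"
  using gram_det_pos[OF metric_inner_prod[OF assms(1,2)], of B "\<lambda>b. b"] assms(3)
    finite_subset[OF assms(3) finite_Basis] independent_mono[OF independent_Basis assms(3)] by simp

section \<open>The volume computed in a single slice chart\<close>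

text \<open>Cut off outside the image of the chart, where \<open>metric\<close> is subject to no
  conditions; this makes it a Borel function on the whole model space.\<close>

definition dens where
  "dens c B y = ennreal (indicator (snd c ` fst c) y * sqrt (det_on B (metric X c y)))"

lemma dens_eq: "y \<in> snd c ` fst c \<Longrightarrow> dens c B y = ennreal (sqrt (det_on B (metric X c y)))"
  by (simp add: dens_def)

lemma dens_measurable [measurable]:
  assumes c: "c \<in> atlas X" shows "dens c B \<in> borel_measurable borel"
proof -
  have "(\<lambda>y. if y \<in> snd c ` fst c then sqrt (det_on B (metric X c y)) else 0) \<in> borel_measurable borel"
    by (intro borel_measurable_continuous_on_if borel_open chart_open[OF c] continuous_intros gram_continuous[OF c])
  moreover have "dens c B = (\<lambda>y. ennreal (if y \<in> snd c ` fst c then sqrt (det_on B (metric X c y)) else 0))"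
    by (auto simp: dens_def fun_eq_iff indicator_def)
  ultimately show ?thesis by simp
qed

lemma sliceD:
  assumes "slice_chart X S c B"
  shows "c \<in> atlas X" "B \<subseteq> Basis" "snd c ` (fst c \<inter> S) = snd c ` fst c \<inter> span B"
  using assms by (auto simp: slice_chart_def)

lemma chart_domain_sets:
  assumes c: "c \<in> atlas X" and S: "S \<subseteq> points X"
  shows "fst c \<inter> S \<in> sets (restrict_space borel S)"
proof -
  obtain U where "open U" "fst c = points X \<inter> U" using chart_domain_open[OF c] by auto
  then show ?thesis using S by (auto simp: sets_restrict_space intro!: image_eqI[of _ _ U])
qed

lemma chart_vimage_sets:
  assumes c: "c \<in> atlas X" and S: "S \<subseteq> points X" and E: "E \<in> sets borel"
  shows "{x \<in> fst c \<inter> S. snd c x \<in> E} \<in> sets (restrict_space borel S)"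
proof -
  have "snd c \<in> borel_measurable (restrict_space borel (fst c \<inter> S))"
    by (intro borel_measurable_continuous_on_restrict continuous_on_subset[OF chart_continuous[OF c]]) simp
  from measurable_sets[OF this E]
  obtain A where A: "A \<in> sets borel" "{x \<in> fst c \<inter> S. snd c x \<in> E} = (fst c \<inter> S) \<inter> A"
    by (auto simp: sets_restrict_space space_restrict_space vimage_def Int_def conj_ac)
  then have "{x \<in> fst c \<inter> S. snd c x \<in> E} = (fst c \<inter> S) \<inter> (S \<inter> A)" by auto
  moreover have "S \<inter> A \<in> sets (restrict_space borel S)" using A by (auto simp: sets_restrict_space)
  ultimately show ?thesis using chart_domain_sets[OF c S] by auto
qed

lemma chart_inv_measurable:
  assumes c: "c \<in> atlas X"
  shows "(\<lambda>y. if y \<in> snd c ` fst c then chart_inv c y else x0) \<in> borel_measurable borel"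
  by (intro borel_measurable_continuous_on_if borel_open chart_open[OF c] chart_inv_continuous[OF c]) simp

text \<open>The image under the chart is a preimage under the inverse chart, intersected with the
  Borel set that \<open>S\<close> occupies in the coordinates.\<close>

lemma slice_image_borel:
  assumes s: "slice_chart X S c B" and A: "A \<in> sets (restrict_space borel S)" "A \<subseteq> fst c"
  shows "snd c ` A \<in> sets borel"
proof -
  note c = sliceD[OF s]
  obtain A' where A': "A' \<in> sets borel" "A = S \<inter> A'" using A by (auto simp: sets_restrict_space)
  let ?k = "\<lambda>y. if y \<in> snd c ` fst c then chart_inv c y else undefined"
  have "snd c ` A = (snd c ` fst c \<inter> span B) \<inter> ?k -` A'"
  proof (intro set_eqI iffI)
    fix y assume "y \<in> snd c ` A"
    then obtain x where x: "x \<in> A" "y = snd c x" by auto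
    then have "x \<in> fst c" "x \<in> S" "x \<in> A'" using A A' by auto
    moreover from this have "y \<in> snd c ` fst c \<inter> span B" unfolding c(3)[symmetric] x(2) by blast
    ultimately show "y \<in> (snd c ` fst c \<inter> span B) \<inter> ?k -` A'"
      using x(2) c(1) by simp
  next
    fix y assume y: "y \<in> (snd c ` fst c \<inter> span B) \<inter> ?k -` A'"
    then have "y \<in> snd c ` (fst c \<inter> S)" using c(3) by auto
    then obtain x where "x \<in> fst c" "x \<in> S" "y = snd c x" by auto
    then show "y \<in> snd c ` A" using y A' c by auto
  qed
  moreover have "?k -` A' \<in> sets borel"
    using measurable_sets[OF chart_inv_measurable[OF c(1)] A'(1)] by simp
  ultimately show ?thesis using chart_open[OF c(1)] by auto
qed

definition chart_vol where
  "chart_vol c B A = emeasure (density (lborel_span B) (dens c B)) (snd c ` A)"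

lemma chart_vol_eq:
  assumes s: "slice_chart X S c B" and A: "A \<in> sets (restrict_space borel S)" "A \<subseteq> fst c"
  shows "chart_vol c B A = (\<integral>\<^sup>+y\<in>snd c ` A. ennreal (sqrt (det_on B (metric X c y))) \<partial>lborel_span B)"
proof -
  have "chart_vol c B A = (\<integral>\<^sup>+y\<in>snd c ` A. dens c B y \<partial>lborel_span B)"
    unfolding chart_vol_def using sliceD(1)[OF s] slice_image_borel[OF s A] by (simp add: emeasure_density)
  also have "\<dots> = (\<integral>\<^sup>+y\<in>snd c ` A. ennreal (sqrt (det_on B (metric X c y))) \<partial>lborel_span B)"
    using A by (intro nn_integral_cong) (auto simp: indicator_def dens_eq)
  finally show ?thesis .
qed

lemma is_riemannian_volume_iff:
  "is_riemannian_volume X S \<mu> \<longleftrightarrow> sets \<mu> = sets (restrict_space borel S) \<and>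
     (\<forall>c B. slice_chart X S c B \<longrightarrow> (\<forall>A\<in>sets \<mu>. A \<subseteq> fst c \<longrightarrow> emeasure \<mu> A = chart_vol c B A))"
  unfolding is_riemannian_volume_def by (simp add: chart_vol_eq cong: conj_cong)

lemma chart_vol_UN:
  fixes A :: "nat \<Rightarrow> 'p set"
  assumes s: "slice_chart X S c B" and A: "\<And>n. A n \<in> sets (restrict_space borel S)" "\<And>n. A n \<subseteq> fst c"
    and disj: "disjoint_family A"
  shows "(\<Sum>n. chart_vol c B (A n)) = chart_vol c B (\<Union>n. A n)"
proof -
  have "disjoint_family (\<lambda>n. snd c ` A n)"
    unfolding disjoint_family_on_def
  proof (intro ballI impI)
    fix m n :: nat assume "m \<noteq> n"
    then have "snd c ` (A m \<inter> A n) = {}" using disj by (auto simp: disjoint_family_on_def)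
    then show "snd c ` A m \<inter> snd c ` A n = {}"
      using inj_on_image_Int[OF chart_inj[OF sliceD(1)[OF s]] A(2)[of m] A(2)[of n]] by simp
  qed
  then show ?thesis
    unfolding chart_vol_def image_UN using slice_image_borel[OF s A]
    by (intro suminf_emeasure) auto
qed

section \<open>Independence of the volume from the slice chart\<close>

text \<open>Near \<open>snd c x\<close> the transition map sends points of \<open>span B\<close> to
  \<open>span B'\<close>, since both describe points of \<open>S\<close>. Along the line through
  \<open>snd c x\<close> in direction \<open>v\<close> the coordinates outside \<open>B'\<close>
  therefore vanish, and so do their derivatives.\<close>

lemma slice_transition_span:
  assumes s: "slice_chart X S c B" "slice_chart X S d B'" and x: "x \<in> fst c" "x \<in> fst d" "x \<in> S"
    and v: "v \<in> span B"
  shows "tr c d x v \<in> span B'"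
proof -
  note c = sliceD[OF s(1)] note d = sliceD[OF s(2)]
  let ?O = "snd c ` (fst c \<inter> fst d)"
  have "snd c x \<in> ?O" using x by auto
  then obtain e where e: "e > 0" "ball (snd c x) e \<subseteq> ?O"
    using overlap_open[OF c(1) d(1)] by (meson openE)
  have Tspan: "transition c d y \<in> span B'" if "y \<in> ?O" "y \<in> span B" for y
  proof -
    have "y \<in> snd c ` (fst c \<inter> S)" unfolding c(3) using that by auto
    then obtain z where z: "z \<in> fst c" "z \<in> S" "y = snd c z" by auto
    moreover have "z \<in> fst d" using that(1) z c(1) by (auto dest: inj_onD[OF chart_inj[OF c(1)]])
    ultimately have "snd d z \<in> snd d ` (fst d \<inter> S)" by auto
    then have "snd d z \<in> span B'" unfolding d(3) by auto
    then show ?thesis using z c by simp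
  qed
  have xB: "snd c x \<in> span B" using c(3) x by blast
  have "((\<lambda>t::real. snd c x + t *\<^sub>R v) has_derivative (\<lambda>t. t *\<^sub>R v)) (at 0)"
    by (auto intro!: derivative_eq_intros)
  moreover have "(transition c d has_derivative tr c d x) (at (snd c x + 0 *\<^sub>R v))"
    using transition_derivative[OF c(1) d(1) x(1,2)] by simp
  ultimately have der: "(transition c d \<circ> (\<lambda>t::real. snd c x + t *\<^sub>R v) has_derivative tr c d x \<circ> (\<lambda>t. t *\<^sub>R v)) (at 0)"
    by (rule diff_chain_at)
  have "((\<lambda>t::real. snd c x + t *\<^sub>R v) \<longlongrightarrow> snd c x + 0 *\<^sub>R v) (at 0)" by (intro tendsto_intros)
  then have "eventually (\<lambda>t::real. snd c x + t *\<^sub>R v \<in> ball (snd c x) e) (at 0)"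
    using e(1) by (intro topological_tendstoD) auto
  then have ev: "eventually (\<lambda>t::real. transition c d (snd c x + t *\<^sub>R v) \<in> span B') (at 0)"
  proof eventually_elim
    case (elim t)
    then show ?case using e(2) xB v by (intro Tspan) (auto intro!: span_add span_scale)
  qed
  have "tr c d x v \<bullet> i = 0" if i: "i \<in> Basis - B'" for i
  proof -
    have "((\<lambda>t::real. transition c d (snd c x + t *\<^sub>R v) \<bullet> i) has_derivative (\<lambda>t. tr c d x (t *\<^sub>R v) \<bullet> i)) (at 0)"
      using has_derivative_inner_left[OF der] by (simp add: comp_def)
    moreover have "((\<lambda>t::real. transition c d (snd c x + t *\<^sub>R v) \<bullet> i) has_derivative (\<lambda>t. 0)) (at 0)"
    proof (rule has_derivative_transform_eventually[OF has_derivative_const])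
      show "eventually (\<lambda>t::real. 0 = transition c d (snd c x + t *\<^sub>R v) \<bullet> i) (at 0)"
        using ev by eventually_elim (use i in_span_Basis_iff[OF d(2)] in auto)
      show "0 = transition c d (snd c x + 0 *\<^sub>R v) \<bullet> i"
        using Tspan[of "snd c x"] x xB i in_span_Basis_iff[OF d(2)] by auto
    qed simp
    ultimately have "(\<lambda>t. tr c d x (t *\<^sub>R v) \<bullet> i) = (\<lambda>t. 0)" by (rule has_derivative_unique)
    then show ?thesis by (auto dest: fun_cong[of _ _ 1])
  qed
  then show ?thesis by (simp add: in_span_Basis_iff[OF d(2)])
qed

text \<open>The derivative of the transition map embeds \<open>span B\<close> into
  \<open>span B'\<close>; exchanging the charts gives the other inequality.\<close>

lemma slice_card_eq:
  assumes s: "slice_chart X S c B" "slice_chart X S d B'" and x: "x \<in> fst c" "x \<in> fst d" "x \<in> S"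
  shows "card B = card B'"
proof -
  have "card B \<le> card B'" if s: "slice_chart X S c B" "slice_chart X S d B'" and x: "x \<in> fst c" "x \<in> fst d" for c d B B'
  proof -
    note c = sliceD[OF s(1)] note d = sliceD[OF s(2)]
    have "inj_on (tr c d x) (span B)"
      using transition_bij[OF c(1) d(1) x] by (meson bij_is_inj inj_on_subset subset_UNIV)
    then have "dim (tr c d x ` span B) = dim (span B)"
      using dim_image_eq[OF transition_linear[OF c(1) d(1) x], of "span B"] by (simp add: span_span)
    moreover have "tr c d x ` span B \<subseteq> span B'"
      using slice_transition_span[OF s x \<open>x \<in> S\<close>] by auto
    ultimately have "dim (span B) \<le> dim (span B')" by (metis dim_subset)
    then show ?thesis
      using c(2) d(2) by (simp add: dim_eq_card_independent[OF independent_mono[OF independent_Basis]])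
  qed
  from this[OF s x(1,2)] this[OF s(2,1) x(2,1)] show ?thesis by simp
qed

text \<open>Under the derivative of the transition map, restricted to \<open>span B\<close>, the
  Gram determinant changes by the square of the determinant of that restriction. Its square root
  therefore picks up exactly the factor of the change of variables. The bijection \<pi> between the
  two index sets makes the restriction a square matrix.\<close>

lemma chart_vol_consistent:
  assumes s: "slice_chart X S c B" "slice_chart X S d B'" and S: "S \<subseteq> points X"
    and A: "A \<in> sets (restrict_space borel S)" "A \<subseteq> fst c" "A \<subseteq> fst d"
  shows "chart_vol c B A = chart_vol d B' A"
proof (cases "A = {}")
  case True
  then show ?thesis by (simp add: chart_vol_def)
next
  case False
  note c = sliceD[OF s(1)] note d = sliceD[OF s(2)]
  have AS: "A \<subseteq> S" using A(1) by (auto simp: sets_restrict_space)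
  have finB: "finite B" "finite B'" using c(2) d(2) finite_subset[OF _ finite_Basis] by blast+
  obtain x0 where "x0 \<in> A" using False by auto
  then have "card B = card B'" using slice_card_eq[OF s] A AS by auto
  then obtain \<pi> where \<pi>: "bij_betw \<pi> B B'" using finite_same_card_bij finB by blast
  let ?T = "transition c d" and ?T' = "\<lambda>y. frechet_derivative (transition c d) (at y)"
  let ?A = "snd c ` A" and ?J = "\<lambda>y. \<bar>det_on B (\<lambda>i j. \<pi> i \<bullet> ?T' y j)\<bar>"
  have TA: "?T ` ?A = snd d ` A" using A(2) c(1) by (simp add: image_image subset_iff cong: image_cong)
  have AO: "?A \<subseteq> snd c ` (fst c \<inter> fst d)" using A by auto
  have Abor: "?A \<in> sets borel" by (rule slice_image_borel[OF s(1) A(1,2)])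
  have "(\<integral>\<^sup>+y. indicator (?T ` ?A) y * dens d B' y \<partial>lborel_span B') =
    (\<integral>\<^sup>+y. ennreal (indicator ?A y * ?J y) * dens d B' (?T y) \<partial>lborel_span B)"
  proof (rule nn_integral_slice_change[OF c(2) d(2) \<pi> Abor])
    show "?A \<subseteq> span B" using A AS c(3) by blast
    show "?T ` ?A \<subseteq> span B'" unfolding TA using A AS d(3) by blast
    show "?T ` E \<in> sets borel" if E: "E \<in> sets borel" "E \<subseteq> ?A" for E
    proof -
      let ?E = "A \<inter> {x \<in> fst c \<inter> S. snd c x \<in> E}"
      have "?E \<in> sets (restrict_space borel S)" using A(1) chart_vimage_sets[OF c(1) S E(1)] by auto
      then have "snd d ` ?E \<in> sets borel" using A by (intro slice_image_borel[OF s(2)]) auto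
      moreover have "?T ` E = snd d ` ?E"
      proof (intro set_eqI iffI)
        fix y assume "y \<in> ?T ` E"
        then obtain x where "x \<in> A" "snd c x \<in> E" "y = ?T (snd c x)" using E(2) by blast
        moreover from this have "x \<in> fst c" "x \<in> S" using A AS by auto
        ultimately show "y \<in> snd d ` ?E" using c(1) by simp
      next
        fix y assume "y \<in> snd d ` ?E"
        then obtain x where "x \<in> A" "snd c x \<in> E" "y = snd d x" "x \<in> fst c" by auto
        then have "y = ?T (snd c x)" using c(1) by simp
        then show "y \<in> ?T ` E" using \<open>snd c x \<in> E\<close> by blast
      qed
      ultimately show ?thesis by simp
    qed
    show "(?T has_derivative ?T' y) (at y)" if "y \<in> ?A" for y
      using AO that by (intro smooth_onD[OF transition_smooth[OF c(1) d(1)]]) auto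
    show "inj_on ?T ?A"
    proof (rule inj_onI)
      fix y z assume "y \<in> ?A" "z \<in> ?A" and eq: "?T y = ?T z"
      then obtain u v where u: "u \<in> A" "y = snd c u" and v: "v \<in> A" "z = snd c v" by auto
      then have "snd d u = snd d v" using eq A(2) c(1) by (metis subsetD transition_app)
      then show "y = z" using inj_onD[OF chart_inj[OF d(1)]] u v A(3) by blast
    qed
    show "(\<lambda>y. indicator ?A y * ?J y) \<in> borel_measurable borel"
    proof -
      have "continuous_on (snd c ` (fst c \<inter> fst d)) (\<lambda>y. ?T' y v)" for v
        by (intro smooth_on_continuous_on smooth_on_derivative transition_smooth[OF c(1) d(1)])
      then have "continuous_on ?A ?J"
        unfolding det_on_def by (intro continuous_intros) (auto intro: continuous_on_subset[OF _ AO])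
      then have "(\<lambda>y. if y \<in> ?A then ?J y else 0) \<in> borel_measurable borel"
        using Abor by (intro borel_measurable_continuous_on_if) auto
      moreover have "(\<lambda>y. if y \<in> ?A then ?J y else 0) = (\<lambda>y. indicator ?A y * ?J y)" by auto
      ultimately show ?thesis by simp
    qed
    show "dens d B' \<in> borel_measurable borel" using d(1) by (rule dens_measurable)
  qed
  also have "\<dots> = (\<integral>\<^sup>+y. indicator ?A y * dens c B y \<partial>lborel_span B)"
  proof (rule nn_integral_cong)
    fix y
    show "ennreal (indicator ?A y * ?J y) * dens d B' (?T y) = indicator ?A y * dens c B y"
    proof (cases "y \<in> ?A")
      case True
      then obtain x where x: "x \<in> A" "y = snd c x" by auto
      then have xc: "x \<in> fst c" "x \<in> fst d" "x \<in> S" using A AS by auto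
      have "det_on B (metric X c y) = det_on B (\<lambda>i j. metric X d (snd d x) (?T' y i) (?T' y j))"
        unfolding x(2) by (rule det_on_cong[OF refl]) (rule metric_change[OF c(1) d(1) xc(1,2)])
      also have "\<dots> = (det_on B (\<lambda>j k. \<pi> k \<bullet> ?T' y j))\<^sup>2 * det_on B (\<lambda>i j. metric X d (snd d x) (\<pi> i) (\<pi> j))"
      proof (rule det_on_gram_change[OF inner_prodD(1)[OF metric_inner_prod[OF d(1)]] finB(1)])
        show "snd d x \<in> snd d ` fst d" using xc by simp
        fix j assume "j \<in> B"
        then have "?T' y j \<in> span B'" unfolding x(2)
          by (intro slice_transition_span[OF s xc] span_base)
        then have "?T' y j = proj_on B' (?T' y j)" by (simp add: proj_on_id[OF d(2)])
        also have "\<dots> = (\<Sum>k\<in>B. (?T' y j \<bullet> \<pi> k) *\<^sub>R \<pi> k)"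
          unfolding lift_def using \<pi> by (rule sum.reindex_bij_betw[symmetric])
        finally show "?T' y j = (\<Sum>k\<in>B. (\<pi> k \<bullet> ?T' y j) *\<^sub>R \<pi> k)" by (simp only: inner_commute)
      qed
      also have "det_on B (\<lambda>i j. metric X d (snd d x) (\<pi> i) (\<pi> j)) = det_on B' (metric X d (snd d x))"
        by (rule det_on_reindex[OF \<pi> finB(1)])
      also have "det_on B (\<lambda>j k. \<pi> k \<bullet> ?T' y j) = det_on B (\<lambda>i j. \<pi> i \<bullet> ?T' y j)"
        by (rule det_on_transpose[OF finB(1)])
      finally have "sqrt (det_on B (metric X c y)) = ?J y * sqrt (det_on B' (metric X d (snd d x)))"
        by (simp add: real_sqrt_mult)
      moreover have "dens c B y = ennreal (sqrt (det_on B (metric X c y)))" using x xc by (intro dens_eq) simp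
      moreover have "dens d B' (?T y) = ennreal (sqrt (det_on B' (metric X d (snd d x))))"
        using x xc c(1) by (subst dens_eq) simp_all
      ultimately show ?thesis using True by (simp add: ennreal_mult')
    qed simp
  qed
  finally show ?thesis
    using slice_image_borel[OF s(1) A(1,2)] slice_image_borel[OF s(2) A(1,3)] c(1) d(1)
    unfolding chart_vol_def TA by (simp add: emeasure_density mult.commute)
qed

text \<open>The empty chart pads the sequences of charts below, which otherwise need not exist for empty \<open>S\<close>.\<close>

lemma empty_chart: "slice_chart X S ({}, f) {}"
proof -
  have "({}, f) \<in> atlas X"
  proof (rule maximal)
    show "is_chart (points X) ({}, f)" by (auto simp: is_chart_def homeomorphism_def)
    have "smooth_on {} h" for h :: "'e \<Rightarrow> 'e"
    proof -
      have "Ck_on k h {}" for k by (induct k arbitrary: h) auto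
      then show ?thesis by (simp add: smooth_on_def)
    qed
    then show "smooth_compatible ({}, f) d" for d by (simp add: smooth_compatible_def)
  qed
  then show ?thesis by (simp add: slice_chart_def)
qed

section \<open>Existence and uniqueness of the volume of an embedded submanifold\<close>

text \<open>Lindelof's theorem gives countably many charts. Adding one chart known to satisfy
  \<open>P\<close> makes the family nonempty, so that the natural numbers can enumerate it.\<close>

lemma countable_subcover:
  assumes P: "\<And>c. P c \<Longrightarrow> c \<in> atlas X" and S: "\<And>x. x \<in> S \<Longrightarrow> \<exists>c. P c \<and> x \<in> fst c"
    and SX: "S \<subseteq> points X" and ex: "\<exists>c. P c"
  shows "\<exists>cs. (\<forall>n::nat. P (cs n)) \<and> S \<subseteq> (\<Union>n. fst (cs n))"
proof -
  have "\<forall>c. \<exists>U. P c \<longrightarrow> open U \<and> fst c = points X \<inter> U" using P chart_domain_open by blast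
  then obtain U where U: "\<And>c. P c \<Longrightarrow> open (U c) \<and> fst c = points X \<inter> U c" by metis
  have op: "V \<in> U ` Collect P \<Longrightarrow> open V" for V using U by blast
  obtain F where F: "F \<subseteq> U ` Collect P" "countable F" "\<Union>F = \<Union>(U ` Collect P)"
    using Lindelof[OF op] by metis
  obtain C where C: "countable C" "C \<subseteq> Collect P" "F = U ` C"
    using countable_subset_image[of F U "Collect P"] F by blast
  obtain c0 where "P c0" using ex by auto
  define cs where "cs = from_nat_into (insert c0 C)"
  have rng: "range cs = insert c0 C" unfolding cs_def using C(1) by (intro range_from_nat_into) auto
  have "S \<subseteq> (\<Union>n. fst (cs n))"
  proof
    fix x assume x: "x \<in> S"
    then obtain c where "P c" "x \<in> fst c" using S by blast
    then have "x \<in> U c" using U by blast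
    then have "x \<in> \<Union>F" unfolding F(3) using \<open>P c\<close> by blast
    then obtain c where "c \<in> C" "x \<in> U c" unfolding C(3) by auto
    then have "x \<in> fst c" using U C(2) SX x by blast
    moreover obtain n where "c = cs n" using \<open>c \<in> C\<close> rng by (metis insertI2 rangeE)
    ultimately show "x \<in> (\<Union>n. fst (cs n))" by auto
  qed
  moreover have "P (cs n)" for n
    using rng C(2) \<open>P c0\<close> by (metis (full_types) insertE mem_Collect_eq rangeI subsetD)
  ultimately show ?thesis by blast
qed

text \<open>Embedded submanifolds whose dimension may vary from point to point: the cardinality of
  \<open>B\<close> is not fixed.\<close>

definition slice_covered where
  "slice_covered S \<longleftrightarrow> S \<subseteq> points X \<and> (\<forall>x\<in>S. \<exists>c B. slice_chart X S c B \<and> x \<in> fst c)"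

text \<open>Cut \<open>S\<close> into countably many disjoint Borel pieces, each inside one slice
  chart, and add up the volumes computed there. For a set inside any other slice chart, consistency
  replaces each summand by a volume in that chart, and additivity sums them. Uniqueness holds
  because the charts prescribe the measure on every piece. This is what gives the \<open>THE\<close>
  in \<open>riemannian_volume\<close> its meaning.\<close>

lemma riemannian_volume_exists1:
  assumes "slice_covered S"
  shows "\<exists>!\<mu>. is_riemannian_volume X S \<mu>"
proof -
  have S: "S \<subseteq> points X" using assms by (simp add: slice_covered_def)
  have "\<exists>cs. (\<forall>n::nat. \<exists>B. slice_chart X S (cs n) B) \<and> S \<subseteq> (\<Union>n. fst (cs n))"
  proof (rule countable_subcover[OF _ _ S])
    show "\<exists>c. \<exists>B. slice_chart X S c B" using empty_chart by blast
    show "\<exists>c. (\<exists>B. slice_chart X S c B) \<and> x \<in> fst c" if "x \<in> S" for x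
      using assms that unfolding slice_covered_def by blast
  qed (auto simp: slice_chart_def)
  then obtain cs where "\<And>n::nat. \<exists>B. slice_chart X S (cs n) B" and cov: "S \<subseteq> (\<Union>n. fst (cs n))" by auto
  then obtain Bs where s: "\<And>n. slice_chart X S (cs n) (Bs n)" by metis
  define D where "D n = disjointed (\<lambda>n. fst (cs n) \<inter> S) n" for n
  have D_sub: "D n \<subseteq> fst (cs n) \<inter> S" for n unfolding D_def by (rule disjointed_subset)
  have D_fst: "x \<in> fst (cs n)" if "x \<in> D n" for x n using D_sub that by blast
  have D_disj: "disjoint_family D" unfolding D_def[abs_def] by (rule disjoint_family_disjointed)
  have D_UN: "(\<Union>n. D n) = S" unfolding D_def UN_disjointed_eq using cov by auto
  let ?\<S> = "sets (restrict_space borel S)"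
  have D_sets: "D n \<in> ?\<S>" for n
    using sets.range_disjointed_sets[of "\<lambda>n. fst (cs n) \<inter> S" "restrict_space borel S"]
      chart_domain_sets[OF sliceD(1)[OF s] S] unfolding D_def by auto
  have sub: "A \<subseteq> S" if "A \<in> ?\<S>" for A using that by (auto simp: sets_restrict_space)
  define m where "m A = (\<Sum>n. chart_vol (cs n) (Bs n) (A \<inter> D n))" for A
  define \<mu> where "\<mu> = measure_of S ?\<S> m"
  have sets\<mu>: "sets \<mu> = ?\<S>"
    unfolding \<mu>_def by (metis sets.sigma_sets_eq sets_measure_of sets.space_closed space_restrict_space space_borel Int_UNIV_right)
  have \<mu>: "emeasure \<mu> A = m A" if "A \<in> ?\<S>" for A
    unfolding \<mu>_def
  proof (rule emeasure_measure_of_sigma[OF _ _ _ that])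
    show "sigma_algebra S ?\<S>" using sets.sigma_algebra_axioms[of "restrict_space borel S"] by (simp add: space_restrict_space)
    show "positive ?\<S> m" by (simp add: positive_def m_def chart_vol_def)
    show "countably_additive ?\<S> m"
      unfolding countably_additive_def
    proof (intro allI impI)
      fix A :: "nat \<Rightarrow> 'p set" assume A: "range A \<subseteq> ?\<S>" "disjoint_family A"
      have "(\<Sum>i. m (A i)) = (\<Sum>n. \<Sum>i. chart_vol (cs n) (Bs n) (A i \<inter> D n))"
        unfolding m_def by (rule nn_suminf_swap)
      also have "\<dots> = (\<Sum>n. chart_vol (cs n) (Bs n) (\<Union>i. A i \<inter> D n))"
        using A D_sets D_fst by (intro suminf_cong chart_vol_UN[OF s]) (auto simp: disjoint_family_on_def disjoint_iff)
      finally show "(\<Sum>i. m (A i)) = m (\<Union> (range A))" by (simp add: m_def)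
    qed
  qed
  have m_eq: "m A = chart_vol c B A" if c: "slice_chart X S c B" and A: "A \<in> ?\<S>" "A \<subseteq> fst c" for c B A
  proof -
    have "m A = (\<Sum>n. chart_vol c B (A \<inter> D n))"
      unfolding m_def using A D_sets D_fst by (intro suminf_cong chart_vol_consistent[OF s c S]) auto
    also have "\<dots> = chart_vol c B (\<Union>n. A \<inter> D n)"
      using A D_sets D_disj by (intro chart_vol_UN[OF c]) (auto simp: disjoint_family_on_def disjoint_iff)
    also have "(\<Union>n. A \<inter> D n) = A" using sub[OF A(1)] D_UN by auto
    finally show ?thesis .
  qed
  show ?thesis
  proof (rule ex1I[of _ \<mu>])
    show "is_riemannian_volume X S \<mu>"
      unfolding is_riemannian_volume_iff using sets\<mu> \<mu> m_eq by auto
    fix \<nu> assume "is_riemannian_volume X S \<nu>"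
    then have \<nu>: "sets \<nu> = ?\<S>" "\<And>c B A. slice_chart X S c B \<Longrightarrow> A \<in> ?\<S> \<Longrightarrow> A \<subseteq> fst c \<Longrightarrow> emeasure \<nu> A = chart_vol c B A"
      unfolding is_riemannian_volume_iff by auto
    show "\<nu> = \<mu>"
    proof (rule measure_eqI)
      show "sets \<nu> = sets \<mu>" using \<nu> sets\<mu> by simp
      fix A assume "A \<in> sets \<nu>"
      then have A: "A \<in> ?\<S>" using \<nu> by simp
      have "emeasure \<nu> A = emeasure \<nu> (\<Union>n. A \<inter> D n)" using sub[OF A] D_UN by (intro arg_cong[where f="emeasure \<nu>"]) auto
      also have "\<dots> = (\<Sum>n. emeasure \<nu> (A \<inter> D n))"
        using A D_sets D_disj \<nu>(1) by (intro suminf_emeasure[symmetric]) (auto simp: disjoint_family_on_def disjoint_iff)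
      also have "\<dots> = m A" unfolding m_def using A D_sets D_fst by (intro suminf_cong \<nu>(2)[OF s]) auto
      finally show "emeasure \<nu> A = emeasure \<mu> A" using \<mu>[OF A] by simp
    qed
  qed
qed

section \<open>Integration against the volume\<close>

abbreviation vol where "vol S \<equiv> riemannian_volume X S"

lemma is_riemannian_volume_vol:
  assumes "slice_covered S" shows "is_riemannian_volume X S (vol S)"
  unfolding riemannian_volume_def by (rule theI'[OF riemannian_volume_exists1[OF assms]])

lemma sets_vol: "slice_covered S \<Longrightarrow> sets (vol S) = sets (restrict_space borel S)"
  and emeasure_vol: "slice_covered S \<Longrightarrow> slice_chart X S c B \<Longrightarrow> A \<in> sets (restrict_space borel S) \<Longrightarrow> A \<subseteq> fst c \<Longrightarrow>
    emeasure (vol S) A = chart_vol c B A"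
  using is_riemannian_volume_vol[of S] unfolding is_riemannian_volume_iff by blast+

lemma space_vol: "slice_covered S \<Longrightarrow> space (vol S) = S"
  using sets_eq_imp_space_eq[OF sets_vol] by (simp add: space_restrict_space)

text \<open>On the domain of the chart, the volume is the push-forward of a density under the
  inverse chart. Proving this as an equality of measures reduces the formula for functions to the
  prescribed values on sets.\<close>

lemma nn_integral_vol:
  assumes S: "slice_covered S" and s: "slice_chart X S c B"
    and f: "f \<in> borel_measurable (restrict_space borel S)"
  shows "(\<integral>\<^sup>+x\<in>fst c. f x \<partial>vol S) =
    (\<integral>\<^sup>+y. indicator (snd c ` (fst c \<inter> S)) y * (f (chart_inv c y) * dens c B y) \<partial>lborel_span B)"
proof (cases "S = {}")
  case True
  then show ?thesis using space_vol[OF S] by (simp add: nn_integral_empty)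
next
  case False
  then obtain x0 where x0: "x0 \<in> S" by auto
  note c = sliceD[OF s]
  have SX: "S \<subseteq> points X" using S by (simp add: slice_covered_def)
  let ?I = "snd c ` (fst c \<inter> S)"
  have I[measurable]: "?I \<in> sets borel" unfolding c(3) using chart_open[OF c(1)] by auto
  note dens_measurable[OF c(1), measurable]
  \<comment> \<open>The inverse chart with a default value inside \<open>S\<close>, so that
    \<open>k\<close> maps everything into \<open>S\<close>. The density vanishes wherever the
    default is taken.\<close>
  define k where "k y = (if y \<in> ?I then chart_inv c y else x0)" for y
  have k_in: "k y \<in> S" for y using x0 c(1) by (auto simp: k_def)
  have k: "k \<in> measurable borel (restrict_space borel S)"
  proof (rule measurable_restrict_space2)
    show "k \<in> borel_measurable borel" unfolding k_def
      using I continuous_on_subset[OF chart_inv_continuous[OF c(1)], of ?I]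
      by (intro borel_measurable_continuous_on_if) auto
  qed (use k_in in auto)
  have dom: "fst c \<inter> S \<in> sets (vol S)" using chart_domain_sets[OF c(1) SX] by (simp add: sets_vol[OF S])
  have "density (vol S) (indicator (fst c \<inter> S)) =
      distr (density (lborel_span B) (\<lambda>y. indicator ?I y * dens c B y)) (restrict_space borel S) k" (is "?M = ?N")
  proof (rule measure_eqI)
    show "sets ?M = sets ?N" by (simp add: sets_vol[OF S])
    fix A assume "A \<in> sets ?M"
    then have A: "A \<in> sets (restrict_space borel S)" by (simp add: sets_vol[OF S])
    have "A \<inter> fst c = A \<inter> (fst c \<inter> S)" using sets.sets_into_space[OF A] by (auto simp: space_restrict_space)
    then have AS: "A \<inter> fst c \<in> sets (restrict_space borel S)"
      using sets.Int[OF A chart_domain_sets[OF c(1) SX]] by simp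
    have "emeasure ?M A = (\<integral>\<^sup>+x. indicator (fst c \<inter> S) x * indicator A x \<partial>vol S)"
      using A dom by (intro emeasure_density borel_measurable_indicator) (auto simp: sets_vol[OF S])
    also have "\<dots> = (\<integral>\<^sup>+x. indicator (A \<inter> (fst c \<inter> S)) x \<partial>vol S)"
      by (rule nn_integral_cong) (auto simp: indicator_def)
    also have "\<dots> = emeasure (vol S) (A \<inter> (fst c \<inter> S))"
      using A dom by (intro nn_integral_indicator) (auto simp: sets_vol[OF S])
    also have "A \<inter> (fst c \<inter> S) = A \<inter> fst c" using sets.sets_into_space[OF A] by (auto simp: space_restrict_space)
    also have "emeasure (vol S) (A \<inter> fst c) = chart_vol c B (A \<inter> fst c)"
      by (rule emeasure_vol[OF S s AS]) simp
    also have "\<dots> = (\<integral>\<^sup>+y. dens c B y * indicator (snd c ` (A \<inter> fst c)) y \<partial>lborel_span B)"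
      unfolding chart_vol_def using slice_image_borel[OF s AS] by (subst emeasure_density) auto
    also have "\<dots> = (\<integral>\<^sup>+y. (indicator ?I y * dens c B y) * indicator (k -` A) y \<partial>lborel_span B)"
    proof (rule nn_integral_cong)
      fix y
      have "y \<in> snd c ` (A \<inter> fst c) \<longleftrightarrow> y \<in> ?I \<and> k y \<in> A"
      proof
        assume "y \<in> snd c ` (A \<inter> fst c)"
        then obtain x where "x \<in> A" "x \<in> fst c" "y = snd c x" by auto
        moreover from this have "x \<in> S" using sets.sets_into_space[OF A] by (auto simp: space_restrict_space)
        ultimately show "y \<in> ?I \<and> k y \<in> A" using c(1) by (auto simp: k_def)
      next
        assume y: "y \<in> ?I \<and> k y \<in> A"
        then obtain x where "x \<in> fst c" "x \<in> S" "y = snd c x" by auto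
        then show "y \<in> snd c ` (A \<inter> fst c)" using y c(1) by (auto simp: k_def)
      qed
      then show "dens c B y * indicator (snd c ` (A \<inter> fst c)) y = (indicator ?I y * dens c B y) * indicator (k -` A) y"
        by (auto simp: indicator_def)
    qed
    also have "\<dots> = emeasure ?N A"
      using measurable_sets[OF k A] A k by (subst emeasure_distr) (auto simp: emeasure_density)
    finally show "emeasure ?M A = emeasure ?N A" .
  qed
  then have "(\<integral>\<^sup>+x. f x \<partial>?M) = (\<integral>\<^sup>+x. f x \<partial>?N)" by simp
  moreover have "(\<integral>\<^sup>+x. f x \<partial>?M) = (\<integral>\<^sup>+x. indicator (fst c \<inter> S) x * f x \<partial>vol S)"
    using f by (intro nn_integral_density borel_measurable_indicator dom)
      (simp add: measurable_cong_sets[OF sets_vol[OF S] refl])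
  moreover have "(\<integral>\<^sup>+x. f x \<partial>?N) = (\<integral>\<^sup>+y. indicator ?I y * dens c B y * f (k y) \<partial>lborel_span B)"
  proof -
    have "(\<integral>\<^sup>+x. f x \<partial>?N) = (\<integral>\<^sup>+y. f (k y) \<partial>density (lborel_span B) (\<lambda>y. indicator ?I y * dens c B y))"
      using k f by (intro nn_integral_distr) auto
    also have "\<dots> = (\<integral>\<^sup>+y. indicator ?I y * dens c B y * f (k y) \<partial>lborel_span B)"
      using measurable_comp[OF k f] by (intro nn_integral_density) (auto simp: comp_def)
    finally show ?thesis .
  qed
  ultimately have "(\<integral>\<^sup>+x. indicator (fst c \<inter> S) x * f x \<partial>vol S) = (\<integral>\<^sup>+y. indicator ?I y * dens c B y * f (k y) \<partial>lborel_span B)"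
    by simp
  moreover have "(\<integral>\<^sup>+x. indicator (fst c \<inter> S) x * f x \<partial>vol S) = (\<integral>\<^sup>+x\<in>fst c. f x \<partial>vol S)"
    by (rule nn_integral_cong) (auto simp: space_vol[OF S] indicator_def)
  moreover have "(\<integral>\<^sup>+y. indicator ?I y * dens c B y * f (k y) \<partial>lborel_span B) =
     (\<integral>\<^sup>+y. indicator ?I y * (f (chart_inv c y) * dens c B y) \<partial>lborel_span B)"
    by (rule nn_integral_cong) (simp add: k_def indicator_def mult.commute)
  ultimately show ?thesis by simp
qed

section \<open>New charts from old ones, and functions read in charts\<close>

text \<open>By maximality of the atlas only compatibility has to be shown, and the new transition
  maps are old ones composed with \<open>G\<close> or with its inverse. This provides both the
  translated charts and the charts adapted to \<Phi>.\<close>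

lemma chart_compose:
  assumes c: "c \<in> atlas X" and W: "open W" "W \<subseteq> snd c ` fst c" and V: "open V"
    and hom: "homeomorphism W V G g" and G: "smooth_on W G" and g: "smooth_on V g"
  shows "(fst c \<inter> snd c -` W, G \<circ> snd c) \<in> atlas X"
proof (rule maximal)
  let ?U = "fst c \<inter> snd c -` W" and ?n = "(fst c \<inter> snd c -` W, G \<circ> snd c)"
  have sndU: "snd c ` ?U = W" using W by auto
  have img: "(G \<circ> snd c) ` ?U = V" using hom sndU by (metis homeomorphism_image1 image_comp)
  have gG: "z \<in> W \<Longrightarrow> g (G z) = z" "z \<in> W \<Longrightarrow> G z \<in> V" "w \<in> V \<Longrightarrow> G (g w) = w" "w \<in> V \<Longrightarrow> g w \<in> W" for z w
    using hom by (auto simp: homeomorphism_def)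
  have inj: "inj_on (G \<circ> snd c) ?U"
    using gG chart_inj[OF c] by (auto simp: inj_on_def) metis
  have inv: "chart_inv ?n w = chart_inv c (g w)" if "w \<in> V" for w
  proof -
    have "g w \<in> snd c ` fst c" using gG(4)[OF that] W by auto
    then obtain x where x: "x \<in> fst c" "g w = snd c x" by auto
    then have "x \<in> ?U" "(G \<circ> snd c) x = w" using gG(3,4)[OF that] by auto
    then show ?thesis using x inj c unfolding chart_inv_def[of ?n] by (auto intro!: inv_into_f_eq)
  qed
  have "openin (top_of_set (fst c)) ?U"
    using continuous_openin_preimage_gen[OF chart_continuous[OF c] W(1)] .
  moreover have "openin (top_of_set (points X)) (fst c)" using atlas_chart[OF c] by (simp add: is_chart_def)
  ultimately have openU: "openin (top_of_set (points X)) ?U" by (rule openin_trans)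
  have "homeomorphism ?U V (G \<circ> snd c) (chart_inv c \<circ> g)"
  proof (rule homeomorphism_compose[OF _ hom])
    show "homeomorphism ?U W (snd c) (chart_inv c)"
      by (rule homeomorphism_of_subsets[OF chart_homeo[OF c] _ W(2) sndU]) auto
  qed
  then show "is_chart (points X) ?n" unfolding is_chart_def using openU img V by auto
  fix d assume d: "d \<in> atlas X"
  let ?O = "snd c ` (fst c \<inter> fst d)"
  have O: "open ?O" by (rule overlap_open[OF c d])
  have V': "snd ?n ` (fst ?n \<inter> fst d) = V \<inter> g -` ?O"
  proof (intro set_eqI iffI)
    fix w assume "w \<in> snd ?n ` (fst ?n \<inter> fst d)"
    then obtain x where "x \<in> fst c" "snd c x \<in> W" "x \<in> fst d" "w = G (snd c x)" by auto
    then show "w \<in> V \<inter> g -` ?O" using gG(1,2) by auto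
  next
    fix w assume w: "w \<in> V \<inter> g -` ?O"
    then obtain x where "x \<in> fst c" "x \<in> fst d" "g w = snd c x" by auto
    moreover have "G (g w) = w" "g w \<in> W" using gG(3,4) w by auto
    ultimately show "w \<in> snd ?n ` (fst ?n \<inter> fst d)" by (auto intro!: image_eqI[of _ _ x])
  qed
  have oV': "open (V \<inter> g -` ?O)"
    using continuous_open_preimage[OF smooth_on_continuous_on[OF g] V O] .
  have "smooth_on (V \<inter> g -` ?O) (\<lambda>w. transition c d (g w))"
    by (rule smooth_on_compose[OF oV' O _ smooth_on_subset[OF g] transition_smooth[OF c d]]) auto
  then have 1: "smooth_on (V \<inter> g -` ?O) (transition ?n d)"
    using smooth_on_cong[OF oV', of "\<lambda>w. transition c d (g w)" "transition ?n d"] inv by (simp add: transition_def)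
  let ?O' = "snd d ` (fst d \<inter> fst c)"
  have O': "open ?O'" by (rule overlap_open[OF d c])
  have W': "snd d ` (fst ?n \<inter> fst d) = ?O' \<inter> transition d c -` W" using d by auto
  have oW': "open (?O' \<inter> transition d c -` W)"
    using continuous_open_preimage[OF smooth_on_continuous_on[OF transition_smooth[OF d c]] O' W(1)] .
  have "smooth_on (?O' \<inter> transition d c -` W) (\<lambda>w. G (transition d c w))"
    by (rule smooth_on_compose[OF oW' W(1) _ smooth_on_subset[OF transition_smooth[OF d c]] G]) auto
  then have 2: "smooth_on (?O' \<inter> transition d c -` W) (transition d ?n)"
    by (simp add: transition_def comp_def)
  show "smooth_compatible ?n d"
    unfolding smooth_compatible_def V' W' using 1 2 by simp
qed

text \<open>In a chart adapted to \<Phi> a leaf is an affine slice parallel to a coordinate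
  subspace, while \<open>slice_chart\<close> asks for the linear subspace itself. Subtracting a
  point of the slice makes up the difference.\<close>

definition shift_chart where "shift_chart c a = (fst c, \<lambda>x. snd c x - a)"

lemma shift_chart_simps [simp]: "fst (shift_chart c a) = fst c" "snd (shift_chart c a) x = snd c x - a"
  by (simp_all add: shift_chart_def)

lemma shift_chart_atlas:
  assumes c: "c \<in> atlas X" shows "shift_chart c a \<in> atlas X"
proof -
  let ?W = "snd c ` fst c"
  let ?V = "(\<lambda>y. y - a) ` ?W"
  have W: "open ?W" by (rule chart_open[OF c])
  then have V: "open ?V" using open_translation_subtract by blast
  have "(fst c \<inter> snd c -` ?W, (\<lambda>y. y - a) \<circ> snd c) \<in> atlas X"
  proof (rule chart_compose[OF c W _ V])
    show "homeomorphism ?W ?V (\<lambda>y. y - a) (\<lambda>y. y + a)"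
      unfolding homeomorphism_def by (auto simp: image_image intro!: continuous_intros)
    show "smooth_on ?W (\<lambda>y. y - a)"
      using smooth_on_add[OF W smooth_on_id[OF W] smooth_on_const[OF W, of "- a"]] by simp
    show "smooth_on ?V (\<lambda>y. y + a)"
      using smooth_on_add[OF V smooth_on_id[OF V] smooth_on_const[OF V]] by simp
  qed simp
  moreover have "fst c \<inter> snd c -` ?W = fst c" by auto
  ultimately show ?thesis by (simp add: shift_chart_def comp_def)
qed

lemma shift_chart_metric:
  assumes c: "c \<in> atlas X" and x: "x \<in> fst c"
  shows "metric X (shift_chart c a) (snd c x - a) u v = metric X c (snd c x) u v"
proof -
  have "((\<lambda>y. y - a) has_derivative (\<lambda>v. v)) (at (snd c x))"
    by (auto intro!: derivative_eq_intros)
  then have "(transition c (shift_chart c a) has_derivative (\<lambda>v. v)) (at (snd c x))"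
    by (rule has_derivative_transform_within_open[OF _ chart_open[OF c]]) (use c x in auto)
  then have "tr c (shift_chart c a) x = (\<lambda>v. v)" by (rule frechet_derivative_at[symmetric])
  then show ?thesis using metric_change[OF c shift_chart_atlas[OF c], of x a u v] x by simp
qed

lemma shift_chart_inv:
  assumes c: "c \<in> atlas X" and x: "z + a \<in> snd c ` fst c"
  shows "chart_inv (shift_chart c a) z = chart_inv c (z + a)"
proof -
  obtain w where w: "w \<in> fst c" "z + a = snd c w" using x by auto
  then have "z = snd (shift_chart c a) w" by (simp add: eq_diff_eq)
  then show ?thesis using w chart_inv[OF shift_chart_atlas[OF c], of w a] c by simp
qed

lemma shift_chart_image:
  assumes c: "c \<in> atlas X"
  shows "z \<in> snd (shift_chart c a) ` fst c \<longleftrightarrow> z + a \<in> snd c ` fst c"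
proof
  assume "z \<in> snd (shift_chart c a) ` fst c"
  then obtain x where "x \<in> fst c" "z = snd c x - a" by auto
  then show "z + a \<in> snd c ` fst c" by simp
next
  assume "z + a \<in> snd c ` fst c"
  then obtain x where "x \<in> fst c" "z + a = snd c x" by auto
  moreover from this have "z = snd c x - a" by (simp add: eq_diff_eq)
  ultimately show "z \<in> snd (shift_chart c a) ` fst c" by auto
qed

lemma shift_chart_dens:
  assumes c: "c \<in> atlas X" shows "dens (shift_chart c a) B z = dens c B (z + a)"
proof (cases "z + a \<in> snd c ` fst c")
  case True
  then obtain w where w: "w \<in> fst c" "z + a = snd c w" by auto
  then have z: "z = snd c w - a" by (simp add: eq_diff_eq)
  have "det_on B (metric X (shift_chart c a) z) = det_on B (metric X c (z + a))"
    unfolding w(2) z by (rule det_on_cong[OF refl]) (simp add: shift_chart_metric[OF c w(1)])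
  then show ?thesis using True shift_chart_image[OF c, of z a] by (simp add: dens_def)
next
  case False
  then show ?thesis using shift_chart_image[OF c, of z a] by (simp add: dens_def)
qed

definition pull where "pull c f z = (if z \<in> snd c ` fst c then f (chart_inv c z) else (0::ennreal))"

lemma pull_app: "c \<in> atlas X \<Longrightarrow> x \<in> fst c \<Longrightarrow> pull c f (snd c x) = f x"
  by (simp add: pull_def)

lemma pull_measurable:
  assumes c: "c \<in> atlas X" and f: "f \<in> borel_measurable (restrict_space borel (points X))"
  shows "pull c f \<in> borel_measurable borel"
proof -
  have "chart_inv c \<in> measurable (restrict_space borel (snd c ` fst c)) (restrict_space borel (points X))"
    using chart_domain[OF c] chart_inv_in[OF c]
    by (intro measurable_restrict_space2 borel_measurable_continuous_on_restrict chart_inv_continuous[OF c])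
       (auto simp: space_restrict_space)
  then have "(\<lambda>z. f (chart_inv c z)) \<in> borel_measurable (restrict_space borel (snd c ` fst c))"
    using f by (rule measurable_compose)
  then show ?thesis unfolding pull_def[abs_def]
    using chart_open[OF c] by (subst measurable_If_restrict_space_iff) auto
qed

lemma full_slice: "c \<in> atlas X \<Longrightarrow> slice_chart X (points X) c Basis"
  using chart_domain by (auto simp: slice_chart_def Int_absorb2)

lemma covered_points: "slice_covered (points X)"
  unfolding slice_covered_def using cover full_slice by blast

lemma nn_integral_vol_points:
  assumes c: "c \<in> atlas X" and f: "f \<in> borel_measurable (restrict_space borel (points X))"
  shows "(\<integral>\<^sup>+x\<in>fst c. f x \<partial>vol (points X)) = (\<integral>\<^sup>+z. pull c f z * dens c Basis z \<partial>lborel)"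
proof -
  have "fst c \<inter> points X = fst c" using chart_domain[OF c] by auto
  then show ?thesis
    unfolding nn_integral_vol[OF covered_points full_slice[OF c] f] lborel_span_Basis
    by (intro nn_integral_cong) (simp add: pull_def indicator_def)
qed

lemma open_preimage_chart:
  assumes c: "c \<in> atlas X" and cont: "continuous_on Y \<Phi>" and sub: "\<Phi> ` Y \<subseteq> points X"
  shows "openin (top_of_set Y) (Y \<inter> \<Phi> -` fst c)"
proof -
  obtain U where U: "open U" "fst c = points X \<inter> U" using chart_domain_open[OF c] by auto
  then have "Y \<inter> \<Phi> -` fst c = Y \<inter> \<Phi> -` U" using sub by auto
  then show ?thesis using continuous_openin_preimage_gen[OF cont U(1)] by simp
qed

lemma chart_at:
  assumes "x \<in> points X" shows "chart_at X x \<in> atlas X" "x \<in> fst (chart_at X x)"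
proof -
  have "\<exists>c. c \<in> atlas X \<and> x \<in> fst c" using assms unfolding cover[symmetric] by auto
  then have "chart_at X x \<in> atlas X \<and> x \<in> fst (chart_at X x)"
    unfolding chart_at_def by (rule someI_ex)
  then show "chart_at X x \<in> atlas X" "x \<in> fst (chart_at X x)" by auto
qed

end

section \<open>Foliated charts\<close>

locale submersion_setup = M: riem M + N: riem N
  for M :: "('p::{t2_space, second_countable_topology}, 'm::euclidean_space) rmanifold"
    and N :: "('q::{t2_space, second_countable_topology}, 'n::euclidean_space) rmanifold" +
  fixes \<Phi> :: "'p \<Rightarrow> 'q"
  assumes sub: "submersion M N \<Phi>"
begin

lemma \<Phi>_points: "x \<in> points M \<Longrightarrow> \<Phi> x \<in> points N"
  and \<Phi>_cont: "continuous_on (points M) \<Phi>"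
  using sub by (auto simp: submersion_def smooth_map_def)

lemma \<Phi>_smooth: "c \<in> atlas M \<Longrightarrow> d \<in> atlas N \<Longrightarrow>
    smooth_on (snd c ` (fst c \<inter> \<Phi> -` fst d)) (snd d \<circ> \<Phi> \<circ> chart_inv c)"
  using sub by (auto simp: submersion_def smooth_map_def)

lemma \<Phi>_domain_open:
  assumes c: "c \<in> atlas M" and d: "d \<in> atlas N"
  shows "open (snd c ` (fst c \<inter> \<Phi> -` fst d))"
proof (rule M.chart_open_image[OF c])
  have "openin (top_of_set (points M)) (fst c \<inter> (points M \<inter> \<Phi> -` fst d))"
  proof (rule openin_Int)
    show "openin (top_of_set (points M)) (fst c)" using M.atlas_chart[OF c] by (simp add: is_chart_def)
    show "openin (top_of_set (points M)) (points M \<inter> \<Phi> -` fst d)"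
      by (rule N.open_preimage_chart[OF d \<Phi>_cont]) (use \<Phi>_points in auto)
  qed
  moreover have "fst c \<inter> (points M \<inter> \<Phi> -` fst d) = fst c \<inter> \<Phi> -` fst d"
    using M.chart_domain[OF c] by auto
  ultimately show "openin (top_of_set (points M)) (fst c \<inter> \<Phi> -` fst d)" by simp
qed auto

lemma \<Phi>_derivative:
  assumes c: "c \<in> atlas M" and d: "d \<in> atlas N" and x: "x \<in> fst c" "\<Phi> x \<in> fst d"
  shows "(snd d \<circ> \<Phi> \<circ> chart_inv c has_derivative
     frechet_derivative (snd d \<circ> \<Phi> \<circ> chart_inv c) (at (snd c x))) (at (snd c x))"
  using x by (intro smooth_onD[OF \<Phi>_smooth[OF c d]]) auto

lemma differential_props:
  assumes "x \<in> points M"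
  shows "linear (differential M N \<Phi> x)" "surj (differential M N \<Phi> x)"
    "(snd (chart_at N (\<Phi> x)) \<circ> \<Phi> \<circ> chart_inv (chart_at M x) has_derivative differential M N \<Phi> x) (at (snd (chart_at M x) x))"
proof -
  show der: "(snd (chart_at N (\<Phi> x)) \<circ> \<Phi> \<circ> chart_inv (chart_at M x) has_derivative differential M N \<Phi> x) (at (snd (chart_at M x) x))"
    unfolding differential_def using M.chart_at[OF assms] N.chart_at[OF \<Phi>_points[OF assms]]
    by (intro \<Phi>_derivative)
  then show "linear (differential M N \<Phi> x)" by (simp add: has_derivative_def bounded_linear.linear)
  show "surj (differential M N \<Phi> x)" using sub assms by (simp add: submersion_def)
qed

text \<open>In such a pair of charts \<Phi> is the projection to the coordinates in
  \<open>B\<close>, matched by \<sigma> with those of \<open>N\<close>. The leaves are the slices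
  parallel to \<open>span (Basis - B)\<close>.\<close>

definition fol_chart where
  "fol_chart c d B \<sigma> \<longleftrightarrow> c \<in> atlas M \<and> d \<in> atlas N \<and> B \<subseteq> Basis \<and> bij_betw \<sigma> B Basis \<and>
     (\<forall>x\<in>fst c. \<Phi> x \<in> fst d \<and> (\<forall>b\<in>B. snd c x \<bullet> b = snd d (\<Phi> x) \<bullet> \<sigma> b))"

text \<open>The local normal form of a submersion. Choose \<open>B\<close> so that the derivative
  \<open>L\<close> of \<Phi> maps it to a basis, and let \<open>G\<close> replace the coordinates in
  \<open>B\<close> by those of \<Phi> while keeping the others. A vector killed by the derivative of
  \<open>G\<close> lies in \<open>span B\<close> and in the kernel of \<open>L\<close>, so it is
  zero, and the inverse function theorem makes \<open>G\<close> a change of coordinates near the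
  point.\<close>

lemma fol_chart_exists:
  assumes x0: "x0 \<in> points M"
  shows "\<exists>c d B \<sigma>. fol_chart c d B \<sigma> \<and> x0 \<in> fst c"
proof -
  define c where "c = chart_at M x0"
  define d where "d = chart_at N (\<Phi> x0)"
  have c: "c \<in> atlas M" "x0 \<in> fst c" and d: "d \<in> atlas N" "\<Phi> x0 \<in> fst d"
    unfolding c_def d_def using M.chart_at[OF x0] N.chart_at[OF \<Phi>_points[OF x0]] by auto
  define F where "F = snd d \<circ> \<Phi> \<circ> chart_inv c"
  define L where "L = differential M N \<Phi> x0"
  let ?O = "snd c ` (fst c \<inter> \<Phi> -` fst d)"
  have O: "open ?O" by (rule \<Phi>_domain_open[OF c(1) d(1)])
  have F: "smooth_on ?O F" unfolding F_def by (rule \<Phi>_smooth[OF c(1) d(1)])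
  have L: "linear L" "surj L" "(F has_derivative L) (at (snd c x0))"
    using differential_props[OF x0] unfolding L_def F_def c_def d_def by auto
  obtain B' where B': "B' \<subseteq> L ` Basis" "independent B'" "L ` Basis \<subseteq> span B'" "card B' = dim (L ` Basis)"
    using basis_exists by metis
  have "span (L ` Basis) = UNIV" using linear_span_image[OF L(1), of Basis] L(2) by simp
  then have spanB': "card B' = DIM('n)"
    using B'(4) dim_span[of "L ` Basis"] by simp
  obtain B where B: "B \<subseteq> Basis" "inj_on L B" "B' = L ` B"
    using B'(1) unfolding subset_image_inj by auto
  have finB: "finite B" using B(1) finite_subset[OF _ finite_Basis] by blast
  have "card B = card (Basis :: 'n set)" using spanB' B(3) card_image[OF B(2)] by simp
  then obtain \<sigma> :: "'m \<Rightarrow> 'n" where \<sigma>: "bij_betw \<sigma> B Basis"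
    using finite_same_card_bij[OF finB finite_Basis] by auto
  have injL: "inj_on L (span B)"
    using linear_inj_on_span_independent_image[OF L(1)] B B'(2) by blast
  define A where "A = lift B \<sigma>"
  define P where "P = proj_on (Basis - B)"
  have linA: "linear A" and linP: "linear P" unfolding A_def P_def by (rule linear_lift)+
  have A: "A y \<bullet> b = (if b \<in> B then y \<bullet> \<sigma> b else 0)" if "b \<in> Basis" for y b
    unfolding A_def by (rule lift_inner[OF B(1) that])
  have P: "P z \<bullet> b = (if b \<in> B then 0 else z \<bullet> b)" if "b \<in> Basis" for z b
    using that by (simp add: P_def lift_inner)
  define G where "G z = A (F z) + P z" for z
  have G: "smooth_on ?O G"
  proof -
    have "smooth_on ?O (\<lambda>z. A (F z))" 
      using linA by (intro smooth_on_linear[OF O _ F]) (simp add: linear_linear)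
    moreover have "smooth_on ?O (\<lambda>z. P z)" 
      using linP by (intro smooth_on_linear[OF O _ smooth_on_id[OF O]]) (simp add: linear_linear)
    ultimately show ?thesis unfolding G_def[abs_def] by (rule smooth_on_add[OF O])
  qed
  have "(G has_derivative (\<lambda>v. A (L v) + P v)) (at (snd c x0))"
  proof -
    have "((\<lambda>z. A (F z)) has_derivative (\<lambda>v. A (L v))) (at (snd c x0))"
      using linA by (intro bounded_linear.has_derivative[OF _ L(3)]) (simp add: linear_linear)
    moreover have "(P has_derivative P) (at (snd c x0))" by (rule linear_imp_has_derivative[OF linP])
    ultimately show ?thesis unfolding G_def[abs_def] by (rule has_derivative_add)
  qed
  then have DG: "frechet_derivative G (at (snd c x0)) = (\<lambda>v. A (L v) + P v)"
    by (rule frechet_derivative_at[symmetric])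
  have linG: "linear (\<lambda>v. A (L v) + P v)"
    using linear_compose_add[OF linear_compose[OF L(1) linA] linP] by (simp add: comp_def)
  have "inj (\<lambda>v. A (L v) + P v)"
  proof (subst linear_injective_0[OF linG], intro allI impI)
    fix v assume v: "A (L v) + P v = 0"
    have comp: "(A (L v) + P v) \<bullet> b = 0" for b using v by simp
    have "v \<in> span B" unfolding in_span_Basis_iff[OF B(1)]
    proof
      fix b assume "b \<in> Basis - B"
      then show "v \<bullet> b = 0" using comp[of b] by (simp add: inner_left_distrib A P)
    qed
    moreover have "L v = 0"
    proof (rule euclidean_eqI)
      fix i :: 'n assume "i \<in> Basis"
      then obtain b where "b \<in> B" "i = \<sigma> b" using \<sigma> by (metis bij_betw_imp_surj_on imageE)
      then show "L v \<bullet> i = 0 \<bullet> i" using comp[of b] B(1) by (simp add: inner_left_distrib A P subset_iff)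
    qed
    ultimately show "v = 0"
      using injL by (metis inj_onD linear_0[OF L(1)] span_zero)
  qed
  then have bij: "bij (frechet_derivative G (at (snd c x0)))"
    unfolding DG using linear_injective_imp_surjective[OF linG] by (simp add: bij_def)
  have "snd c x0 \<in> ?O" using c d by auto
  from smooth_local_inverse[OF O this G bij] obtain U V g where
    UV: "open U" "U \<subseteq> ?O" "snd c x0 \<in> U" "open V" "homeomorphism U V G g" "smooth_on V g" by blast
  define c' where "c' = (fst c \<inter> snd c -` U, G \<circ> snd c)"
  have "c' \<in> atlas M" unfolding c'_def
    using UV by (intro M.chart_compose[OF c(1) _ _ UV(4,5) smooth_on_subset[OF G]]) auto
  moreover have "\<Phi> x \<in> fst d \<and> (\<forall>b\<in>B. snd c' x \<bullet> b = snd d (\<Phi> x) \<bullet> \<sigma> b)" if "x \<in> fst c'" for x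
  proof -
    have x: "x \<in> fst c" "snd c x \<in> U" using that by (auto simp: c'_def)
    then obtain x' where "x' \<in> fst c" "\<Phi> x' \<in> fst d" "snd c x = snd c x'" using UV(2) by auto
    then have "\<Phi> x \<in> fst d" using x inj_onD[OF M.chart_inj[OF c(1)], of x x'] by auto
    moreover have "snd c' x \<bullet> b = snd d (\<Phi> x) \<bullet> \<sigma> b" if "b \<in> B" for b
      using that B(1) x c(1) by (simp add: c'_def G_def inner_left_distrib A P F_def subset_iff)
    ultimately show ?thesis by simp
  qed
  moreover have "x0 \<in> fst c'" using c UV by (simp add: c'_def)
  ultimately show ?thesis unfolding fol_chart_def using d(1) B(1) \<sigma> by blast
qed

text \<open>Defined for every \<open>y\<close> and empty off the image of \<Phi>, so that the coarea
  formula can integrate over all of \<open>N\<close>.\<close>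

definition leaf where "leaf y = {x \<in> points M. \<Phi> x = y}"

lemma fol_chartD:
  assumes "fol_chart c d B \<sigma>"
  shows "c \<in> atlas M" "d \<in> atlas N" "B \<subseteq> Basis" "bij_betw \<sigma> B Basis"
    "x \<in> fst c \<Longrightarrow> \<Phi> x \<in> fst d" "x \<in> fst c \<Longrightarrow> b \<in> B \<Longrightarrow> snd c x \<bullet> b = snd d (\<Phi> x) \<bullet> \<sigma> b"
  using assms by (auto simp: fol_chart_def)

lemma push_chart:
  assumes fc: "fol_chart c d B \<sigma>" and x: "x \<in> fst c"
  shows "push B \<sigma> (snd c x) = snd d (\<Phi> x)"
proof -
  note c = fol_chartD[OF fc]
  have "push B \<sigma> (snd c x) = (\<Sum>b\<in>B. (snd d (\<Phi> x) \<bullet> \<sigma> b) *\<^sub>R \<sigma> b)"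
    unfolding push_def using c(6)[OF x] by simp
  also have "\<dots> = (\<Sum>i\<in>Basis. (snd d (\<Phi> x) \<bullet> i) *\<^sub>R i)" by (rule sum.reindex_bij_betw[OF c(4)])
  finally show ?thesis by (simp add: euclidean_representation)
qed

text \<open>Inside the chart the leaf is the set where the coordinates in \<open>B\<close> agree
  with those of \<open>y\<close>; the translation moves these to zero.\<close>

lemma leaf_slice:
  assumes f: "fol_chart c d B \<sigma>" and y: "y \<in> fst d"
  shows "slice_chart M (leaf y) (M.shift_chart c (lift B \<sigma> (snd d y))) (Basis - B)"
proof -
  note c = fol_chartD[OF f]
  let ?a = "lift B \<sigma> (snd d y)"
  have eq: "snd c x - ?a \<in> span (Basis - B) \<longleftrightarrow> \<Phi> x = y" if x: "x \<in> fst c" for x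
  proof -
    have "snd c x - ?a \<in> span (Basis - B) \<longleftrightarrow> (\<forall>b\<in>B. snd d (\<Phi> x) \<bullet> \<sigma> b = snd d y \<bullet> \<sigma> b)"
      using c(3) c(6)[OF x] by (auto simp: in_span_Basis_iff inner_diff_left lift_inner subset_iff)
    also have "\<dots> \<longleftrightarrow> snd d (\<Phi> x) = snd d y"
    proof
      assume *: "\<forall>b\<in>B. snd d (\<Phi> x) \<bullet> \<sigma> b = snd d y \<bullet> \<sigma> b"
      show "snd d (\<Phi> x) = snd d y"
      proof (rule euclidean_eqI)
        fix i :: 'n assume "i \<in> Basis"
        then obtain b where "b \<in> B" "i = \<sigma> b" using c(4) by (metis bij_betw_imp_surj_on imageE)
        then show "snd d (\<Phi> x) \<bullet> i = snd d y \<bullet> i" using * by simp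
      qed
    qed simp
    also have "\<dots> \<longleftrightarrow> \<Phi> x = y" using N.chart_inj[OF c(2)] c(5)[OF x] y by (auto dest: inj_onD)
    finally show ?thesis .
  qed
  show ?thesis
    unfolding slice_chart_def using M.shift_chart_atlas[OF c(1)] M.chart_domain[OF c(1)] eq
    by (auto simp: leaf_def)
qed

lemma leaf_covered: "M.slice_covered (leaf y)"
  unfolding M.slice_covered_def
proof (intro conjI ballI)
  fix x assume x: "x \<in> leaf y"
  then obtain c d B \<sigma> where f: "fol_chart c d B \<sigma>" "x \<in> fst c"
    using fol_chart_exists[of x] by (auto simp: leaf_def)
  then have "y \<in> fst d" using fol_chartD(5)[OF f] x by (simp add: leaf_def)
  from leaf_slice[OF f(1) this] f(2) show "\<exists>c B. slice_chart M (leaf y) c B \<and> x \<in> fst c"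
    by (metis M.shift_chart_simps(1))
qed (simp add: leaf_def)

lemma leaf_measurable:
  "f \<in> borel_measurable (restrict_space borel (points M)) \<Longrightarrow> f \<in> borel_measurable (M.vol (leaf y))"
  by (subst measurable_cong_sets[OF M.sets_vol[OF leaf_covered] refl])
     (auto simp: leaf_def intro: measurable_restrict_mono)

text \<open>The translation is moved from the chart into the integrand. Now \<open>y\<close> enters
  only through \<open>snd d y\<close> in an argument of fixed functions, which makes the dependence
  on \<open>y\<close> measurable and prepares Fubini's theorem.\<close>

lemma nn_integral_leaf:
  assumes fc: "fol_chart c d B \<sigma>" and y: "y \<in> fst d"
    and f: "f \<in> borel_measurable (restrict_space borel (points M))"
  shows "(\<integral>\<^sup>+x\<in>fst c. f x \<partial>M.vol (leaf y)) =
    (\<integral>\<^sup>+t. M.pull c f (lift B \<sigma> (snd d y) + t) * M.dens c (Basis - B) (lift B \<sigma> (snd d y) + t) \<partial>lborel_span (Basis - B))"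
proof -
  note c = fol_chartD[OF fc]
  let ?a = "lift B \<sigma> (snd d y)"
  let ?c = "M.shift_chart c ?a"
  note s = leaf_slice[OF fc y]
  note M.pull_measurable[OF c(1) f, measurable] M.dens_measurable[OF c(1), measurable]
  let ?g = "\<lambda>t. M.pull c f (?a + t) * M.dens c (Basis - B) (?a + t)"
  have I: "snd ?c ` (fst ?c \<inter> leaf y) = snd ?c ` fst c \<inter> span (Basis - B)" using M.sliceD(3)[OF s] by simp
  have "(\<integral>\<^sup>+x\<in>fst ?c. f x \<partial>M.vol (leaf y)) =
     (\<integral>\<^sup>+t. indicator (snd ?c ` (fst ?c \<inter> leaf y)) t * (f (chart_inv ?c t) * M.dens ?c (Basis - B) t) \<partial>lborel_span (Basis - B))"
    using f by (intro M.nn_integral_vol[OF leaf_covered s]) (auto simp: leaf_def intro: measurable_restrict_mono)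
  also have "\<dots> = (\<integral>\<^sup>+t. indicator (span (Basis - B)) t * ?g t \<partial>lborel_span (Basis - B))"
  proof (rule nn_integral_cong)
    fix t
    show "indicator (snd ?c ` (fst ?c \<inter> leaf y)) t * (f (chart_inv ?c t) * M.dens ?c (Basis - B) t) =
       indicator (span (Basis - B)) t * ?g t"
    proof (cases "t + ?a \<in> snd c ` fst c")
      case True
      then show ?thesis unfolding I
        using M.shift_chart_image[OF c(1), of t ?a] M.shift_chart_inv[OF c(1) True]
        by (simp add: indicator_def M.shift_chart_dens[OF c(1)] M.pull_def add.commute)
    next
      case False
      then show ?thesis unfolding I
        using M.shift_chart_image[OF c(1), of t ?a] by (simp add: indicator_def M.pull_def add.commute)
    qed
  qed
  also have "\<dots> = (\<integral>\<^sup>+t. ?g t \<partial>lborel_span (Basis - B))"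
    by (rule nn_integral_lborel_span_cong) (auto intro: borel_span)
  finally show ?thesis by simp
qed

section \<open>The Jacobian in foliated charts\<close>

definition jac where "jac = submersion_jacobian M N \<Phi>"

text \<open>Apply \<open>det_endo_adjoint\<close> to the coordinate vectors of \<open>c\<close>,
  transported by \<tau> to the reference chart \<open>chart_at\<close> in which the differential is
  defined. Those outside \<open>B\<close> span the vertical space, and the differential sends those
  in \<open>B\<close> to the coordinate vectors of \<open>d\<close>, transported by
  \<kappa>.\<close>

lemma jac_square:
  assumes fc: "fol_chart c d B \<sigma>" and x: "x \<in> fst c"
  shows "det_endo (horizontal M N \<Phi> x) (differential_adjoint M N \<Phi> x \<circ> differential M N \<Phi> x) *
      det_on Basis (metric M c (snd c x)) =
    det_on Basis (metric N d (snd d (\<Phi> x))) * det_on (Basis - B) (metric M c (snd c x))"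
proof -
  note c = fol_chartD[OF fc]
  have xM: "x \<in> points M" using M.chart_domain[OF c(1)] x by auto
  define c0 where "c0 = chart_at M x"
  define d0 where "d0 = chart_at N (\<Phi> x)"
  have c0: "c0 \<in> atlas M" "x \<in> fst c0" and d0: "d0 \<in> atlas N" "\<Phi> x \<in> fst d0"
    unfolding c0_def d0_def using M.chart_at[OF xM] N.chart_at[OF \<Phi>_points[OF xM]] by auto
  have d: "\<Phi> x \<in> fst d" by (rule c(5)[OF x])
  define D where "D = differential M N \<Phi> x"
  have D: "linear D" "surj D" "(snd d0 \<circ> \<Phi> \<circ> chart_inv c0 has_derivative D) (at (snd c0 x))"
    using differential_props[OF xM] unfolding D_def c0_def d0_def by auto
  define \<tau> where "\<tau> = frechet_derivative (transition c c0) (at (snd c x))"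
  define \<kappa> where "\<kappa> = frechet_derivative (transition d d0) (at (snd d (\<Phi> x)))"
  have \<tau>: "linear \<tau>" "bij \<tau>" "(transition c c0 has_derivative \<tau>) (at (snd c x))"
    unfolding \<tau>_def using M.transition_linear[OF c(1) c0(1) x c0(2)] M.transition_bij[OF c(1) c0(1) x c0(2)]
      M.transition_derivative[OF c(1) c0(1) x c0(2)] by auto
  have \<kappa>: "linear \<kappa>" "bij \<kappa>" "(transition d d0 has_derivative \<kappa>) (at (snd d (\<Phi> x)))"
    unfolding \<kappa>_def using N.transition_linear[OF c(2) d0(1) d d0(2)] N.transition_bij[OF c(2) d0(1) d d0(2)]
      N.transition_derivative[OF c(2) d0(1) d d0(2)] by auto
  define S where "S = push B \<sigma>"
  have linS: "linear S" unfolding S_def by (rule linear_push)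
  have finB: "finite B" using c(3) finite_subset[OF _ finite_Basis] by blast
  have S_basis: "S b = (if b \<in> B then \<sigma> b else 0)" if "b \<in> Basis" for b
  proof -
    have "S b = (\<Sum>k\<in>B. if k = b then \<sigma> b else 0)"
      unfolding S_def push_def using that c(3) by (intro sum.cong) (auto simp: inner_Basis subset_iff)
    then show ?thesis using finB by simp
  qed
  have S_chart: "S (snd c x') = snd d (\<Phi> x')" if "x' \<in> fst c" for x'
    unfolding S_def by (rule push_chart[OF fc that])
  \<comment> \<open>The chain rule, applied to two expressions for \<Phi>: from \<open>c\<close>
    through the reference charts, and through the projection \<open>S\<close> followed by the
    transition from \<open>d\<close>.\<close>
  have "D \<circ> \<tau> = \<kappa> \<circ> S"
  proof -
    let ?F = "snd d0 \<circ> \<Phi> \<circ> chart_inv c0"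
    have "(?F \<circ> transition c c0 has_derivative D \<circ> \<tau>) (at (snd c x))"
      using \<tau>(3) D(3) c(1) x by (intro diff_chain_at) simp_all
    moreover have "(transition d d0 \<circ> S has_derivative \<kappa> \<circ> S) (at (snd c x))"
      using \<kappa>(3) S_chart[OF x] by (intro diff_chain_at linear_imp_has_derivative[OF linS]) simp
    then have "(?F \<circ> transition c c0 has_derivative \<kappa> \<circ> S) (at (snd c x))"
    proof (rule has_derivative_transform_within_open)
      show "open (snd c ` (fst c \<inter> fst c0))" by (rule M.overlap_open[OF c(1) c0(1)])
      show "snd c x \<in> snd c ` (fst c \<inter> fst c0)" using x c0 by auto
      fix z assume "z \<in> snd c ` (fst c \<inter> fst c0)"
      then obtain x' where x': "x' \<in> fst c" "x' \<in> fst c0" "z = snd c x'" by auto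
      then show "(transition d d0 \<circ> S) z = (?F \<circ> transition c c0) z"
        using c(1,2) c0(1) c(5)[OF x'(1)] by (simp add: S_chart)
    qed
    ultimately show ?thesis by (rule has_derivative_unique)
  qed
  then have D\<tau>: "D (\<tau> v) = \<kappa> (S v)" for v by (metis comp_apply)
  have g: "inner_prod (metric_at M x)" and h: "inner_prod (metric_at N (\<Phi> x))"
    unfolding metric_at_def c0_def[symmetric] d0_def[symmetric]
    using M.metric_inner_prod[OF c0(1)] N.metric_inner_prod[OF d0(1)] c0 d0 by auto
  have S0: "S u = 0 \<longleftrightarrow> u \<in> span (Basis - B)" for u
  proof
    assume "S u = 0"
    have "u \<bullet> b = 0" if "b \<in> B" for b
      using push_inner[OF finB c(4) that, of u] \<open>S u = 0\<close> by (simp add: S_def)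
    then show "u \<in> span (Basis - B)" using c(3) by (simp add: in_span_Basis_iff subset_iff)
  next
    assume "u \<in> span (Basis - B)"
    then show "S u = 0" unfolding S_def push_def using c(3) by (intro sum.neutral) (auto simp: in_span_Basis_iff)
  qed
  have "det_endo (horizontal M N \<Phi> x) (differential_adjoint M N \<Phi> x \<circ> D) *
      det_on ((Basis - B) \<union> B) (\<lambda>i j. metric_at M x (\<tau> i) (\<tau> j)) =
    det_on B (\<lambda>i j. metric_at N (\<Phi> x) (D (\<tau> i)) (D (\<tau> j))) * det_on (Basis - B) (\<lambda>i j. metric_at M x (\<tau> i) (\<tau> j))"
  proof (rule det_endo_adjoint[OF g h D(1,2)])
    show "horizontal M N \<Phi> x = {u. \<forall>v\<in>{v. D v = 0}. metric_at M x u v = 0}"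
      by (simp add: horizontal_def vertical_def D_def)
    show "differential_adjoint M N \<Phi> x w = (THE u. u \<in> horizontal M N \<Phi> x \<and>
        (\<forall>v\<in>horizontal M N \<Phi> x. metric_at M x u v = metric_at N (\<Phi> x) w (D v)))" for w
      by (simp add: differential_adjoint_def D_def)
    show "inj_on \<tau> ((Basis - B) \<union> B)" using \<tau>(2) by (meson bij_is_inj inj_on_subset subset_UNIV)
    have un: "(Basis - B) \<union> B = Basis" using c(3) by auto
    show "independent (\<tau> ` ((Basis - B) \<union> B))" unfolding un
      using linear_independent_injective_image[OF \<tau>(1) independent_Basis] \<tau>(2) by (simp add: bij_is_inj)
    show "span (\<tau> ` ((Basis - B) \<union> B)) = UNIV" unfolding un
      using linear_span_image[OF \<tau>(1), of Basis] \<tau>(2) by (simp add: bij_is_surj)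
    show "{v. D v = 0} = span (\<tau> ` (Basis - B))"
    proof -
      have "D v = 0 \<longleftrightarrow> v \<in> \<tau> ` span (Basis - B)" for v
      proof -
        obtain u where u: "v = \<tau> u" using \<tau>(2) by (metis bij_pointE)
        have "D v = 0 \<longleftrightarrow> S u = 0"
          unfolding u D\<tau> using linear_injective_0[OF \<kappa>(1)] \<kappa>(2) linear_0[OF \<kappa>(1)] by (metis bij_is_inj)
        also have "\<dots> \<longleftrightarrow> v \<in> \<tau> ` span (Basis - B)"
          unfolding S0 u using \<tau>(2) by (simp add: bij_is_inj inj_image_mem_iff)
        finally show ?thesis .
      qed
      then show ?thesis using linear_span_image[OF \<tau>(1), of "Basis - B"] by auto
    qed
    show "card B = DIM('n)" using bij_betw_same_card[OF c(4)] .
  qed (use finB in auto)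
  moreover have "metric_at M x (\<tau> i) (\<tau> j) = metric M c (snd c x) i j" for i j
    unfolding metric_at_def c0_def[symmetric] \<tau>_def using M.metric_change[OF c(1) c0(1) x c0(2)] by simp
  moreover have "det_on B (\<lambda>i j. metric_at N (\<Phi> x) (D (\<tau> i)) (D (\<tau> j))) = det_on Basis (metric N d (snd d (\<Phi> x)))"
  proof -
    have "metric_at N (\<Phi> x) (D (\<tau> i)) (D (\<tau> j)) = metric N d (snd d (\<Phi> x)) (\<sigma> i) (\<sigma> j)" if "i \<in> B" "j \<in> B" for i j
      unfolding D\<tau> metric_at_def d0_def[symmetric] using that c(3) N.metric_change[OF c(2) d0(1) d d0(2)]
      by (simp add: S_basis subset_iff \<kappa>_def)
    then have "det_on B (\<lambda>i j. metric_at N (\<Phi> x) (D (\<tau> i)) (D (\<tau> j))) = det_on B (\<lambda>i j. metric N d (snd d (\<Phi> x)) (\<sigma> i) (\<sigma> j))"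
      by (intro det_on_cong) auto
    then show ?thesis using det_on_reindex[OF c(4) finB] by simp
  qed
  moreover have "(Basis - B) \<union> B = Basis" using c(3) by auto
  ultimately show ?thesis by (simp add: D_def)
qed

lemma jac_eq:
  assumes fc: "fol_chart c d B \<sigma>" and x: "x \<in> fst c"
  shows "jac x = sqrt (det_on Basis (metric N d (snd d (\<Phi> x)))) * sqrt (det_on (Basis - B) (metric M c (snd c x))) /
     sqrt (det_on Basis (metric M c (snd c x)))"
proof -
  note c = fol_chartD[OF fc]
  have "det_on Basis (metric M c (snd c x)) > 0" using M.gram_pos[OF c(1)] x by simp
  then have "det_endo (horizontal M N \<Phi> x) (differential_adjoint M N \<Phi> x \<circ> differential M N \<Phi> x) =
    det_on Basis (metric N d (snd d (\<Phi> x))) * det_on (Basis - B) (metric M c (snd c x)) / det_on Basis (metric M c (snd c x))"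
    using jac_square[OF fc x] by (simp add: field_simps)
  then show ?thesis by (simp add: jac_def submersion_jacobian_def real_sqrt_mult real_sqrt_divide)
qed

lemma jac_pos:
  assumes "x \<in> points M" shows "jac x > 0"
proof -
  obtain c d B \<sigma> where fc: "fol_chart c d B \<sigma>" and x: "x \<in> fst c" using fol_chart_exists[OF assms] by auto
  note c = fol_chartD[OF fc]
  show ?thesis unfolding jac_eq[OF fc x]
    using M.gram_pos[OF c(1), of "snd c x"] N.gram_pos[OF c(2), of "snd d (\<Phi> x)"] x c(3) c(5)[OF x] by simp
qed

text \<open>The infinitesimal coarea formula: the volume density of \<open>M\<close>, weighted with
  the Jacobian, is the product of the densities along and across the leaves. In product form it
  needs no division in \<open>ennreal\<close>.\<close>

lemma jac_dens:
  assumes fc: "fol_chart c d B \<sigma>" and x: "x \<in> fst c"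
  shows "ennreal (jac x) * M.dens c Basis (snd c x) =
    M.dens c (Basis - B) (snd c x) * N.dens d Basis (snd d (\<Phi> x))"
proof -
  note c = fol_chartD[OF fc]
  have p: "det_on Basis (metric M c (snd c x)) > 0" "det_on (Basis - B) (metric M c (snd c x)) > 0"
    "det_on Basis (metric N d (snd d (\<Phi> x))) > 0"
    using M.gram_pos[OF c(1), of "snd c x"] N.gram_pos[OF c(2), of "snd d (\<Phi> x)"] x c(3) c(5)[OF x] by auto
  have "M.dens c Basis (snd c x) = ennreal (sqrt (det_on Basis (metric M c (snd c x))))"
    "M.dens c (Basis - B) (snd c x) = ennreal (sqrt (det_on (Basis - B) (metric M c (snd c x))))"
    "N.dens d Basis (snd d (\<Phi> x)) = ennreal (sqrt (det_on Basis (metric N d (snd d (\<Phi> x)))))"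
    using x c(5)[OF x] by (auto simp: M.dens_eq N.dens_eq)
  then show ?thesis using p jac_pos[of x] M.chart_domain[OF c(1)] x
    by (simp add: jac_eq[OF fc x] ennreal_mult[symmetric] mult.commute)
qed

text \<open>An empty \<open>M\<close> is set apart because it may admit no foliated chart at all,
  for example when its model space has smaller dimension than that of \<open>N\<close>.\<close>

lemma fol_cover:
  "\<exists>cs ds Bs \<sigma>s. (\<forall>n::nat. fol_chart (cs n) (ds n) (Bs n) (\<sigma>s n)) \<and> points M = (\<Union>n. fst (cs n)) \<or> points M = {}"
proof (cases "points M = {}")
  case False
  have "\<exists>cs. (\<forall>n::nat. \<exists>d B \<sigma>. fol_chart (cs n) d B \<sigma>) \<and> points M \<subseteq> (\<Union>n. fst (cs n))"
  proof (rule M.countable_subcover)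
    show "\<exists>c. (\<exists>d B \<sigma>. fol_chart c d B \<sigma>) \<and> x \<in> fst c" if "x \<in> points M" for x
      using fol_chart_exists[OF that] by blast
    then show "\<exists>c. \<exists>d B \<sigma>. fol_chart c d B \<sigma>" using False by blast
  qed (auto dest: fol_chartD)
  then obtain cs where cs: "\<forall>n::nat. \<exists>d B \<sigma>. fol_chart (cs n) d B \<sigma>" "points M \<subseteq> (\<Union>n. fst (cs n))" by blast
  then obtain ds Bs \<sigma>s where *: "\<forall>n. fol_chart (cs n) (ds n) (Bs n) (\<sigma>s n)" by metis
  then have "points M = (\<Union>n. fst (cs n))" using cs(2) M.chart_domain fol_chartD(1) by blast
  then show ?thesis using * by blast
qed auto

text \<open>The definition makes arbitrary choices at every point, a reference chart and a basis of
  the horizontal space. Measurability is therefore read off from the formula \<open>jac_eq\<close>,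
  which is continuous on each foliated chart.\<close>

lemma jac_measurable: "jac \<in> borel_measurable (restrict_space borel (points M))"
proof (cases "points M = {}")
  case True
  then show ?thesis by (simp add: measurable_def space_restrict_space)
next
  case False
  then obtain cs ds Bs \<sigma>s where f: "\<And>n::nat. fol_chart (cs n) (ds n) (Bs n) (\<sigma>s n)" and cov: "points M = (\<Union>n. fst (cs n))"
    using fol_cover by auto
  show ?thesis
  proof (rule measurable_piecewise_restrict[of "range (\<lambda>n. fst (cs n))"])
    show "space (restrict_space borel (points M)) \<subseteq> \<Union> (range (\<lambda>n. fst (cs n)))"
      using cov by (simp add: space_restrict_space)
    fix W assume "W \<in> range (\<lambda>n. fst (cs n))"
    then obtain n where W: "W = fst (cs n)" by auto
    note c = fol_chartD[OF f[of n]]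
    show "W \<inter> space (restrict_space borel (points M)) \<in> sets (restrict_space borel (points M))"
      unfolding W space_restrict_space using M.chart_domain_sets[OF c(1), of "points M"] by simp
    have cont: "continuous_on W jac"
    proof -
      have 1: "continuous_on W (\<lambda>x. det_on B (metric M (cs n) (snd (cs n) x)))" for B
        unfolding W by (rule continuous_on_compose2[OF M.gram_continuous[OF c(1)] M.chart_continuous[OF c(1)]]) auto
      have 2: "continuous_on W (\<lambda>x. det_on Basis (metric N (ds n) (snd (ds n) (\<Phi> x))))"
      proof (rule continuous_on_compose2[OF N.gram_continuous[OF c(2)]])
        show "continuous_on W (\<lambda>x. snd (ds n) (\<Phi> x))" unfolding W
          using c(5) M.chart_domain[OF c(1)]
          by (intro continuous_on_compose2[OF N.chart_continuous[OF c(2)]] continuous_on_subset[OF \<Phi>_cont]) auto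
        show "(\<lambda>x. snd (ds n) (\<Phi> x)) ` W \<subseteq> snd (ds n) ` fst (ds n)" unfolding W using c(5) by auto
      qed
      have "continuous_on W (\<lambda>x. sqrt (det_on Basis (metric N (ds n) (snd (ds n) (\<Phi> x)))) * sqrt (det_on (Basis - Bs n) (metric M (cs n) (snd (cs n) x))) /
         sqrt (det_on Basis (metric M (cs n) (snd (cs n) x))))"
      proof (intro continuous_intros 1 2 ballI)
        fix x assume "x \<in> W"
        then have "det_on Basis (metric M (cs n) (snd (cs n) x)) > 0"
          using M.gram_pos[OF c(1), of "snd (cs n) x"] by (simp add: W)
        then show "sqrt (det_on Basis (metric M (cs n) (snd (cs n) x))) \<noteq> 0" by simp
      qed
      then show ?thesis by (rule continuous_on_cong[THEN iffD1, rotated 2]) (use jac_eq[OF f] W in auto)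
    qed
    have "W \<subseteq> points M" using cov W by auto
    then show "jac \<in> borel_measurable (restrict_space (restrict_space borel (points M)) W)"
      using borel_measurable_continuous_on_restrict[OF cont]
      by (simp add: measurable_cong_sets[OF sets_restrict_restrict refl])
  qed simp
qed

section \<open>The coarea formula\<close>

abbreviation "borelM \<equiv> restrict_space borel (points M)"
abbreviation "borelN \<equiv> restrict_space borel (points N)"
abbreviation "\<mu> \<equiv> M.vol (points M)"
abbreviation "\<nu> \<equiv> N.vol (points N)"

lemma sets_\<mu> [measurable_cong]: "sets \<mu> = sets borelM" and sets_\<nu> [measurable_cong]: "sets \<nu> = sets borelN"
  by (rule M.sets_vol[OF M.covered_points], rule N.sets_vol[OF N.covered_points])

lemma space_\<mu>: "space \<mu> = points M" and space_\<nu>: "space \<nu> = points N" and space_leaf: "space (M.vol (leaf y)) = leaf y"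
  using M.space_vol[OF M.covered_points] N.space_vol[OF N.covered_points] M.space_vol[OF leaf_covered] by auto

lemma fst_chart_disjoint_leaf:
  assumes fc: "fol_chart c d B \<sigma>" and y: "y \<notin> fst d"
  shows "fst c \<inter> leaf y = {}"
  using fol_chartD(5)[OF fc] y by (auto simp: leaf_def)

lemma nn_integral_leaf_eq:
  assumes fc: "fol_chart c d B \<sigma>" and f: "f \<in> borel_measurable borelM"
  shows "(\<integral>\<^sup>+x\<in>fst c. f x \<partial>M.vol (leaf y)) =
    (if y \<in> fst d then \<integral>\<^sup>+t. M.pull c f (lift B \<sigma> (snd d y) + t) * M.dens c (Basis - B) (lift B \<sigma> (snd d y) + t) \<partial>lborel_span (Basis - B) else 0)"
proof (cases "y \<in> fst d")
  case False
  have "(\<integral>\<^sup>+x\<in>fst c. f x \<partial>M.vol (leaf y)) = (\<integral>\<^sup>+x. 0 \<partial>M.vol (leaf y))"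
    using fst_chart_disjoint_leaf[OF fc False] by (intro nn_integral_cong) (auto simp: space_leaf indicator_def)
  then show ?thesis using False by simp
qed (simp add: nn_integral_leaf[OF fc _ f])

lemma slice_integral_measurable:
  assumes fc: "fol_chart c d B \<sigma>" and f: "f \<in> borel_measurable borelM"
  shows "(\<lambda>w. \<integral>\<^sup>+t. M.pull c f (lift B \<sigma> w + t) * M.dens c (Basis - B) (lift B \<sigma> w + t) \<partial>lborel_span (Basis - B)) \<in> borel_measurable borel"
proof -
  note c = fol_chartD[OF fc]
  interpret sB: sigma_finite_measure "lborel_span (Basis - B) :: 'm measure" by (rule sigma_finite_lborel_span) auto
  note M.pull_measurable[OF c(1) f, measurable] M.dens_measurable[OF c(1), measurable]
  show ?thesis by (intro sB.borel_measurable_nn_integral) measurable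
qed

lemma leaf_integral_measurable_chart:
  assumes fc: "fol_chart c d B \<sigma>" and f: "f \<in> borel_measurable borelM"
  shows "(\<lambda>y. \<integral>\<^sup>+x\<in>fst c. f x \<partial>M.vol (leaf y)) \<in> borel_measurable borelN"
proof -
  note c = fol_chartD[OF fc]
  define K where "K w = (\<integral>\<^sup>+t. M.pull c f (lift B \<sigma> w + t) * M.dens c (Basis - B) (lift B \<sigma> w + t) \<partial>lborel_span (Basis - B))" for w
  have K: "K \<in> borel_measurable borel" unfolding K_def[abs_def] by (rule slice_integral_measurable[OF fc f])
  have sub: "fst d \<subseteq> points N" by (rule N.chart_domain[OF c(2)])
  have dom: "fst d \<in> sets borelN" using N.chart_domain_sets[OF c(2), of "points N"] sub by (simp add: Int_absorb2)
  have "(\<lambda>y. K (snd d y)) \<in> borel_measurable (restrict_space borelN (fst d))"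
    unfolding measurable_cong_sets[OF sets_restrict_restrict[OF sub] refl]
    by (rule measurable_compose[OF borel_measurable_continuous_on_restrict[OF N.chart_continuous[OF c(2)]] K])
  then have "(\<lambda>y. if y \<in> fst d then K (snd d y) else 0) \<in> borel_measurable borelN"
    using dom sub by (subst measurable_If_restrict_space_iff) (auto simp: space_restrict_space Int_absorb1 Collect_conj_eq)
  then show ?thesis unfolding nn_integral_leaf_eq[OF fc f] K_def .
qed

text \<open>In coordinates, \<open>jac_dens\<close> splits the weighted density of \<open>M\<close>
  into a factor along the leaf and the density of \<open>N\<close>. The latter depends only on the
  coordinates in \<open>B\<close>, so after Fubini it leaves the inner integral, which is then the
  integral over a leaf; \<open>push\<close> carries the outer integral to the coordinates of
  \<open>N\<close>.\<close>

lemma coarea_chart: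
  assumes fc: "fol_chart c d B \<sigma>" and f: "f \<in> borel_measurable borelM"
  shows "(\<integral>\<^sup>+x\<in>fst c. f x * ennreal (jac x) \<partial>\<mu>) = (\<integral>\<^sup>+y. (\<integral>\<^sup>+x\<in>fst c. f x \<partial>M.vol (leaf y)) \<partial>\<nu>)"
proof -
  note c = fol_chartD[OF fc]
  note M.pull_measurable[OF c(1) f, measurable] M.dens_measurable[OF c(1), measurable]
    N.dens_measurable[OF c(2), measurable] jac_measurable[measurable]
  have finB: "finite B" using c(3) finite_subset[OF _ finite_Basis] by blast
  let ?C = "Basis - B"
  define S where "S = push B \<sigma>"
  have [measurable]: "S \<in> borel_measurable borel" unfolding S_def by measurable
  have S_lborel: "distr (lborel_span B) borel S = lborel"
    unfolding S_def by (rule lborel_distr_push[OF c(3,4)])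
  have Sb: "S s \<bullet> \<sigma> b = s \<bullet> b" if "b \<in> B" for s b
    unfolding S_def by (rule push_inner[OF finB c(4) that])
  have lift_S: "lift B \<sigma> (S s) = s" if "s \<in> span B" for s
  proof (rule euclidean_eqI)
    fix b :: 'm assume b: "b \<in> Basis"
    then show "lift B \<sigma> (S s) \<bullet> b = s \<bullet> b"
      using that c(3) by (auto simp: lift_inner Sb in_span_Basis_iff)
  qed
  have S_add: "S (s + t) = S s" if "t \<in> span ?C" for s t
    unfolding S_def push_def using that c(3) by (intro sum.cong) (auto simp: inner_left_distrib in_span_Basis_iff)
  have S_chart: "S (snd c x) = snd d (\<Phi> x)" if "x \<in> fst c" for x
    unfolding S_def by (rule push_chart[OF fc that])
  define K where "K w = (\<integral>\<^sup>+t. M.pull c f (lift B \<sigma> w + t) * M.dens c ?C (lift B \<sigma> w + t) \<partial>lborel_span ?C)" for w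
  have K[measurable]: "K \<in> borel_measurable borel" unfolding K_def[abs_def] by (rule slice_integral_measurable[OF fc f])
  have fj: "(\<lambda>x. f x * ennreal (jac x)) \<in> borel_measurable borelM" using f by measurable
  have "(\<integral>\<^sup>+x\<in>fst c. f x * ennreal (jac x) \<partial>\<mu>) = (\<integral>\<^sup>+z. M.pull c (\<lambda>x. f x * ennreal (jac x)) z * M.dens c Basis z \<partial>lborel)"
    by (rule M.nn_integral_vol_points[OF c(1) fj])
  also have "\<dots> = (\<integral>\<^sup>+z. M.pull c f z * (M.dens c ?C z * N.dens d Basis (S z)) \<partial>lborel)"
  proof (rule nn_integral_cong)
    fix z
    show "M.pull c (\<lambda>x. f x * ennreal (jac x)) z * M.dens c Basis z = M.pull c f z * (M.dens c ?C z * N.dens d Basis (S z))"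
    proof (cases "z \<in> snd c ` fst c")
      case True
      then obtain x where x: "x \<in> fst c" "z = snd c x" by auto
      then show ?thesis
        using jac_dens[OF fc x(1)] by (simp add: M.pull_app[OF c(1) x(1)] S_chart mult.assoc)
    qed (simp add: M.pull_def)
  qed
  \<comment> \<open>The outer variable \<open>s\<close> moves across the leaves and the inner
    variable \<open>t\<close> along one of them.\<close>
  also have "\<dots> = (\<integral>\<^sup>+s. (\<integral>\<^sup>+t. M.pull c f (s + t) * (M.dens c ?C (s + t) * N.dens d Basis (S (s + t))) \<partial>lborel_span ?C) \<partial>lborel_span (Basis - ?C))"
    by (rule nn_integral_lborel_split) (auto, measurable)
  also have "Basis - ?C = B" using c(3) by auto
  also have "(\<integral>\<^sup>+s. (\<integral>\<^sup>+t. M.pull c f (s + t) * (M.dens c ?C (s + t) * N.dens d Basis (S (s + t))) \<partial>lborel_span ?C) \<partial>lborel_span B) =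
     (\<integral>\<^sup>+s. K (S s) * N.dens d Basis (S s) \<partial>lborel_span B)"
  proof (rule nn_integral_lborel_span_cong)
    fix s assume s: "s \<in> span B"
    have "(\<integral>\<^sup>+t. M.pull c f (s + t) * (M.dens c ?C (s + t) * N.dens d Basis (S (s + t))) \<partial>lborel_span ?C) =
      (\<integral>\<^sup>+t. (M.pull c f (s + t) * M.dens c ?C (s + t)) * N.dens d Basis (S s) \<partial>lborel_span ?C)"
      by (rule nn_integral_lborel_span_cong) (simp_all add: S_add mult.assoc)
    also have "\<dots> = K (S s) * N.dens d Basis (S s)"
      unfolding K_def lift_S[OF s] by (rule nn_integral_multc) measurable
    finally show "(\<integral>\<^sup>+t. M.pull c f (s + t) * (M.dens c ?C (s + t) * N.dens d Basis (S (s + t))) \<partial>lborel_span ?C) =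
      K (S s) * N.dens d Basis (S s)" .
  next
    interpret sB: sigma_finite_measure "lborel_span ?C :: 'm measure" by (rule sigma_finite_lborel_span) auto
    show "(\<lambda>s. \<integral>\<^sup>+t. M.pull c f (s + t) * (M.dens c ?C (s + t) * N.dens d Basis (S (s + t))) \<partial>lborel_span ?C) \<in> borel_measurable borel"
      by (intro sB.borel_measurable_nn_integral) measurable
  qed measurable
  also have "\<dots> = (\<integral>\<^sup>+w. K w * N.dens d Basis w \<partial>distr (lborel_span B) borel S)"
    by (subst nn_integral_distr) simp_all
  also have "\<dots> = (\<integral>\<^sup>+w. K w * N.dens d Basis w \<partial>lborel)" unfolding S_lborel ..
  also have "\<dots> = (\<integral>\<^sup>+w. N.pull d (\<lambda>y. \<integral>\<^sup>+x\<in>fst c. f x \<partial>M.vol (leaf y)) w * N.dens d Basis w \<partial>lborel)"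
  proof (rule nn_integral_cong)
    fix w
    show "K w * N.dens d Basis w = N.pull d (\<lambda>y. \<integral>\<^sup>+x\<in>fst c. f x \<partial>M.vol (leaf y)) w * N.dens d Basis w"
    proof (cases "w \<in> snd d ` fst d")
      case True
      then obtain y where y: "y \<in> fst d" "w = snd d y" by auto
      then show ?thesis by (simp add: N.pull_app[OF c(2) y(1)] nn_integral_leaf_eq[OF fc f] K_def)
    qed (simp add: N.dens_def)
  qed
  also have "\<dots> = (\<integral>\<^sup>+y\<in>fst d. (\<integral>\<^sup>+x\<in>fst c. f x \<partial>M.vol (leaf y)) \<partial>\<nu>)"
    by (rule N.nn_integral_vol_points[OF c(2) leaf_integral_measurable_chart[OF fc f], symmetric])
  also have "\<dots> = (\<integral>\<^sup>+y. (\<integral>\<^sup>+x\<in>fst c. f x \<partial>M.vol (leaf y)) \<partial>\<nu>)"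
    by (rule nn_integral_cong) (simp only: nn_integral_leaf_eq[OF fc f], simp add: indicator_def)
  finally show ?thesis .
qed

text \<open>Writing \<open>f\<close> as the sum of its restrictions to disjoint pieces of foliated
  charts reduces both claims to a single chart; the leaf integral is a countable sum of measurable
  functions for the same reason.\<close>

lemma coarea_aux:
  assumes f: "f \<in> borel_measurable borelM"
  shows "(\<lambda>y. \<integral>\<^sup>+x. f x \<partial>M.vol (leaf y)) \<in> borel_measurable borelN \<and>
    (\<integral>\<^sup>+x. f x * ennreal (jac x) \<partial>\<mu>) = (\<integral>\<^sup>+y. (\<integral>\<^sup>+x. f x \<partial>M.vol (leaf y)) \<partial>\<nu>)"
proof (cases "points M = {}")
  case True
  then have "leaf y = {}" for y by (auto simp: leaf_def)
  then show ?thesis using True space_\<mu> space_leaf by (simp add: nn_integral_empty)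
next
  case False
  then obtain cs ds Bs \<sigma>s where fc: "\<And>n::nat. fol_chart (cs n) (ds n) (Bs n) (\<sigma>s n)" and cov: "points M = (\<Union>n. fst (cs n))"
    using fol_cover by auto
  note jac_measurable[measurable]
  define D where "D n = disjointed (\<lambda>n. fst (cs n)) n" for n
  have D_fst: "x \<in> fst (cs n)" if "x \<in> D n" for x n
    using disjointed_subset[of "\<lambda>n. fst (cs n)" n] that by (auto simp: D_def)
  have D_disj: "disjoint_family D" unfolding D_def[abs_def] by (rule disjoint_family_disjointed)
  have D_UN: "(\<Union>n. D n) = points M" unfolding D_def UN_disjointed_eq using cov by simp
  have "fst (cs n) \<in> sets borelM" for n
    using M.chart_domain_sets[OF fol_chartD(1)[OF fc], of "points M" n] M.chart_domain[OF fol_chartD(1)[OF fc]]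
    by (simp add: Int_absorb2)
  then have D[measurable]: "D n \<in> sets borelM" for n
    using sets.range_disjointed_sets[of "\<lambda>n. fst (cs n)" borelM] unfolding D_def by auto
  define F where "F n x = f x * indicator (D n) x" for n x
  have F[measurable]: "F n \<in> borel_measurable borelM" for n unfolding F_def using f by measurable
  have ind: "(\<Sum>n. indicator (D n) x :: ennreal) = 1" if "x \<in> points M" for x
    using suminf_indicator[OF D_disj, of x] that D_UN by simp
  have f_sum: "f x = (\<Sum>n. F n x)" if "x \<in> points M" for x
    unfolding F_def using ind[OF that] by (simp add: ennreal_suminf_cmult)
  have F_fst: "F n x * indicator (fst (cs n)) x = F n x" for n x
    using D_fst[of x n] by (auto simp: F_def indicator_def)
  have inner: "(\<integral>\<^sup>+x. f x \<partial>M.vol (leaf y)) = (\<Sum>n. \<integral>\<^sup>+x\<in>fst (cs n). F n x \<partial>M.vol (leaf y))" for y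
  proof -
    have "(\<integral>\<^sup>+x. f x \<partial>M.vol (leaf y)) = (\<integral>\<^sup>+x. (\<Sum>n. F n x) \<partial>M.vol (leaf y))"
    proof (rule nn_integral_cong)
      fix x assume "x \<in> space (M.vol (leaf y))"
      then have "x \<in> points M" unfolding space_leaf by (simp add: leaf_def)
      then show "f x = (\<Sum>n. F n x)" by (rule f_sum)
    qed
    also have "\<dots> = (\<Sum>n. \<integral>\<^sup>+x. F n x \<partial>M.vol (leaf y))"
      by (rule nn_integral_suminf) (rule leaf_measurable[OF F])
    finally show ?thesis by (simp only: F_fst)
  qed
  have "(\<integral>\<^sup>+x. f x * ennreal (jac x) \<partial>\<mu>) = (\<integral>\<^sup>+x. (\<Sum>n. F n x * ennreal (jac x)) \<partial>\<mu>)"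
    by (rule nn_integral_cong) (simp add: f_sum space_\<mu>)
  also have "\<dots> = (\<Sum>n. \<integral>\<^sup>+x. F n x * ennreal (jac x) \<partial>\<mu>)"
    by (rule nn_integral_suminf) measurable
  also have "\<dots> = (\<Sum>n. \<integral>\<^sup>+x\<in>fst (cs n). F n x * ennreal (jac x) \<partial>\<mu>)"
    by (intro suminf_cong nn_integral_cong) (metis F_fst mult.assoc mult.commute)
  also have "\<dots> = (\<Sum>n. \<integral>\<^sup>+y. (\<integral>\<^sup>+x\<in>fst (cs n). F n x \<partial>M.vol (leaf y)) \<partial>\<nu>)"
    by (simp only: coarea_chart[OF fc F])
  also have "\<dots> = (\<integral>\<^sup>+y. (\<Sum>n. \<integral>\<^sup>+x\<in>fst (cs n). F n x \<partial>M.vol (leaf y)) \<partial>\<nu>)"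
    by (rule nn_integral_suminf[symmetric])
       (subst measurable_cong_sets[OF sets_\<nu> refl], rule leaf_integral_measurable_chart[OF fc F])
  finally have "(\<integral>\<^sup>+x. f x * ennreal (jac x) \<partial>\<mu>) = (\<integral>\<^sup>+y. (\<integral>\<^sup>+x. f x \<partial>M.vol (leaf y)) \<partial>\<nu>)"
    by (simp only: inner)
  moreover have "(\<lambda>y. \<integral>\<^sup>+x. f x \<partial>M.vol (leaf y)) \<in> borel_measurable borelN"
    unfolding inner by (rule borel_measurable_suminf_order) (rule leaf_integral_measurable_chart[OF fc F])
  ultimately show ?thesis by simp
qed

lemmas leaf_integral_measurable = coarea_aux[THEN conjunct1]
lemmas coarea = coarea_aux[THEN conjunct2]

end

section \<open>The extremal function\<close>

text \<open>Young's inequality for the exponents p and p/(p-1). The terms of the tangent inequality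
  are arranged so that every one is nonnegative, which allows integrating in \<open>ennreal\<close>
  without subtraction.\<close>

lemma powr_tangent:
  fixes a b p :: real
  assumes "p > 1" "a \<ge> 0" "b \<ge> 0"
  shows "b powr p + p * b powr (p - 1) * a \<le> a powr p + p * b powr p"
proof -
  have "(b powr (p - 1)) powr (p / (p - 1)) = b powr p" using assms by (simp add: powr_powr)
  moreover have "a * b powr (p - 1) \<le> a powr p / p + (b powr (p - 1)) powr (p / (p - 1)) / (p / (p - 1))"
    using assms by (intro Youngs_inequality) (simp_all add: field_simps)
  ultimately have "p * (a * b powr (p - 1)) \<le> p * (a powr p / p + b powr p / (p / (p - 1)))"
    using assms by (intro mult_left_mono) simp_all
  also have "\<dots> = a powr p + (p - 1) * b powr p" using assms by (simp add: field_simps)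
  finally show ?thesis by (simp add: algebra_simps)
qed

context submersion_setup
begin

section \<open>Leaf volumes and null sets of leaves\<close>

lemma leaf_points:
  assumes "x \<in> space (M.vol (leaf y))" shows "x \<in> points M" "\<Phi> x = y"
  using assms unfolding space_leaf by (auto simp: leaf_def)

lemma leaf_integral_affine:
  fixes u v :: "'p \<Rightarrow> ennreal"
  assumes "u \<in> borel_measurable borelM" "v \<in> borel_measurable borelM"
  shows "(\<integral>\<^sup>+x. u x + a * v x \<partial>M.vol (leaf y)) = (\<integral>\<^sup>+x. u x \<partial>M.vol (leaf y)) + a * (\<integral>\<^sup>+x. v x \<partial>M.vol (leaf y))"
  using assms[THEN leaf_measurable] by (simp add: nn_integral_add nn_integral_cmult)

definition leaf_mass where "leaf_mass y = emeasure (M.vol (leaf y)) (leaf y)"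

lemma leaf_mass_integral: "leaf_mass y = (\<integral>\<^sup>+x. 1 \<partial>M.vol (leaf y))"
  by (simp add: leaf_mass_def space_leaf)

lemma leaf_mass_zero:
  assumes "AE x in M.vol (leaf y). False" shows "leaf_mass y = 0"
proof -
  have "leaf_mass y = (\<integral>\<^sup>+x. 0 \<partial>M.vol (leaf y))"
    unfolding leaf_mass_integral using assms by (intro nn_integral_cong_AE) auto
  then show ?thesis by simp
qed

lemma leaf_mass_measurable [measurable]: "leaf_mass \<in> borel_measurable borelN"
  unfolding leaf_mass_integral[abs_def] by (rule leaf_integral_measurable) simp

lemma \<Phi>_measurable: "\<Phi> \<in> measurable borelM borelN"
  using \<Phi>_points by (intro measurable_restrict_space2 borel_measurable_continuous_on_restrict \<Phi>_cont)
    (auto simp: space_restrict_space)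

text \<open>By the coarea formula the Jacobian has integral zero over the preimage of
  \<open>E\<close>, and it is positive. This covers two cases: sets \<open>E\<close> that are null
  in \<open>N\<close>, and leaves of volume zero.\<close>

lemma saturated_null:
  assumes E: "E \<in> sets borelN" and null: "AE y in \<nu>. y \<in> E \<longrightarrow> leaf_mass y = 0"
  shows "{x \<in> points M. \<Phi> x \<in> E} \<in> null_sets \<mu>"
proof -
  let ?E = "{x \<in> points M. \<Phi> x \<in> E}"
  note jac_measurable[measurable]
  have E'[measurable]: "?E \<in> sets borelM"
    using measurable_sets[OF \<Phi>_measurable E] by (simp add: space_restrict_space vimage_def Int_def conj_commute)
  have "(\<integral>\<^sup>+x. indicator ?E x * ennreal (jac x) \<partial>\<mu>) = (\<integral>\<^sup>+y. (\<integral>\<^sup>+x. indicator ?E x \<partial>M.vol (leaf y)) \<partial>\<nu>)"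
    by (rule coarea) measurable
  also have "\<dots> = (\<integral>\<^sup>+y. indicator E y * leaf_mass y \<partial>\<nu>)"
  proof (rule nn_integral_cong)
    fix y
    have "(\<integral>\<^sup>+x. indicator ?E x \<partial>M.vol (leaf y)) = (\<integral>\<^sup>+x. indicator E y * 1 \<partial>M.vol (leaf y))"
      by (rule nn_integral_cong) (simp add: leaf_points indicator_def)
    also have "\<dots> = indicator E y * leaf_mass y"
      unfolding leaf_mass_integral by (rule nn_integral_cmult) simp
    finally show "(\<integral>\<^sup>+x. indicator ?E x \<partial>M.vol (leaf y)) = indicator E y * leaf_mass y" .
  qed
  also have "\<dots> = (\<integral>\<^sup>+y. 0 \<partial>\<nu>)"
    using null by (intro nn_integral_cong_AE) (auto simp: indicator_def)
  finally have "(\<integral>\<^sup>+x. indicator ?E x * ennreal (jac x) \<partial>\<mu>) = 0" by simp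
  then have "AE x in \<mu>. indicator ?E x * ennreal (jac x) = 0"
    by (subst (asm) nn_integral_0_iff_AE) auto
  then have "AE x in \<mu>. x \<notin> ?E"
  proof (rule AE_mp[OF _ AE_I2], intro impI notI)
    fix x assume "indicator ?E x * ennreal (jac x) = 0" "x \<in> ?E"
    then show False using jac_pos[of x] by auto
  qed
  then show ?thesis using E' by (simp add: AE_iff_null_sets sets_\<mu>)
qed

text \<open>The coarea formula for the indicator function of \<open>Z\<close>: the integral on
  \<open>M\<close> is zero, hence so is almost every leaf integral.\<close>

lemma null_set_leaves:
  assumes Z: "Z \<in> null_sets \<mu>"
  shows "AE y in \<nu>. AE x in M.vol (leaf y). x \<notin> Z"
proof -
  note jac_measurable[measurable]
  have Z'[measurable]: "Z \<in> sets borelM" using Z sets_\<mu> by auto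
  have "(\<integral>\<^sup>+y. (\<integral>\<^sup>+x. indicator Z x \<partial>M.vol (leaf y)) \<partial>\<nu>) = (\<integral>\<^sup>+x. indicator Z x * ennreal (jac x) \<partial>\<mu>)"
    by (rule coarea[symmetric]) measurable
  also have "\<dots> = (\<integral>\<^sup>+x. 0 \<partial>\<mu>)"
    using AE_not_in[OF Z] by (intro nn_integral_cong_AE) (auto simp: indicator_def)
  finally have 0: "(\<integral>\<^sup>+y. (\<integral>\<^sup>+x. indicator Z x \<partial>M.vol (leaf y)) \<partial>\<nu>) = 0" by simp
  have "AE y in \<nu>. (\<integral>\<^sup>+x. indicator Z x \<partial>M.vol (leaf y)) = 0"
  proof (rule nn_integral_0_iff_AE[THEN iffD1, OF _ 0])
    show "(\<lambda>y. \<integral>\<^sup>+x. indicator Z x \<partial>M.vol (leaf y)) \<in> borel_measurable \<nu>"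
      unfolding measurable_cong_sets[OF sets_\<nu> refl] by (rule leaf_integral_measurable) measurable
  qed
  then show ?thesis
  proof (rule AE_mp[OF _ AE_I2], intro impI)
    fix y assume "(\<integral>\<^sup>+x. indicator Z x \<partial>M.vol (leaf y)) = 0"
    then have "AE x in M.vol (leaf y). indicator Z x = (0::ennreal)"
      by (subst (asm) nn_integral_0_iff_AE) (auto intro!: leaf_measurable)
    then show "AE x in M.vol (leaf y). x \<notin> Z" by (auto simp: indicator_def)
  qed
qed

lemma leaves_eq: "leaves M \<Phi> = leaf ` \<Phi> ` points M"
  by (auto simp: leaves_def leaf_def)

lemma leaf_sets: "leaf y \<in> sets (M.vol (leaf y))"
  using sets.top[of "M.vol (leaf y)"] by (simp add: space_leaf)

lemma emeasure_lebesgue_leaf: "emeasure (lebesgue_volume M (leaf y)) (leaf y) = leaf_mass y"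
  unfolding lebesgue_volume_def leaf_mass_def using leaf_sets[of y] by simp

lemma leaf_mass_finite_AE:
  assumes C: "\<forall>x\<in>points M. jac x < C" and fin: "emeasure \<mu> (points M) < \<infinity>"
  shows "AE y in \<nu>. leaf_mass y \<noteq> \<infinity>"
proof -
  note jac_measurable[measurable]
  have "(\<integral>\<^sup>+y. leaf_mass y \<partial>\<nu>) = (\<integral>\<^sup>+x. 1 * ennreal (jac x) \<partial>\<mu>)"
    unfolding leaf_mass_integral by (rule coarea[symmetric]) simp
  also have "\<dots> \<le> (\<integral>\<^sup>+x. ennreal C \<partial>\<mu>)"
  proof (rule nn_integral_mono)
    fix x assume "x \<in> space \<mu>"
    then have "jac x \<le> C" using C by (simp add: space_\<mu> less_imp_le)
    then show "1 * ennreal (jac x) \<le> ennreal C" by (simp add: ennreal_leI)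
  qed
  also have "\<dots> = ennreal C * emeasure \<mu> (points M)" by (simp add: space_\<mu>)
  also have "\<dots> < \<infinity>" using fin by (simp add: ennreal_mult_less_top)
  finally have "(\<integral>\<^sup>+y. leaf_mass y \<partial>\<nu>) \<noteq> \<infinity>" by simp
  then show ?thesis by (intro nn_integral_PInf_AE) (auto simp: measurable_cong_sets[OF sets_\<nu> refl])
qed

lemma infinite_leaves_null:
  assumes C: "\<forall>x\<in>points M. jac x < C" and fin: "emeasure \<mu> (points M) < \<infinity>"
  shows "\<Union>(infinite_leaves M \<Phi>) \<in> null_sets (lebesgue_volume M (points M))"
proof -
  have "{x \<in> points M. \<Phi> x \<in> {y \<in> space borelN. leaf_mass y = \<infinity>}} \<in> null_sets \<mu>"
    using leaf_mass_finite_AE[OF C fin] by (intro saturated_null) (measurable, auto)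
  moreover have "\<Union>(infinite_leaves M \<Phi>) \<subseteq> {x \<in> points M. \<Phi> x \<in> {y \<in> space borelN. leaf_mass y = \<infinity>}}"
  proof
    fix x assume "x \<in> \<Union>(infinite_leaves M \<Phi>)"
    then obtain y where "x \<in> leaf y" "leaf_mass y = \<infinity>"
      unfolding infinite_leaves_def leaves_eq using emeasure_lebesgue_leaf by auto
    then show "x \<in> {x \<in> points M. \<Phi> x \<in> {y \<in> space borelN. leaf_mass y = \<infinity>}}"
      using \<Phi>_points by (auto simp: leaf_def space_restrict_space)
  qed
  ultimately show ?thesis unfolding lebesgue_volume_def null_sets_completion_iff2 by blast
qed

section \<open>Construction and minimality of the extremal function\<close>

lemma extremal_exists:
  fixes p C :: real
  assumes C: "\<forall>x\<in>points M. jac x < C" and fin: "emeasure \<mu> (points M) < \<infinity>" and p: "p > 1"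
    and adm: "adm M \<Phi> p \<noteq> {}"
  shows "\<exists>f\<^sub>0. extremal M \<Phi> p f\<^sub>0"
proof -
  note jac_measurable[measurable] \<Phi>_measurable[measurable]
  have [measurable_cong]: "sets (M.vol (points M)) = sets borelM" by (rule sets_\<mu>)
  \<comment> \<open>The exponent is chosen to make \<open>w\<close> to the power p-1 equal to the
    Jacobian, so that multiples of \<open>w\<close> that are constant on leaves satisfy the Lagrange
    condition.\<close>
  define w where "w x = jac x powr (1 / (p - 1))" for x
  have w[measurable]: "w \<in> borel_measurable borelM" unfolding w_def by measurable
  have w_pos: "w x > 0" if "x \<in> points M" for x using jac_pos[OF that] by (simp add: w_def)
  have w_powr: "w x powr (p - 1) = jac x" if "x \<in> points M" for x
    using p jac_pos[OF that] by (simp add: w_def powr_powr)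
  define I where "I y = (\<integral>\<^sup>+x. ennreal (w x) \<partial>M.vol (leaf y))" for y
  have I[measurable]: "I \<in> borel_measurable borelN"
    unfolding I_def[abs_def] by (rule leaf_integral_measurable) measurable
  have I_finite: "I y \<noteq> \<infinity>" if "leaf_mass y \<noteq> \<infinity>" for y
  proof -
    have "I y \<le> (\<integral>\<^sup>+x. ennreal (C powr (1 / (p - 1))) \<partial>M.vol (leaf y))"
      unfolding I_def w_def
    proof (intro nn_integral_mono ennreal_leI powr_mono2)
      fix x assume "x \<in> space (M.vol (leaf y))"
      then have "x \<in> points M" by (rule leaf_points)
      then show "0 \<le> jac x" "jac x \<le> C" using C jac_pos[of x] by (auto simp: less_imp_le)
    qed (use p in simp)
    also have "\<dots> = ennreal (C powr (1 / (p - 1))) * leaf_mass y"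
      by (simp add: leaf_mass_def space_leaf)
    also have "\<dots> < \<infinity>" using that by (simp add: ennreal_mult_less_top less_top)
    finally show ?thesis by simp
  qed
  have I_pos: "I y \<noteq> 0" if "leaf_mass y \<noteq> 0" for y
  proof
    assume "I y = 0"
    then have "AE x in M.vol (leaf y). ennreal (w x) = 0"
      unfolding I_def by (subst (asm) nn_integral_0_iff_AE) (auto intro!: leaf_measurable)
    then have "AE x in M.vol (leaf y). False"
      by (rule AE_mp[OF _ AE_I2]) (use w_pos leaf_points in \<open>force simp: ennreal_eq_0_iff\<close>)
    then have "leaf_mass y = 0" by (rule leaf_mass_zero)
    with that show False by simp
  qed
  \<comment> \<open>A real normalising factor. If \<open>I y\<close> is 0 or infinite,
    \<open>k y\<close> is 0 and \<open>f0\<close> vanishes on that leaf because division by 0 gives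
    0. Such leaves have volume zero or infinity and form a null set.\<close>
  define k where "k y = enn2real (I y)" for y
  have k[measurable]: "k \<in> borel_measurable borelN" unfolding k_def by measurable
  have k_pos: "k y > 0" and k_I: "I y = ennreal (k y)" if "leaf_mass y \<noteq> 0" "leaf_mass y \<noteq> \<infinity>" for y
    using I_finite[OF that(2)] I_pos[OF that(1)]
    by (auto simp: k_def enn2real_positive_iff less_top zero_less_iff_neq_zero)
  define f0 where "f0 x = w x / k (\<Phi> x)" for x
  have f0[measurable]: "f0 \<in> borel_measurable borelM" unfolding f0_def by measurable
  have f0_nonneg: "f0 x \<ge> 0" for x by (simp add: f0_def w_def k_def)
  have leaf_f0: "(\<integral>\<^sup>+x. ennreal (f0 x) \<partial>M.vol (leaf y)) = 1"
    if "leaf_mass y \<noteq> 0" "leaf_mass y \<noteq> \<infinity>" for y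
  proof -
    have "(\<integral>\<^sup>+x. ennreal (f0 x) \<partial>M.vol (leaf y)) = (\<integral>\<^sup>+x. ennreal (1 / k y) * ennreal (w x) \<partial>M.vol (leaf y))"
      using k_pos[OF that] by (intro nn_integral_cong) (auto dest!: leaf_points simp: f0_def ennreal_mult[symmetric] w_def)
    also have "\<dots> = ennreal (1 / k y) * I y"
      unfolding I_def by (rule nn_integral_cmult) (rule leaf_measurable, measurable)
    also have "\<dots> = 1" using k_pos[OF that] by (simp add: k_I[OF that] ennreal_mult[symmetric])
    finally show ?thesis .
  qed
  have f0_leaves: "almost_every_leaf M \<Phi> (\<lambda>L. (\<integral>\<^sup>+x. ennreal (f0 x) \<partial>lebesgue_volume M L) \<ge> 1)"
  proof -
    let ?E = "{y \<in> space borelN. leaf_mass y = 0 \<or> leaf_mass y = \<infinity>}"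
    have "{x \<in> points M. \<Phi> x \<in> ?E} \<in> null_sets \<mu>"
      using leaf_mass_finite_AE[OF C fin] by (intro saturated_null) (measurable, auto)
    moreover have "\<Union>{L \<in> leaves M \<Phi>. \<not> (\<integral>\<^sup>+x. ennreal (f0 x) \<partial>lebesgue_volume M L) \<ge> 1} \<subseteq> {x \<in> points M. \<Phi> x \<in> ?E}"
    proof
      fix x assume "x \<in> \<Union>{L \<in> leaves M \<Phi>. \<not> (\<integral>\<^sup>+x. ennreal (f0 x) \<partial>lebesgue_volume M L) \<ge> 1}"
      then obtain y where y: "x \<in> leaf y" "\<not> (\<integral>\<^sup>+x. ennreal (f0 x) \<partial>M.vol (leaf y)) \<ge> 1"
        unfolding leaves_eq lebesgue_volume_def nn_integral_completion by auto
      then have "leaf_mass y = 0 \<or> leaf_mass y = \<infinity>" using leaf_f0[of y] by fastforce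
      then show "x \<in> {x \<in> points M. \<Phi> x \<in> ?E}" using y(1) \<Phi>_points by (auto simp: leaf_def space_restrict_space)
    qed
    ultimately show ?thesis
      unfolding almost_every_leaf_def lebesgue_volume_def[of M "points M"] null_sets_completion_iff2 by blast
  qed
  \<comment> \<open>Stated for \<open>ennreal\<close> integrals because the integrability of
    \<open>f0\<close> to the power p is not yet known; it will follow from this very
    inequality.\<close>
  have key: "(\<integral>\<^sup>+x. ennreal (f0 x powr p) \<partial>\<mu>) \<le> (\<integral>\<^sup>+x. ennreal (\<bar>f x\<bar> powr p) \<partial>\<mu>)" if f: "f \<in> adm M \<Phi> p" for f
  proof -
    have f_meas: "f \<in> borel_measurable (completion \<mu>)" and f_nonneg: "\<And>x. x \<in> points M \<Longrightarrow> f x \<ge> 0"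
      and f_leaves: "almost_every_leaf M \<Phi> (\<lambda>L. (\<integral>\<^sup>+x. ennreal (f x) \<partial>lebesgue_volume M L) \<ge> 1)"
      using f by (auto simp: adm_def in_Lp_def lebesgue_volume_def)
    \<comment> \<open>The coarea formula requires Borel functions, while \<open>f\<close> is
      measurable only for the completion. The positive part of a Borel representative agrees with
      \<open>f\<close> almost everywhere.\<close>
    obtain f' where f': "f' \<in> borel_measurable \<mu>" "AE x in \<mu>. f x = f' x"
      using completion_ex_borel_measurable_real[OF f_meas] by blast
    define h where "h x = max 0 (f' x)" for x
    have [measurable]: "f' \<in> borel_measurable borelM" using f'(1) by measurable
    have h[measurable]: "h \<in> borel_measurable borelM" unfolding h_def by measurable
    have h_nonneg: "h x \<ge> 0" for x by (simp add: h_def)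
    have "AE x in \<mu>. f x = h x"
      using f'(2) AE_space by eventually_elim (use f_nonneg in \<open>force simp: h_def space_\<mu>\<close>)
    then obtain Z where Z: "{x \<in> space \<mu>. \<not> f x = h x} \<subseteq> Z" "Z \<in> null_sets \<mu>"
      by (auto simp: eventually_ae_filter)
    \<comment> \<open>A null set of the uncompleted volume that contains every leaf on which the
      integral of \<open>f\<close> is less than 1.\<close>
    obtain Z' where Z': "\<Union>{L \<in> leaves M \<Phi>. \<not> (\<integral>\<^sup>+x. ennreal (f x) \<partial>lebesgue_volume M L) \<ge> 1} \<subseteq> Z'" "Z' \<in> null_sets \<mu>"
      using f_leaves unfolding almost_every_leaf_def lebesgue_volume_def[of M "points M"] null_sets_completion_iff2
      by (elim bexE) (rule that)
    have leafwise: "(\<integral>\<^sup>+x. ennreal (f0 x powr p / jac x) \<partial>M.vol (leaf y)) \<le> (\<integral>\<^sup>+x. ennreal (h x powr p / jac x) \<partial>M.vol (leaf y))"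
      if Zy: "AE x in M.vol (leaf y). x \<notin> Z" and Zy': "AE x in M.vol (leaf y). x \<notin> Z'" and my: "leaf_mass y \<noteq> \<infinity>" for y
    proof (cases "leaf_mass y = 0")
      case True
      have "AE x in M.vol (leaf y). ennreal (f0 x powr p / jac x) = 0"
        by (rule AE_I[of _ _ "leaf y"]) (use True leaf_sets space_leaf in \<open>auto simp: leaf_mass_def\<close>)
      then have "(\<integral>\<^sup>+x. ennreal (f0 x powr p / jac x) \<partial>M.vol (leaf y)) = (\<integral>\<^sup>+x. 0 \<partial>M.vol (leaf y))"
        by (rule nn_integral_cong_AE)
      then show ?thesis by simp
    next
      case False
      note kp = k_pos[OF False my]
      have "leaf y \<noteq> {}" using False by (auto simp: leaf_mass_def)
      then have "leaf y \<in> leaves M \<Phi>" unfolding leaves_eq by (auto simp: leaf_def)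
      \<comment> \<open>\<open>Z'\<close> is null in this leaf, which has positive volume. So the
        leaf is not one of the exceptional leaves, which lie inside \<open>Z'\<close>.\<close>
      moreover have "\<not> leaf y \<subseteq> Z'"
      proof
        assume sub: "leaf y \<subseteq> Z'"
        have "AE x in M.vol (leaf y). False"
          using Zy' AE_space by eventually_elim (use sub in \<open>auto simp: space_leaf\<close>)
        then have "leaf_mass y = 0" by (rule leaf_mass_zero)
        with False show False by simp
      qed
      ultimately have "1 \<le> (\<integral>\<^sup>+x. ennreal (f x) \<partial>M.vol (leaf y))"
        using Z'(1) unfolding lebesgue_volume_def nn_integral_completion by blast
      also have "\<dots> = (\<integral>\<^sup>+x. ennreal (h x) \<partial>M.vol (leaf y))"
      proof (rule nn_integral_cong_AE)
        show "AE x in M.vol (leaf y). ennreal (f x) = ennreal (h x)"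
          using Zy AE_space
        proof eventually_elim
          case (elim x)
          then have "x \<in> space \<mu>" using leaf_points(1)[of x y] by (simp add: space_\<mu>)
          then have "f x = h x" using Z(1) elim(1) by blast
          then show ?case by simp
        qed
      qed
      finally have h1: "1 \<le> (\<integral>\<^sup>+x. ennreal (h x) \<partial>M.vol (leaf y))" .
      \<comment> \<open>The constant value of \<open>f0 powr (p - 1) / jac\<close> on the leaf,
        which is the Lagrange multiplier up to the factor p.\<close>
      define \<kappa> where "\<kappa> = k y powr (1 - p)"
      have \<kappa>: "\<kappa> > 0" using kp by (simp add: \<kappa>_def)
      have f0_powr: "f0 x powr (p - 1) = jac x * \<kappa>" "f0 x powr p = f0 x * (jac x * \<kappa>)"
        if "x \<in> space (M.vol (leaf y))" for x
      proof -
        have x: "x \<in> points M" "\<Phi> x = y" using leaf_points[OF that] by auto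
        have f0x: "f0 x = w x / k y" "f0 x > 0" using kp w_pos[OF x(1)] by (auto simp: f0_def x)
        have "f0 x powr (p - 1) = w x powr (p - 1) / k y powr (p - 1)"
          unfolding f0x(1) using kp w_pos[OF x(1)] by (simp add: powr_divide)
        also have "\<dots> = jac x * \<kappa>"
          unfolding w_powr[OF x(1)] \<kappa>_def by (simp add: divide_inverse flip: powr_minus)
        finally show 1: "f0 x powr (p - 1) = jac x * \<kappa>" .
        have "f0 x powr p = f0 x powr (1 + (p - 1))" by simp
        also have "\<dots> = f0 x * f0 x powr (p - 1)" using f0x(2) by (simp only: powr_add) simp
        finally show "f0 x powr p = f0 x * (jac x * \<kappa>)" unfolding 1 .
      qed
      have "(\<integral>\<^sup>+x. ennreal (f0 x powr p / jac x) \<partial>M.vol (leaf y)) = (\<integral>\<^sup>+x. ennreal \<kappa> * ennreal (f0 x) \<partial>M.vol (leaf y))"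
      proof (rule nn_integral_cong)
        fix x assume x: "x \<in> space (M.vol (leaf y))"
        have "f0 x powr p / jac x = \<kappa> * f0 x"
          unfolding f0_powr(2)[OF x] using jac_pos[OF leaf_points(1)[OF x]] by simp
        then show "ennreal (f0 x powr p / jac x) = ennreal \<kappa> * ennreal (f0 x)"
          using \<kappa> f0_nonneg by (simp add: ennreal_mult)
      qed
      also have "\<dots> = ennreal \<kappa> * (\<integral>\<^sup>+x. ennreal (f0 x) \<partial>M.vol (leaf y))"
        by (rule nn_integral_cmult) (rule leaf_measurable, measurable)
      finally have L: "(\<integral>\<^sup>+x. ennreal (f0 x powr p / jac x) \<partial>M.vol (leaf y)) = ennreal \<kappa>"
        using leaf_f0[OF False my] by simp
      \<comment> \<open>The tangent inequality divided by the Jacobian and integrated over the leaf.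
        The linear terms become p times \<kappa> times the integrals of \<open>h\<close> and of
        \<open>f0\<close>, of which the first is at least 1 and the second is 1. The finite term p
        times \<kappa> then cancels.\<close>
      have "ennreal \<kappa> + ennreal (p * \<kappa>) * 1 \<le> ennreal \<kappa> + ennreal (p * \<kappa>) * (\<integral>\<^sup>+x. ennreal (h x) \<partial>M.vol (leaf y))"
        by (intro add_left_mono mult_left_mono h1) simp
      also have "\<dots> = (\<integral>\<^sup>+x. ennreal (f0 x powr p / jac x) + ennreal (p * \<kappa>) * ennreal (h x) \<partial>M.vol (leaf y))"
        unfolding L[symmetric] by (rule leaf_integral_affine[symmetric]) measurable
      also have "\<dots> \<le> (\<integral>\<^sup>+x. ennreal (h x powr p / jac x) + ennreal (p * \<kappa>) * ennreal (f0 x) \<partial>M.vol (leaf y))"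
      proof (rule nn_integral_mono)
        fix x assume x: "x \<in> space (M.vol (leaf y))"
        have j: "jac x > 0" by (rule jac_pos[OF leaf_points(1)[OF x]])
        have "f0 x powr p + p * f0 x powr (p - 1) * h x \<le> h x powr p + p * f0 x powr p"
          by (rule powr_tangent[OF p h_nonneg f0_nonneg])
        then have "(f0 x powr p + p * f0 x powr (p - 1) * h x) / jac x \<le> (h x powr p + p * f0 x powr p) / jac x"
          using j by (intro divide_right_mono) auto
        moreover have "(f0 x powr p + p * f0 x powr (p - 1) * h x) / jac x = f0 x powr p / jac x + p * \<kappa> * h x"
          unfolding f0_powr(1)[OF x] using j by (simp add: add_divide_distrib)
        moreover have "(h x powr p + p * f0 x powr p) / jac x = h x powr p / jac x + p * \<kappa> * f0 x"
          unfolding f0_powr(2)[OF x] using j by (simp add: add_divide_distrib)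
        ultimately have "f0 x powr p / jac x + p * \<kappa> * h x \<le> h x powr p / jac x + p * \<kappa> * f0 x" by simp
        then show "ennreal (f0 x powr p / jac x) + ennreal (p * \<kappa>) * ennreal (h x) \<le>
            ennreal (h x powr p / jac x) + ennreal (p * \<kappa>) * ennreal (f0 x)"
          using j p \<kappa> h_nonneg f0_nonneg by (simp add: ennreal_mult[symmetric] ennreal_plus[symmetric] del: ennreal_plus)
      qed
      also have "\<dots> = (\<integral>\<^sup>+x. ennreal (h x powr p / jac x) \<partial>M.vol (leaf y)) + ennreal (p * \<kappa>) * 1"
        unfolding leaf_f0[OF False my, symmetric] by (rule leaf_integral_affine) measurable
      finally show ?thesis unfolding L by simp
    qed
    \<comment> \<open>The coarea formula carries the Jacobian as a weight; dividing the integrand by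
      it beforehand recovers the unweighted integral on \<open>M\<close>.\<close>
    have cancel: "(\<integral>\<^sup>+x. ennreal (u x powr p) \<partial>\<mu>) = (\<integral>\<^sup>+y. (\<integral>\<^sup>+x. ennreal (u x powr p / jac x) \<partial>M.vol (leaf y)) \<partial>\<nu>)"
      if u[measurable]: "u \<in> borel_measurable borelM" for u
    proof -
      have "(\<integral>\<^sup>+x. ennreal (u x powr p) \<partial>\<mu>) = (\<integral>\<^sup>+x. ennreal (u x powr p / jac x) * ennreal (jac x) \<partial>\<mu>)"
      proof (rule nn_integral_cong)
        fix x assume "x \<in> space \<mu>"
        then have "jac x > 0" using jac_pos by (simp add: space_\<mu>)
        then show "ennreal (u x powr p) = ennreal (u x powr p / jac x) * ennreal (jac x)"
          by (simp add: ennreal_mult[symmetric])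
      qed
      also have "\<dots> = (\<integral>\<^sup>+y. (\<integral>\<^sup>+x. ennreal (u x powr p / jac x) \<partial>M.vol (leaf y)) \<partial>\<nu>)"
        by (rule coarea) measurable
      finally show ?thesis .
    qed
    have "(\<integral>\<^sup>+x. ennreal (f0 x powr p) \<partial>\<mu>) \<le> (\<integral>\<^sup>+x. ennreal (h x powr p) \<partial>\<mu>)"
      unfolding cancel[OF f0] cancel[OF h]
    proof (rule nn_integral_mono_AE)
      show "AE y in \<nu>. (\<integral>\<^sup>+x. ennreal (f0 x powr p / jac x) \<partial>M.vol (leaf y)) \<le> (\<integral>\<^sup>+x. ennreal (h x powr p / jac x) \<partial>M.vol (leaf y))"
        using null_set_leaves[OF Z(2)] null_set_leaves[OF Z'(2)] leaf_mass_finite_AE[OF C fin]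
        by eventually_elim (rule leafwise)
    qed
    also have "(\<integral>\<^sup>+x. ennreal (h x powr p) \<partial>\<mu>) = (\<integral>\<^sup>+x. ennreal (\<bar>f x\<bar> powr p) \<partial>\<mu>)"
      using \<open>AE x in \<mu>. f x = h x\<close> by (intro nn_integral_cong_AE) (auto simp: h_nonneg)
    finally show ?thesis .
  qed
  have Lp: "(\<integral>\<^sup>+x. ennreal (\<bar>f x\<bar> powr p) \<partial>\<mu>) = ennreal (LINT x|lebesgue_volume M (points M). \<bar>f x\<bar> powr p)"
    if "in_Lp M p f" for f
  proof -
    have "(\<integral>\<^sup>+x. ennreal (\<bar>f x\<bar> powr p) \<partial>completion \<mu>) = ennreal (LINT x|completion \<mu>. \<bar>f x\<bar> powr p)"
      using that by (intro nn_integral_eq_integral) (auto simp: in_Lp_def lebesgue_volume_def)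
    then show ?thesis by (simp add: nn_integral_completion lebesgue_volume_def)
  qed
  \<comment> \<open>Any admissible function will do: its finite norm bounds that of
    \<open>f0\<close>.\<close>
  obtain g where g: "g \<in> adm M \<Phi> p" using adm by auto
  have f0_Lp: "in_Lp M p f0"
  proof -
    have f0c: "f0 \<in> borel_measurable (completion \<mu>)" by (rule measurable_completion) measurable
    have "(\<integral>\<^sup>+x. ennreal (\<bar>f0 x\<bar> powr p) \<partial>completion \<mu>) < \<infinity>"
      using key[OF g] Lp[of g] g f0_nonneg by (simp add: nn_integral_completion adm_def le_less_trans)
    then have "integrable (completion \<mu>) (\<lambda>x. \<bar>f0 x\<bar> powr p)"
      using f0c by (intro integrableI_bounded) auto
    then show ?thesis using f0c by (simp add: in_Lp_def lebesgue_volume_def)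
  qed
  have f0_adm: "f0 \<in> adm M \<Phi> p"
    using f0_Lp f0_nonneg f0_leaves by (simp add: adm_def)
  have norm_le: "Lp_norm M p f0 \<le> Lp_norm M p f" if f: "f \<in> adm M \<Phi> p" for f
  proof -
    have "in_Lp M p f" using f by (simp add: adm_def)
    have "ennreal (LINT x|lebesgue_volume M (points M). \<bar>f0 x\<bar> powr p) \<le> ennreal (LINT x|lebesgue_volume M (points M). \<bar>f x\<bar> powr p)"
      using key[OF f] f0_nonneg unfolding Lp[OF f0_Lp, symmetric] Lp[OF \<open>in_Lp M p f\<close>, symmetric] by simp
    then have "(LINT x|lebesgue_volume M (points M). \<bar>f0 x\<bar> powr p) \<le> (LINT x|lebesgue_volume M (points M). \<bar>f x\<bar> powr p)"
      by (subst (asm) ennreal_le_iff) (auto intro: integral_nonneg_AE)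
    then show ?thesis unfolding Lp_norm_def using p by (intro powr_mono2) (auto intro: integral_nonneg_AE)
  qed
  have "modulus M \<Phi> p = ennreal (Lp_norm M p f0)"
    unfolding modulus_def using adm f0_adm norm_le
    by (auto intro!: antisym INF_lower INF_greatest ennreal_leI)
  then show ?thesis using f0_adm unfolding extremal_def by blast
qed

end

theorem corollary3p4:
  fixes M :: "('p::{t2_space, second_countable_topology}, 'm::euclidean_space) rmanifold"
    and N :: "('q::{t2_space, second_countable_topology}, 'n::euclidean_space) rmanifold"
    and \<Phi> :: "'p \<Rightarrow> 'q" and C p :: real
  assumes "riemannian_manifold M" and "riemannian_manifold N"
    and "submersion M N \<Phi>"
    and "\<forall>x\<in>points M. submersion_jacobian M N \<Phi> x < C"
    and "emeasure (lebesgue_volume M (points M)) (points M) < \<infinity>"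
    and "p > 1"
    and "adm M \<Phi> p \<noteq> {}"
  shows "(\<exists>f\<^sub>0. extremal M \<Phi> p f\<^sub>0) \<longleftrightarrow>
         \<Union>(infinite_leaves M \<Phi>) \<in> null_sets (lebesgue_volume M (points M))"
proof -
  interpret submersion_setup M N \<Phi>
    using assms(1-3) by unfold_locales
  have fin: "emeasure \<mu> (points M) < \<infinity>"
    using assms(5) sets.top[of \<mu>] by (simp add: lebesgue_volume_def space_\<mu>)
  have C: "\<forall>x\<in>points M. jac x < C" using assms(4) by (simp add: jac_def)
  show ?thesis
    using infinite_leaves_null[OF C fin] extremal_exists[OF C fin assms(6,7)] by simp
qed

end
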